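(* Let $\Gamma$ be the graph of a boat--star tiling of $\mathbb{R}^2$ (as defined in the context), with integrated density of states $k_\Gamma$, and let $k_\Gamma(4\pm)$ denote the one-sided limits of $k_\Gamma$ at $4$. Then $$k_\Gamma(4+)-k_\Gamma(4-)\ \ge\ \frac{65-29\sqrt5}{10}.$$
   Context: **Graphs, Laplacian, IDS.** The graph $\Gamma=(\mathcal{V},\mathcal{E})$ of a tiling of $\mathbb{R}^2$ by polygons has one vertex per tile; two vertices are joined ($u\sim v$) iff the corresponding (distinct) tiles share at least one edge (at most one graph edge is placed between two tiles, even if they share several edges). The Laplacian on $\ell^2(\mathcal{V})$ is $[\Delta_\Gamma\psi](v)=\sum_{u\sim v}(\psi(v)-\psi(u))$; the same formula defines the Laplacian of a finite graph. Let $\mathcal{V}_n\subseteq\mathcal{V}$ be the finite set of tiles meeting the closed ball of radius $n$ about the origin, $\Gamma_n$ the subgraph induced on $\mathcal{V}_n$, $\Delta_n$ its Laplacian, and $\nu_n(B)=\frac{1}{\#\mathcal{V}_n}\mathrm{Tr}\,\chi_B(\Delta_n)$ for Borel $B\subseteq\mathbb{R}$. For the tilings below it is known that $\nu_n$ converges weak-$*$ to a probability measure $\nu_\Gamma$ (the density of states measure), independent of the choice of suitable exhaustion. The integrated density of states is $k_\Gamma(E)=\nu_\Gamma((-\infty,E])$. **Boat--star tilings.** Let $\varphi=(1+\sqrt5)/2$. There are six tiles, all edges of length 1. *Star*: a regular pentagon (the core) of side $1/\varphi$ together with five "points", i.e. isosceles triangles with legs $1$ erected outward on its sides (apex angle $36^\circ$).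 *Boat*: for a regular pentagon $v_0v_1v_2v_3v_4$ of side $1/\varphi$ (its core), the union of the quadrilateral $v_0v_1v_2v_3$ and the points on the sides $v_0v_1$, $v_1v_2$ (the middle point), $v_2v_3$; the edge $v_3v_0$ (length 1) is its chord. *Diamond*: a rhombus with angles $36^\circ,144^\circ$, one of its two acute vertices being marked. *Pentagons*: regular, of side 1, of types $\alpha,\beta,\gamma$; types $\alpha$ and $\beta$ have one distinguished side, $\gamma$ has none. The substitution $S$ enlarges a tile by $\varphi^2$ to $Q$ and replaces $Q$ by the following unit-edge tiles. *$Q$ a pentagon* with sides $E_0,\dots,E_4$ in cyclic order ($E_0$ distinguished for $\alpha,\beta$) and vertices $V_{i,i+1}=E_i\cap E_{i+1}$ (indices mod 5): (i) a central pentagon of type $\gamma$, concentric with $Q$ and rotated by $180^\circ$ relative to $Q$; (ii) at each vertex $V_{i,i+1}$ a corner pentagon, the image of $Q$ under the homothety of ratio $\varphi^{-2}$ centered at $V_{i,i+1}$. Its sides are: one on $E_i$, one on $E_{i+1}$, the inner side (shared with the central pentagon), the side $g_i$ lying between the side on $E_i$ and the inner side, and the side $g_{i+1}$ lying between the side on $E_{i+1}$ and the inner side. If $Q$ is of type $\gamma$, all corners are of type $\beta$ with distinguished inner side. If $Q$ is of type $\beta$, the corners at $V_{4,0},V_{0,1}$ are of type $\alpha$ with distinguished side $g_0$, and the corners at $V_{1,2},V_{2,3},V_{3,4}$ are of type $\beta$ with distinguished inner side. If $Q$ is of type $\alpha$, the corners at $V_{0,1},V_{1,2}$ are of type $\alpha$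 with distinguished side $g_1$, those at $V_{3,4},V_{4,0}$ are of type $\alpha$ with distinguished side $g_4$, and that at $V_{2,3}$ is of type $\beta$ with distinguished inner side; (iii) a diamond centered at the midpoint of $E_i$, with long diagonal perpendicular to $E_i$ and marked at its acute vertex inside $Q$, for $i=0$ if $Q$ is of type $\beta$, for $i=1$ and $i=4$ if $Q$ is of type $\alpha$, and no diamond if $Q$ is of type $\gamma$. *$Q$ a star, boat or diamond*: let $K$ be the core (a regular pentagon of side $\varphi$) of the enlarged star or boat; for a diamond with marked tip $m$ and obtuse vertices $o_1,o_2$, let $K$ be the regular pentagon having $o_1o_2$ as a side and $m$ as its opposite vertex. Replace $Q$ by: a star whose five point-apexes are the vertices of $K$; and, for each tip $t$ of $Q$ (the five point-apexes of a star, the three point-apexes of a boat, the single unmarked acute vertex of a diamond), a boat whose middle point has apex $t$ and legs along the edges of $Q$ at $t$, together with a type-$\alpha$ pentagon whose distinguished side is the chord of that boat and which lies on the other side of that chord from the boat. A boat--star tiling is a tiling of $\mathbb{R}^2$ by these (decorated) tiles every finite patch of which occurs, up to rotation and translation, in $S^n(P)$ for some tile $P$ and some $n\in\mathbb{N}$ ($S$ is iterated tile by tile). *)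

theory Defs
  imports "HOL-Probability.Probability"
begin

(* The plane R^2 is identified with the complex numbers. *)

section \<open>Geometry of the tiles\<close>

definition phi :: real where
  "phi = (1 + sqrt 5) / 2"

definition zeta5 :: complex where
  "zeta5 = cis (2 * pi / 5)"

text \<open>Circumradius of a regular pentagon of side 1.\<close>
definition rho :: real where
  "rho = 1 / (2 * sin (pi / 5))"

text \<open>Vertices, in counterclockwise order, of the regular pentagon with centre \<open>c\<close> and
  circumradius vector \<open>r\<close> (its side length is \<open>norm r / rho\<close>). Indices are
  understood modulo 5, and side \<open>k\<close> joins vertex \<open>k\<close> to vertex \<open>k + 1\<close>.\<close>
definition vtx :: "complex \<Rightarrow> complex \<Rightarrow> nat \<Rightarrow> complex" where
  "vtx c r k = c + r * zeta5 ^ k"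

definition side :: "complex \<Rightarrow> complex \<Rightarrow> nat \<Rightarrow> complex set" where
  "side c r k = closed_segment (vtx c r k) (vtx c r (k + 1))"

text \<open>Apex of the outward isosceles triangle erected on side \<open>k\<close> with base angles
  \<open>72\<degree>\<close>, hence with apex angle \<open>36\<degree>\<close> and legs \<open>phi\<close> times the side.\<close>
definition apex :: "complex \<Rightarrow> complex \<Rightarrow> nat \<Rightarrow> complex" where
  "apex c r k = vtx c r k + phi *\<^sub>R (vtx c r (k + 1) - vtx c r k) * cnj zeta5"

definition point :: "complex \<Rightarrow> complex \<Rightarrow> nat \<Rightarrow> complex set" where
  "point c r k = convex hull {vtx c r k, apex c r k, vtx c r (k + 1)}"

definition legs :: "complex \<Rightarrow> complex \<Rightarrow> nat \<Rightarrow> complex set set" where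
  "legs c r k = {closed_segment (vtx c r k) (apex c r k),
                 closed_segment (apex c r k) (vtx c r (k + 1))}"

section \<open>Decorated tiles\<close>

datatype tile_kind = Star | Boat | Diamond | PAlpha | PBeta | PGamma

text \<open>A tile is represented by geometric data independent of any labelling of its vertices, so
  that equality of tiles is equality of decorated subsets of the plane. The mark is the
  distinguished side of an \<open>\<alpha>\<close>- or \<open>\<beta>\<close>-pentagon, the singleton of the marked vertex of a
  diamond, and empty otherwise.\<close>
datatype tile = Tile (kind: tile_kind) (region: "complex set")
  (edges: "complex set set") (mark: "complex set")

text \<open>Star and boat with core \<open>vtx c r 0, \<dots>, vtx c r 4\<close>. The middle point of the boat is
  the one on side 1.\<close>
definition star :: "complex \<Rightarrow> complex \<Rightarrow> tile" where
  "star c r = Tile Star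
     (convex hull (vtx c r ` {..<5}) \<union> (\<Union>k<5. point c r k))
     (\<Union>k<5. legs c r k) {}"

definition boat :: "complex \<Rightarrow> complex \<Rightarrow> tile" where
  "boat c r = Tile Boat
     (convex hull (vtx c r ` {0, 1, 2, 3}) \<union> (\<Union>k<3. point c r k))
     ((\<Union>k<3. legs c r k) \<union> {closed_segment (vtx c r 3) (vtx c r 0)}) {}"

text \<open>Vertices of the diamond with marked acute vertex \<open>m\<close> whose long diagonal points from
  \<open>m\<close> in direction \<open>u\<close>; its edges have length \<open>norm u\<close>. Vertices 1 and 3 are the obtuse
  ones, vertex 2 is the unmarked acute one.\<close>
definition dvtx :: "complex \<Rightarrow> complex \<Rightarrow> nat \<Rightarrow> complex" where
  "dvtx m u k = [m, m + u * cis (- pi / 10), m + u * cis (- pi / 10) + u * cis (pi / 10),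
                 m + u * cis (pi / 10)] ! k"

definition diamond :: "complex \<Rightarrow> complex \<Rightarrow> tile" where
  "diamond m u = Tile Diamond
     (convex hull (dvtx m u ` {..<4}))
     ((\<lambda>k. closed_segment (dvtx m u k) (dvtx m u ((k + 1) mod 4))) ` {..<4}) {m}"

definition pent :: "tile_kind \<Rightarrow> complex \<Rightarrow> complex \<Rightarrow> complex set \<Rightarrow> tile" where
  "pent \<kappa> c r D = Tile \<kappa> (convex hull (vtx c r ` {..<5})) (side c r ` {..<5}) D"

inductive is_tile :: "tile \<Rightarrow> bool" where
  "norm r = rho / phi \<Longrightarrow> is_tile (star c r)"
| "norm r = rho / phi \<Longrightarrow> is_tile (boat c r)"
| "norm u = 1 \<Longrightarrow> is_tile (diamond m u)"
| "norm r = rho \<Longrightarrow> is_tile (pent PAlpha c r (side c r 0))"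
| "norm r = rho \<Longrightarrow> is_tile (pent PBeta c r (side c r 0))"
| "norm r = rho \<Longrightarrow> is_tile (pent PGamma c r {})"

section \<open>The substitution\<close>

text \<open>The enlargement is \<open>z \<mapsto> phi\<^sup>2 z\<close>. For a pentagon with parameters \<open>c\<close>, \<open>r\<close>, the
  enlarged pentagon \<open>Q\<close> has sides \<open>E\<^sub>i = side (enl c) (enl r) i\<close>, hence
  \<open>V\<^sub>i\<^sub>,\<^sub>i\<^sub>+\<^sub>1 = vtx (enl c) (enl r) (i + 1)\<close>.\<close>
definition enl :: "complex \<Rightarrow> complex" where
  "enl z = phi\<^sup>2 *\<^sub>R z"

text \<open>Centre of the corner pentagon at \<open>V\<^sub>i\<^sub>,\<^sub>i\<^sub>+\<^sub>1\<close>, the image of \<open>Q\<close> under the homothety of ratio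
  \<open>phi\<^sup>-\<^sup>2\<close> centred there. That homothety preserves the labels of the sides and carries the
  circumradius vector \<open>enl r\<close> of \<open>Q\<close> to \<open>r\<close>.\<close>
definition corner_centre :: "complex \<Rightarrow> complex \<Rightarrow> nat \<Rightarrow> complex" where
  "corner_centre c r i =
     (let V = vtx (enl c) (enl r) (i + 1) in V + (1 / phi\<^sup>2) *\<^sub>R (enl c - V))"

definition corner :: "tile_kind \<Rightarrow> complex \<Rightarrow> complex \<Rightarrow> nat \<Rightarrow> nat \<Rightarrow> tile" where
  "corner \<kappa> c r i j =
     pent \<kappa> (corner_centre c r i) r (side (corner_centre c r i) r j)"

text \<open>In the corner pentagon at \<open>V\<^sub>i\<^sub>,\<^sub>i\<^sub>+\<^sub>1\<close>, the sides in counterclockwise order are the side on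
  \<open>E\<^sub>i\<close> (label \<open>i\<close>), the side on \<open>E\<^sub>i\<^sub>+\<^sub>1\<close> (label \<open>i + 1\<close>), \<open>g\<^sub>i\<^sub>+\<^sub>1\<close> (label \<open>i + 2\<close>), the inner
  side (label \<open>i + 3\<close>) and \<open>g\<^sub>i\<close> (label \<open>i + 4\<close>).\<close>
definition corner_inner :: "tile_kind \<Rightarrow> complex \<Rightarrow> complex \<Rightarrow> nat \<Rightarrow> tile" where
  "corner_inner \<kappa> c r i = corner \<kappa> c r i (i + 3)"

definition corner_g_next :: "tile_kind \<Rightarrow> complex \<Rightarrow> complex \<Rightarrow> nat \<Rightarrow> tile" where
  "corner_g_next \<kappa> c r i = corner \<kappa> c r i (i + 2)"

definition corner_g_this :: "tile_kind \<Rightarrow> complex \<Rightarrow> complex \<Rightarrow> nat \<Rightarrow> tile" where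
  "corner_g_this \<kappa> c r i = corner \<kappa> c r i (i + 4)"

text \<open>Diamond centred at the midpoint \<open>p\<close> of \<open>E\<^sub>i\<close>; \<open>n\<close> is the inward unit normal, and the
  half long diagonal has length \<open>cos (pi / 10)\<close>.\<close>
definition edge_diamond :: "complex \<Rightarrow> complex \<Rightarrow> nat \<Rightarrow> tile" where
  "edge_diamond c r i =
     (let p = midpoint (vtx (enl c) (enl r) i) (vtx (enl c) (enl r) (i + 1));
          n = sgn (enl c - p)
      in diamond (p + cos (pi / 10) *\<^sub>R n) (- n))"

text \<open>\<open>core t C R\<close>: the pentagon \<open>K\<close> of the enlarged tile has centre \<open>C\<close> and
  circumradius vector \<open>R\<close>.\<close>
inductive core :: "tile \<Rightarrow> complex \<Rightarrow> complex \<Rightarrow> bool" where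
  "core (star c r) (enl c) (enl r)"
| "core (boat c r) (enl c) (enl r)"
| "vtx C R 0 = enl m \<Longrightarrow>
   {vtx C R 2, vtx C R 3} = {enl (dvtx m u 1), enl (dvtx m u 3)} \<Longrightarrow>
   core (diamond m u) C R"

text \<open>\<open>tip t p a b\<close>: \<open>p\<close> is a tip of the enlarged tile, and the edges at \<open>p\<close> are
  those from \<open>p\<close> to \<open>a\<close> and \<open>b\<close>. For the boat below, the legs of its middle point occur
  in the same rotational sense as \<open>a\<close>, \<open>b\<close>.\<close>
inductive tip :: "tile \<Rightarrow> complex \<Rightarrow> complex \<Rightarrow> complex \<Rightarrow> bool" where
  "k < 5 \<Longrightarrow> tip (star c r) (enl (apex c r k)) (enl (vtx c r k)) (enl (vtx c r (k + 1)))"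
| "k < 3 \<Longrightarrow> tip (boat c r) (enl (apex c r k)) (enl (vtx c r k)) (enl (vtx c r (k + 1)))"
| "tip (diamond m u) (enl (dvtx m u 2)) (enl (dvtx m u 1)) (enl (dvtx m u 3))"

definition is_tip_boat ::
    "complex \<Rightarrow> complex \<Rightarrow> complex \<Rightarrow> complex \<Rightarrow> complex \<Rightarrow> bool" where
  "is_tip_boat p a b c r \<longleftrightarrow> norm r = rho / phi \<and> apex c r 1 = p \<and>
     vtx c r 1 \<in> closed_segment p a \<and> vtx c r 2 \<in> closed_segment p b"

text \<open>\<open>piece t t'\<close>: the tile \<open>t'\<close> belongs to \<open>S t\<close>.
  In the last rule the boat lies to the right of its chord directed from vertex 0 to vertex 3,
  and the pentagon, being numbered counterclockwise, to the left.\<close>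
inductive piece :: "tile \<Rightarrow> tile \<Rightarrow> bool" where
  gamma_centre: "piece (pent PGamma c r {}) (pent PGamma (enl c) (- r) {})"
| gamma_corner: "i < 5 \<Longrightarrow> piece (pent PGamma c r {}) (corner_inner PBeta c r i)"
| beta_centre: "piece (pent PBeta c r (side c r 0)) (pent PGamma (enl c) (- r) {})"
| beta_corner_40: "piece (pent PBeta c r (side c r 0)) (corner_g_next PAlpha c r 4)"
| beta_corner_01: "piece (pent PBeta c r (side c r 0)) (corner_g_this PAlpha c r 0)"
| beta_corner: "i \<in> {1, 2, 3} \<Longrightarrow>
    piece (pent PBeta c r (side c r 0)) (corner_inner PBeta c r i)"
| beta_diamond: "piece (pent PBeta c r (side c r 0)) (edge_diamond c r 0)"
| alpha_centre: "piece (pent PAlpha c r (side c r 0)) (pent PGamma (enl c) (- r) {})"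
| alpha_corner_01: "piece (pent PAlpha c r (side c r 0)) (corner_g_next PAlpha c r 0)"
| alpha_corner_12: "piece (pent PAlpha c r (side c r 0)) (corner_g_this PAlpha c r 1)"
| alpha_corner_34: "piece (pent PAlpha c r (side c r 0)) (corner_g_next PAlpha c r 3)"
| alpha_corner_40: "piece (pent PAlpha c r (side c r 0)) (corner_g_this PAlpha c r 4)"
| alpha_corner_23: "piece (pent PAlpha c r (side c r 0)) (corner_inner PBeta c r 2)"
| alpha_diamond: "i \<in> {1, 4} \<Longrightarrow> piece (pent PAlpha c r (side c r 0)) (edge_diamond c r i)"
| core_star: "core t C R \<Longrightarrow> norm r = rho / phi \<Longrightarrow>
    apex c r ` {..<5} = vtx C R ` {..<5} \<Longrightarrow> piece t (star c r)"
| boat_at_tip: "tip t p a b \<Longrightarrow> is_tip_boat p a b c r \<Longrightarrow> piece t (boat c r)"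
| pent_at_tip: "tip t p a b \<Longrightarrow> is_tip_boat p a b c r \<Longrightarrow>
    vtx c' r' 0 = vtx c r 0 \<Longrightarrow> vtx c' r' 1 = vtx c r 3 \<Longrightarrow>
    piece t (pent PAlpha c' r' (side c' r' 0))"

definition subst :: "tile set \<Rightarrow> tile set" where
  "subst F = {t'. \<exists>t\<in>F. piece t t'}"

section \<open>Boat-star tilings and their graphs\<close>

definition move :: "complex \<Rightarrow> complex \<Rightarrow> tile \<Rightarrow> tile" where
  "move a b t = (let g = (\<lambda>z. a * z + b) in
     Tile (kind t) (g ` region t) ((`) g ` edges t) (g ` mark t))"

definition is_tiling :: "tile set \<Rightarrow> bool" where
  "is_tiling T \<longleftrightarrow> (\<forall>t\<in>T. is_tile t) \<and> (\<Union>t\<in>T. region t) = UNIV \<and>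
     (\<forall>s\<in>T. \<forall>t\<in>T. s \<noteq> t \<longrightarrow> interior (region s) \<inter> interior (region t) = {})"

definition boat_star_tiling :: "tile set \<Rightarrow> bool" where
  "boat_star_tiling T \<longleftrightarrow> is_tiling T \<and>
     (\<forall>F. finite F \<and> F \<subseteq> T \<longrightarrow>
        (\<exists>P n a b. is_tile P \<and> norm a = 1 \<and> move a b ` F \<subseteq> (subst ^^ n) {P}))"

definition adj :: "tile \<Rightarrow> tile \<Rightarrow> bool" where
  "adj s t \<longleftrightarrow> s \<noteq> t \<and> edges s \<inter> edges t \<noteq> {}"

definition tiles_upto :: "tile set \<Rightarrow> nat \<Rightarrow> tile set" where
  "tiles_upto T n = {t \<in> T. region t \<inter> cball 0 (real n) \<noteq> {}}"

section \<open>Laplacian and density of states\<close>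

text \<open>A function on a vertex set \<open>V\<close> is represented by its extension by zero. The Laplacian
  is that of the subgraph induced on \<open>V\<close>.\<close>
definition functions_on :: "'v set \<Rightarrow> ('v \<Rightarrow> real) set" where
  "functions_on V = {f. \<forall>v. v \<notin> V \<longrightarrow> f v = 0}"

definition laplacian :: "'v set \<Rightarrow> ('v \<Rightarrow> 'v \<Rightarrow> bool) \<Rightarrow> ('v \<Rightarrow> real) \<Rightarrow> 'v \<Rightarrow> real" where
  "laplacian V E f v = (if v \<in> V then (\<Sum>u\<in>{u \<in> V. E u v}. f v - f u) else 0)"

definition inner_on :: "'v set \<Rightarrow> ('v \<Rightarrow> real) \<Rightarrow> ('v \<Rightarrow> real) \<Rightarrow> real" where
  "inner_on V f g = (\<Sum>v\<in>V. f v * g v)"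

definition orth_proj :: "'v set \<Rightarrow> ('v \<Rightarrow> real) set \<Rightarrow> ('v \<Rightarrow> real) \<Rightarrow> 'v \<Rightarrow> real" where
  "orth_proj V W f = (THE g. g \<in> W \<and> (\<forall>h\<in>W. inner_on V (\<lambda>v. f v - g v) h = 0))"

definition eigenspace ::
    "'v set \<Rightarrow> (('v \<Rightarrow> real) \<Rightarrow> 'v \<Rightarrow> real) \<Rightarrow> real \<Rightarrow> ('v \<Rightarrow> real) set" where
  "eigenspace V A l = {f \<in> functions_on V. \<forall>v\<in>V. A f v = l * f v}"

definition eigenvalues :: "'v set \<Rightarrow> (('v \<Rightarrow> real) \<Rightarrow> 'v \<Rightarrow> real) \<Rightarrow> real set" where
  "eigenvalues V A = {l. \<exists>f\<in>eigenspace V A l. \<exists>v\<in>V. f v \<noteq> 0}"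

text \<open>Functional calculus of a self-adjoint operator \<open>A\<close> on the functions on a finite set
  \<open>V\<close>: \<open>f(A) = \<Sum>\<^sub>l f(l) P\<^sub>l\<close>, where \<open>P\<^sub>l\<close> is the orthogonal projection onto the eigenspace
  for \<open>l\<close>.\<close>
definition functional_calculus ::
    "'v set \<Rightarrow> (('v \<Rightarrow> real) \<Rightarrow> 'v \<Rightarrow> real) \<Rightarrow> (real \<Rightarrow> real) \<Rightarrow> ('v \<Rightarrow> real) \<Rightarrow> 'v \<Rightarrow> real"
  where
  "functional_calculus V A f g v =
     (\<Sum>l\<in>eigenvalues V A. f l * orth_proj V (eigenspace V A l) g v)"

definition trace_on :: "'v set \<Rightarrow> (('v \<Rightarrow> real) \<Rightarrow> 'v \<Rightarrow> real) \<Rightarrow> real" where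
  "trace_on V A = (\<Sum>v\<in>V. A (indicator {v}) v)"

definition spectral_measure :: "'v set \<Rightarrow> ('v \<Rightarrow> 'v \<Rightarrow> bool) \<Rightarrow> real measure" where
  "spectral_measure V E = measure_of UNIV (sets borel)
     (\<lambda>B. ennreal (trace_on V (functional_calculus V (laplacian V E) (indicator B)) /
                   real (card V)))"

text \<open>The weak-* convergence is that of the dual of the space of continuous functions vanishing
  at infinity.\<close>
definition density_of_states :: "tile set \<Rightarrow> real measure \<Rightarrow> bool" where
  "density_of_states T \<nu> \<longleftrightarrow> real_distribution \<nu> \<and>
     (\<forall>f :: real \<Rightarrow> real. continuous_on UNIV f \<and> (f \<longlongrightarrow> 0) at_infinity \<longrightarrow>
        (\<lambda>n. \<integral>x. f x \<partial>spectral_measure (tiles_upto T n) adj) \<longlonglongrightarrow> (\<integral>x. f x \<partial>\<nu>))"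

definition ids :: "real measure \<Rightarrow> real \<Rightarrow> real" where
  "ids \<nu> E = cdf \<nu> E"

end

theory Submission imports Defs "HOL-Real_Asymp.Real_Asymp" begin

text \<open>
  An eigenvalue of the finite graphs that survives in the limit is produced by a finitely supported
  eigenfunction that recurs with positive frequency. Apply the substitution twice to any pentagon.
  The result contains a ring of ten \<alpha>-pentagons around its centre, pairwise not adjacent, each with
  exactly four neighbours. Give the ten pentagons the values \<open>1\<close> and \<open>-1\<close> alternately and all other
  tiles the value \<open>0\<close>. Every other tile meets as many positive as negative pentagons, so the Laplacian
  vanishes there, and on the ring it is multiplication by the degree: this is an eigenfunction for
  the eigenvalue \<open>4\<close>. It lives on the grandchildren of one pentagon, so different pentagons give
  disjointly supported eigenfunctions, and the mass of \<open>4\<close> is at least the number of pentagons two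
  levels up, divided by the number of tiles.

  That ratio is computed by the transfer operator \<open>transfer\<close> of the substitution on functions of the
  kind of a tile. On a four-dimensional invariant space its eigenvalues are \<open>phi ^ 4\<close>, \<open>4\<close>, \<open>1\<close> and
  \<open>phi ^ (-4)\<close>. Comparing the number of pentagons of a patch with the number of grandchildren of all
  its tiles, the coefficient of the dominant eigenvector vanishes precisely for the ratio \<open>(65 - 29 * sqrt 5) / 10\<close>
  (\<open>pent_excess\<close>); the rest grows like \<open>4 ^ i\<close>, the number of tiles like \<open>phi ^ (4 * i)\<close>.

  The plane geometry is replaced by exact arithmetic. In every supertile all centres of tiles lie in
  one translate of a rotated and scaled copy of the ring generated by \<open>zeta5\<close>, and a tile is determined
  by its kind, its position in that ring and one of ten directions (\<open>atile\<close>); \<open>piece_conc\<close> shows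
  that the substitution acts on such triples by a list of children (\<open>kids\<close>). The relative positions
  of two tiles of a supertile that are not far apart belong to a finite list (\<open>nbrs\<close>) that is closed
  under the substitution (\<open>coherent_kidset\<close>). Hence all statements on the surroundings of a ring
  reduce to finitely many inequalities between numbers \<open>A + B * phi\<close>. A tiling is not itself given
  with such coordinates, but its part that meets a ball is a finite patch, so it is contained in the image
  of one supertile (\<open>patch_realized\<close>). Conversely all tiles of that supertile with centre in the ball
  belong to the tiling: a centre lies in no other tile of the supertile (\<open>present\<close>).

  The supertile that realizes the tiles meeting a large ball is cut into supertiles of a fixed level.
  Those well inside the ball contribute rings with almost the right frequency; the other tiles lie in an
  annulus of bounded width and are negligible in number (\<open>supertile_stage\<close>). Finally the
  mass of a point can only grow in a vague limit (\<open>atom_ge_of_vague_limit\<close>), and the mass of \<open>4\<close> is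
  the jump of the integrated density of states.
\<close>

section \<open>Orthonormal systems of functions on a finite set\<close>

definition orthonormal :: "'v set \<Rightarrow> 'i set \<Rightarrow> ('i \<Rightarrow> 'v \<Rightarrow> real) \<Rightarrow> bool" where
  "orthonormal V I u \<longleftrightarrow> (\<forall>i\<in>I. \<forall>j\<in>I. inner_on V (u i) (u j) = (if i = j then 1 else 0))"

lemma inner_on_commute: "inner_on V f g = inner_on V g f"
  by (simp add: inner_on_def mult.commute)

lemma inner_on_sum_right:
  "inner_on V f (\<lambda>v. \<Sum>i\<in>I. c i * u i v) = (\<Sum>i\<in>I. c i * inner_on V f (u i))"
proof -
  have "inner_on V f (\<lambda>v. \<Sum>i\<in>I. c i * u i v) = (\<Sum>v\<in>V. \<Sum>i\<in>I. c i * (f v * u i v))"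
    by (simp add: inner_on_def sum_distrib_left mult.left_commute)
  also have "\<dots> = (\<Sum>i\<in>I. \<Sum>v\<in>V. c i * (f v * u i v))" by (rule sum.swap)
  finally show ?thesis by (simp add: inner_on_def sum_distrib_left)
qed

lemma inner_on_sum_left:
  "inner_on V (\<lambda>v. \<Sum>i\<in>I. c i * u i v) f = (\<Sum>i\<in>I. c i * inner_on V (u i) f)"
  by (subst inner_on_commute) (simp add: inner_on_sum_right inner_on_commute)

lemma inner_on_diff_left: "inner_on V (\<lambda>v. f v - g v) h = inner_on V f h - inner_on V g h"
  by (simp add: inner_on_def left_diff_distrib sum_subtractf)

lemma inner_on_diff_right: "inner_on V h (\<lambda>v. f v - g v) = inner_on V h f - inner_on V h g"
  by (simp add: inner_on_def right_diff_distrib sum_subtractf)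

lemma inner_on_scale_left: "inner_on V (\<lambda>v. c * f v) h = c * inner_on V f h"
  by (simp add: inner_on_def sum_distrib_left mult.assoc)

lemma inner_on_scale_right: "inner_on V h (\<lambda>v. c * f v) = c * inner_on V h f"
  by (simp add: inner_on_def sum_distrib_left mult.left_commute)

lemma inner_on_divide_left: "inner_on V (\<lambda>v. f v / c) h = inner_on V f h / c"
  using inner_on_scale_left[of V "1 / c" f h] by simp

lemma inner_on_divide_right: "inner_on V h (\<lambda>v. f v / c) = inner_on V h f / c"
  using inner_on_scale_right[of V h "1 / c" f] by simp

lemma inner_on_self_nonneg: "inner_on V f f \<ge> 0"
  by (simp add: inner_on_def sum_nonneg)

lemma inner_on_self_eq_0: "finite V \<Longrightarrow> inner_on V f f = 0 \<longleftrightarrow> (\<forall>v\<in>V. f v = 0)"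
  by (simp add: inner_on_def sum_nonneg_eq_0_iff)

lemma inner_on_indicator: "finite V \<Longrightarrow> v \<in> V \<Longrightarrow> inner_on V (indicator {v}) f = f v"
  by (simp add: inner_on_def indicator_def if_distrib[of "\<lambda>x. x * _"] sum.delta' cong: if_cong)

lemma inner_on_normalized:
  assumes "inner_on V f f > 0"
  shows "inner_on V (\<lambda>v. (1 / sqrt (inner_on V f f)) * f v) (\<lambda>v. (1 / sqrt (inner_on V f f)) * f v) = 1"
  unfolding inner_on_scale_left inner_on_scale_right using assms
  by (simp add: field_simps flip: power2_eq_square)

lemma orthonormal_expansion:
  assumes "finite I" "orthonormal V I u" "i \<in> I"
  shows "inner_on V (\<lambda>v. \<Sum>j\<in>I. c j * u j v) (u i) = c i"
proof -
  have "(\<Sum>j\<in>I. c j * inner_on V (u j) (u i)) = (\<Sum>j\<in>I. if i = j then c j else 0)"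
    using assms by (intro sum.cong) (auto simp: orthonormal_def)
  then show ?thesis using assms by (simp add: inner_on_sum_left)
qed

lemma bessel_inequality:
  assumes "finite I" "orthonormal V I u"
  shows "(\<Sum>i\<in>I. (inner_on V g (u i))\<^sup>2) \<le> inner_on V g g"
proof -
  define h where "h = (\<lambda>v. \<Sum>i\<in>I. inner_on V g (u i) * u i v)"
  have gh: "inner_on V g h = (\<Sum>i\<in>I. (inner_on V g (u i))\<^sup>2)"
    unfolding h_def inner_on_sum_right by (simp add: power2_eq_square)
  have "inner_on V h h = (\<Sum>i\<in>I. inner_on V g (u i) * inner_on V h (u i))"
    by (subst (2) h_def) (simp add: inner_on_sum_right)
  also have "\<dots> = (\<Sum>i\<in>I. (inner_on V g (u i))\<^sup>2)"
    using orthonormal_expansion[OF assms, of _ "\<lambda>i. inner_on V g (u i)"]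
    by (intro sum.cong) (simp_all add: h_def power2_eq_square)
  finally have "inner_on V (\<lambda>v. g v - h v) (\<lambda>v. g v - h v)
      = inner_on V g g - (\<Sum>i\<in>I. (inner_on V g (u i))\<^sup>2)"
    using gh inner_on_commute[of V g h] by (simp add: inner_on_diff_left inner_on_diff_right)
  then show ?thesis using inner_on_self_nonneg[of V "\<lambda>v. g v - h v"] by simp
qed

text \<open>Sum the inequality of Bessel over the indicators of the points.\<close>
lemma card_orthonormal_le:
  assumes "finite V" "finite I" "orthonormal V I u"
  shows "card I \<le> card V"
proof -
  have "real (card I) = (\<Sum>i\<in>I. inner_on V (u i) (u i))"
    using assms by (simp add: orthonormal_def)
  also have "\<dots> = (\<Sum>v\<in>V. \<Sum>i\<in>I. (u i v)\<^sup>2)"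
    unfolding inner_on_def by (subst sum.swap) (simp add: power2_eq_square)
  also have "\<dots> \<le> (\<Sum>v\<in>V. 1)"
  proof (rule sum_mono)
    fix v assume v: "v \<in> V"
    show "(\<Sum>i\<in>I. (u i v)\<^sup>2) \<le> 1"
      using bessel_inequality[OF assms(2,3), of "indicator {v}"] v assms(1)
      by (simp add: inner_on_indicator)
  qed
  finally show ?thesis by simp
qed

definition linear_subspace :: "'v set \<Rightarrow> ('v \<Rightarrow> real) set \<Rightarrow> bool" where
  "linear_subspace V W \<longleftrightarrow> W \<subseteq> functions_on V \<and> (\<lambda>v. 0) \<in> W \<and>
     (\<forall>f\<in>W. \<forall>g\<in>W. (\<lambda>v. f v - g v) \<in> W) \<and> (\<forall>f\<in>W. \<forall>c. (\<lambda>v. c * f v) \<in> W)"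

lemma linear_subspace_diff:
  "linear_subspace V W \<Longrightarrow> f \<in> W \<Longrightarrow> g \<in> W \<Longrightarrow> (\<lambda>v. f v - g v) \<in> W"
  by (simp add: linear_subspace_def)

lemma linear_subspace_scale:
  "linear_subspace V W \<Longrightarrow> f \<in> W \<Longrightarrow> (\<lambda>v. c * f v) \<in> W"
  by (simp add: linear_subspace_def)

lemma linear_subspace_sum:
  assumes W: "linear_subspace V W" and u: "\<And>i. i \<in> I \<Longrightarrow> u i \<in> W"
  shows "(\<lambda>v. \<Sum>i\<in>I. c i * u i v) \<in> W"
  using u
proof (induction I rule: infinite_finite_induct)
  case (insert i I)
  have 1: "(\<lambda>v. c i * u i v) \<in> W"
    by (rule linear_subspace_scale[OF W]) (simp add: insert.prems)
  have 2: "(\<lambda>v. (-1) * (\<Sum>i\<in>I. c i * u i v)) \<in> W"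
    by (rule linear_subspace_scale[OF W], rule insert.IH) (simp add: insert.prems)
  show ?case using linear_subspace_diff[OF W 1 2] insert.hyps by simp
qed (use W in \<open>auto simp: linear_subspace_def\<close>)

text \<open>An orthonormal system in the subspace with the largest number of members spans it, since the
  rejection of a further vector could be normalized and added.\<close>
lemma orthonormal_basis_exists:
  assumes V: "finite V" and W: "linear_subspace V W"
  shows "\<exists>(k::nat) u. orthonormal V {..<k} u \<and> (\<forall>i<k. u i \<in> W) \<and>
    (\<forall>w\<in>W. w = (\<lambda>v. \<Sum>i<k. inner_on V w (u i) * u i v))"
proof -
  define Q where "Q k u \<longleftrightarrow> orthonormal V {..<k} u \<and> (\<forall>i<k. u i \<in> W)" for k :: nat and u
  have "Q 0 (\<lambda>_ _. 0)" by (simp add: Q_def orthonormal_def)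
  moreover have "\<forall>k. (\<exists>u. Q k u) \<longrightarrow> k \<le> card V"
    using card_orthonormal_le[OF V, of "{..<_::nat}"] by (auto simp: Q_def)
  ultimately obtain k where k: "\<exists>u. Q k u" and max: "\<And>k'. \<exists>u. Q k' u \<Longrightarrow> k' \<le> k"
    using Nat.ex_has_greatest_nat[of "\<lambda>k. \<exists>u. Q k u" 0 "card V"] by metis
  from k obtain u where u: "orthonormal V {..<k} u" "\<And>i. i < k \<Longrightarrow> u i \<in> W"
    by (auto simp: Q_def)
  have span: "w = (\<lambda>v. \<Sum>i<k. inner_on V w (u i) * u i v)" if w: "w \<in> W" for w
  proof (rule ccontr)
    assume neq: "w \<noteq> (\<lambda>v. \<Sum>i<k. inner_on V w (u i) * u i v)"
    define p where "p = (\<lambda>v. \<Sum>i<k. inner_on V w (u i) * u i v)"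
    define r where "r = (\<lambda>v. w v - p v)"
    have "p \<in> W" unfolding p_def using linear_subspace_sum[OF W, of "{..<k}" u] u(2) by simp
    then have rW: "r \<in> W" unfolding r_def by (intro linear_subspace_diff[OF W] w)
    have r_orth: "inner_on V r (u i) = 0" if "i < k" for i
      using orthonormal_expansion[OF _ u(1), of i "\<lambda>i. inner_on V w (u i)"] that
      by (simp add: r_def p_def inner_on_diff_left)
    have "r \<noteq> (\<lambda>v. 0)" using neq by (auto simp: r_def p_def fun_eq_iff)
    then have "\<exists>v\<in>V. r v \<noteq> 0"
      using rW W by (auto simp: fun_eq_iff linear_subspace_def functions_on_def)
    then have pos: "inner_on V r r > 0"
      using inner_on_self_eq_0[OF V, of r] inner_on_self_nonneg[of V r] by auto
    define s where "s = (\<lambda>v. (1 / sqrt (inner_on V r r)) * r v)"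
    have s1: "inner_on V s s = 1" unfolding s_def by (rule inner_on_normalized[OF pos])
    have s0: "inner_on V s (u i) = 0" "inner_on V (u i) s = 0" if "i < k" for i
      using r_orth[OF that] by (simp_all add: s_def inner_on_divide_left inner_on_commute[of V "u i"])
    have "s \<in> W" unfolding s_def by (rule linear_subspace_scale[OF W rW])
    then have "Q (Suc k) (u(k := s))"
      using u s1 s0 by (auto simp: Q_def orthonormal_def less_Suc_eq)
    then show False using max[of "Suc k"] by auto
  qed
  have "orthonormal V {..<k} u \<and> (\<forall>i<k. u i \<in> W) \<and>
    (\<forall>w\<in>W. w = (\<lambda>v. \<Sum>i<k. inner_on V w (u i) * u i v))"
    by (intro conjI ballI allI impI) (assumption | rule u | rule span)+
  then show ?thesis by (intro exI)
qed

lemma orth_proj_eq: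
  assumes V: "finite V" and W: "linear_subspace V W"
    and u: "orthonormal V {..<k} u" "\<And>i. i < (k::nat) \<Longrightarrow> u i \<in> W"
    and span: "\<And>w. w \<in> W \<Longrightarrow> w = (\<lambda>v. \<Sum>i<k. inner_on V w (u i) * u i v)"
  shows "orth_proj V W f = (\<lambda>v. \<Sum>i<k. inner_on V f (u i) * u i v)"
    (is "_ = ?p")
  unfolding orth_proj_def
proof (rule the_equality)
  have pW: "?p \<in> W" using linear_subspace_sum[OF W, of "{..<k}" u] u(2) by simp
  have orth: "inner_on V (\<lambda>v. f v - ?p v) h = 0" if h: "h \<in> W" for h
  proof -
    have z: "inner_on V (\<lambda>v. f v - ?p v) (u i) = 0" if "i < k" for i
      using orthonormal_expansion[OF _ u(1), of i "\<lambda>i. inner_on V f (u i)"] that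
      by (simp add: inner_on_diff_left)
    have "inner_on V (\<lambda>v. f v - ?p v) h
        = inner_on V (\<lambda>v. f v - ?p v) (\<lambda>v. \<Sum>i<k. inner_on V h (u i) * u i v)"
      by (rule arg_cong[OF span[OF h]])
    also have "\<dots> = 0" by (subst inner_on_sum_right) (simp add: z)
    finally show ?thesis .
  qed
  then show "?p \<in> W \<and> (\<forall>h\<in>W. inner_on V (\<lambda>v. f v - ?p v) h = 0)" using pW by blast
  fix g assume g: "g \<in> W \<and> (\<forall>h\<in>W. inner_on V (\<lambda>v. f v - g v) h = 0)"
  define d where "d = (\<lambda>v. g v - ?p v)"
  have dW: "d \<in> W" unfolding d_def using g pW by (intro linear_subspace_diff[OF W]) auto
  have "inner_on V d d = inner_on V (\<lambda>v. f v - ?p v) d - inner_on V (\<lambda>v. f v - g v) d"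
    by (simp add: d_def inner_on_diff_left)
  then have "inner_on V d d = 0" using orth[OF dW] g dW by simp
  then have "\<forall>v\<in>V. d v = 0" using inner_on_self_eq_0[OF V] by blast
  moreover have "\<forall>v. v \<notin> V \<longrightarrow> d v = 0"
    using dW W by (auto simp: linear_subspace_def functions_on_def)
  ultimately show "g = ?p" by (auto simp: d_def fun_eq_iff)
qed

text \<open>The trace of an orthogonal projection is the dimension of its range; the last clause is the
  form in which this is needed.\<close>
lemma trace_orth_proj:
  assumes V: "finite V" and W: "linear_subspace V W"
  shows "trace_on V (orth_proj V W) \<ge> 0"
    and "finite J \<Longrightarrow> orthonormal V J g \<Longrightarrow> (\<And>j. j \<in> J \<Longrightarrow> g j \<in> W) \<Longrightarrow>
      real (card J) \<le> trace_on V (orth_proj V W)"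
proof -
  obtain k :: nat and u where ku: "orthonormal V {..<k} u \<and> (\<forall>i<k. u i \<in> W) \<and>
    (\<forall>w\<in>W. w = (\<lambda>v. \<Sum>i<k. inner_on V w (u i) * u i v))"
    using orthonormal_basis_exists[OF V W] by (elim exE) (rule that)
  have u: "orthonormal V {..<k} u" using ku by (rule conjunct1)
  have uW: "u i \<in> W" if "i < k" for i using conjunct1[OF conjunct2[OF ku]] that by blast
  have span: "w = (\<lambda>v. \<Sum>i<k. inner_on V w (u i) * u i v)" if "w \<in> W" for w
    by (rule bspec[OF conjunct2[OF conjunct2[OF ku]] that])
  have "trace_on V (orth_proj V W) = (\<Sum>v\<in>V. \<Sum>i<k. u i v * u i v)"
    unfolding trace_on_def using V by (simp add: orth_proj_eq[OF V W u uW span] inner_on_indicator)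
  also have "\<dots> = (\<Sum>i<k. inner_on V (u i) (u i))"
    unfolding inner_on_def by (rule sum.swap)
  finally have tr: "trace_on V (orth_proj V W) = (\<Sum>i<k. inner_on V (u i) (u i))" .
  then show "trace_on V (orth_proj V W) \<ge> 0" by (simp add: sum_nonneg inner_on_self_nonneg)
  assume J: "finite J" "orthonormal V J g" "\<And>j. j \<in> J \<Longrightarrow> g j \<in> W"
  have "real (card J) = (\<Sum>j\<in>J. inner_on V (g j) (g j))"
    using J by (simp add: orthonormal_def)
  also have "\<dots> = (\<Sum>j\<in>J. \<Sum>i<k. (inner_on V (g j) (u i))\<^sup>2)"
  proof (rule sum.cong)
    fix j assume "j \<in> J"
    have "inner_on V (g j) (g j) = inner_on V (g j) (\<lambda>v. \<Sum>i<k. inner_on V (g j) (u i) * u i v)"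
      by (rule arg_cong[OF span[OF J(3)[OF \<open>j \<in> J\<close>]]])
    then show "inner_on V (g j) (g j) = (\<Sum>i<k. (inner_on V (g j) (u i))\<^sup>2)"
      by (simp add: inner_on_sum_right power2_eq_square)
  qed simp
  also have "\<dots> = (\<Sum>i<k. \<Sum>j\<in>J. (inner_on V (u i) (g j))\<^sup>2)"
    by (subst sum.swap) (simp add: inner_on_commute)
  also have "\<dots> \<le> (\<Sum>i<k. inner_on V (u i) (u i))"
    by (intro sum_mono bessel_inequality J)
  finally show "real (card J) \<le> trace_on V (orth_proj V W)" using tr by simp
qed

section \<open>The spectral measure of a finite graph\<close>

lemma laplacian_symmetric:
  assumes V: "finite V" and E: "\<And>u v. E u v \<longleftrightarrow> E v u"
  shows "inner_on V (laplacian V E f) g = inner_on V f (laplacian V E g)"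
proof -
  have *: "inner_on V (laplacian V E f) g
      = (\<Sum>v\<in>V. \<Sum>u\<in>V. if E u v then f v * g v else 0) - (\<Sum>v\<in>V. \<Sum>u\<in>V. if E u v then f u * g v else 0)"
    for f g
    unfolding inner_on_def laplacian_def sum_subtractf[symmetric] sum_distrib_right
    using V by (intro sum.cong refl) (auto simp: sum.If_cases sum_distrib_right sum_subtractf
        Int_def left_diff_distrib)
  have "(\<Sum>v\<in>V. \<Sum>u\<in>V. if E u v then f u * g v else 0) = (\<Sum>v\<in>V. \<Sum>u\<in>V. if E u v then g u * f v else 0)"
    by (subst sum.swap) (intro sum.cong refl, use E in \<open>auto simp: mult.commute\<close>)
  moreover have "(\<Sum>v\<in>V. \<Sum>u\<in>V. if E u v then f v * g v else 0) = (\<Sum>v\<in>V. \<Sum>u\<in>V. if E u v then g v * f v else 0)"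
    by (intro sum.cong refl) (simp add: mult.commute)
  ultimately show ?thesis using *[of f g] *[of g f] by (simp add: inner_on_commute[of V f])
qed

lemma laplacian_diff: "laplacian V E (\<lambda>v. f v - g v) v = laplacian V E f v - laplacian V E g v"
proof -
  have "f v - g v - (f u - g u) = (f v - f u) - (g v - g u)" for u by simp
  then show ?thesis by (simp only: laplacian_def sum_subtractf) simp
qed

lemma laplacian_scale: "laplacian V E (\<lambda>v. c * f v) v = c * laplacian V E f v"
  by (auto simp: laplacian_def sum_distrib_left right_diff_distrib)

lemma linear_subspace_eigenspace: "linear_subspace V (eigenspace V (laplacian V E) l)"
  unfolding linear_subspace_def eigenspace_def functions_on_def
  by (auto simp: laplacian_diff laplacian_scale right_diff_distrib) (simp add: laplacian_def)

text \<open>Eigenfunctions for different eigenvalues are orthogonal, so there are at most as many eigenvalues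
  as vertices.\<close>
lemma finite_eigenvalues:
  assumes V: "finite V" and E: "\<And>u v. E u v \<longleftrightarrow> E v u"
  shows "finite (eigenvalues V (laplacian V E))"
proof (rule ccontr)
  let ?L = "laplacian V E"
  assume "infinite (eigenvalues V ?L)"
  then obtain A where A: "A \<subseteq> eigenvalues V ?L" "finite A" "card A = Suc (card V)"
    using infinite_arbitrarily_large by blast
  then have "\<forall>l\<in>A. \<exists>f. f \<in> eigenspace V ?L l \<and> (\<exists>v\<in>V. f v \<noteq> 0)"
    by (force simp: eigenvalues_def)
  then obtain f where f: "\<And>l. l \<in> A \<Longrightarrow> f l \<in> eigenspace V ?L l"
    and nz: "\<And>l. l \<in> A \<Longrightarrow> \<exists>v\<in>V. f l v \<noteq> 0" by metis
  have pos: "inner_on V (f l) (f l) > 0" if "l \<in> A" for l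
    using nz[OF that] inner_on_self_eq_0[OF V, of "f l"] inner_on_self_nonneg[of V "f l"] by auto
  define u where "u l = (\<lambda>v. (1 / sqrt (inner_on V (f l) (f l))) * f l v)" for l
  have orth: "inner_on V (f l) (f m) = 0" if "l \<in> A" "m \<in> A" "l \<noteq> m" for l m
  proof -
    have "inner_on V (?L (f l)) (f m) = l * inner_on V (f l) (f m)"
      using f[OF that(1)] by (simp add: inner_on_def eigenspace_def sum_distrib_left mult.assoc)
    moreover have "inner_on V (f l) (?L (f m)) = m * inner_on V (f l) (f m)"
      using f[OF that(2)]
      by (simp add: inner_on_def eigenspace_def sum_distrib_left mult.assoc mult.left_commute)
    ultimately show ?thesis using laplacian_symmetric[OF V E, where f = "f l" and g = "f m"] that(3) by simp
  qed
  have "orthonormal V A u"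
    unfolding orthonormal_def
  proof (intro ballI)
    fix l m assume "l \<in> A" "m \<in> A"
    then show "inner_on V (u l) (u m) = (if l = m then 1 else 0)"
      using orth[of l m] inner_on_normalized[OF pos[OF \<open>l \<in> A\<close>]]
      by (cases "l = m") (simp_all add: u_def inner_on_divide_left inner_on_divide_right)
  qed
  from card_orthonormal_le[OF V A(2) this] A(3) show False by simp
qed

text \<open>The trace of \<open>\<chi>\<^sub>B(\<Delta>)\<close> is a finite sum of the multiplicities of the eigenvalues in \<open>B\<close>;
  in particular the set function that defines the spectral measure is countably additive.\<close>
lemma spectral_measure_finite_sum:
  fixes V :: "'v set" and E
  assumes V: "finite V" and E: "\<And>u v. E u v \<longleftrightarrow> E v u"
  defines "S \<equiv> eigenvalues V (laplacian V E)"
    and "\<tau> \<equiv> \<lambda>l. trace_on V (orth_proj V (eigenspace V (laplacian V E) l))"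
  shows "sets (spectral_measure V E) = sets borel"
    and "B \<in> sets borel \<Longrightarrow>
      emeasure (spectral_measure V E) B = ennreal ((\<Sum>l\<in>S \<inter> B. \<tau> l) / real (card V))"
proof -
  have S: "finite S" unfolding S_def by (rule finite_eigenvalues[OF V E])
  have \<tau>: "\<tau> l \<ge> 0" for l
    unfolding \<tau>_def by (rule trace_orth_proj(1)[OF V linear_subspace_eigenspace])
  have tr: "trace_on V (functional_calculus V (laplacian V E) (indicator B)) = (\<Sum>l\<in>S \<inter> B. \<tau> l)" for B
  proof -
    have "trace_on V (functional_calculus V (laplacian V E) (indicator B))
        = (\<Sum>l\<in>S. indicator B l * \<tau> l)"
      unfolding trace_on_def functional_calculus_def S_def \<tau>_def sum_distrib_left
      by (rule sum.swap)
    also have "\<dots> = (\<Sum>l\<in>S. if l \<in> B then \<tau> l else 0)"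
      by (intro sum.cong) (auto simp: indicator_def)
    also have "\<dots> = (\<Sum>l\<in>S \<inter> B. \<tau> l)"
      using S by (simp add: sum.inter_restrict)
    finally show ?thesis .
  qed
  define M where "M = distr (point_measure S (\<lambda>l. ennreal (\<tau> l / real (card V)))) borel (\<lambda>x. x)"
  have M: "emeasure M B = ennreal ((\<Sum>l\<in>S \<inter> B. \<tau> l) / real (card V))" if "B \<in> sets borel" for B
  proof -
    have "emeasure M B = emeasure (point_measure S (\<lambda>l. ennreal (\<tau> l / real (card V)))) (S \<inter> B)"
      unfolding M_def using that
      by (subst emeasure_distr) (auto simp: space_point_measure measurable_point_measure_eq1 Int_commute)
    also have "\<dots> = (\<Sum>l\<in>S \<inter> B. ennreal (\<tau> l / real (card V)))"
      using S by (intro emeasure_point_measure_finite) auto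
    also have "\<dots> = ennreal ((\<Sum>l\<in>S \<inter> B. \<tau> l) / real (card V))"
      using \<tau> by (simp add: sum_divide_distrib sum_ennreal)
    finally show ?thesis .
  qed
  have "space M = UNIV" "sets M = sets borel" by (simp_all add: M_def)
  moreover have "measure_of UNIV (sets borel) (\<lambda>B. ennreal ((\<Sum>l\<in>S \<inter> B. \<tau> l) / real (card V)))
      = measure_of UNIV (sets borel) (emeasure M)"
    using sets.sigma_sets_eq[of "borel :: real measure"] by (intro measure_of_eq) (auto simp: M)
  ultimately have "spectral_measure V E = measure_of (space M) (sets M) (emeasure M)"
    unfolding spectral_measure_def tr by simp
  then have "spectral_measure V E = M" by (simp add: measure_of_of_measure)
  then show "sets (spectral_measure V E) = sets borel"
    and "B \<in> sets borel \<Longrightarrow>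
      emeasure (spectral_measure V E) B = ennreal ((\<Sum>l\<in>S \<inter> B. \<tau> l) / real (card V))"
    using M by (auto simp: M_def)
qed

text \<open>Disjointly supported eigenfunctions are linearly independent, so each of them contributes
  to the mass of the eigenvalue.\<close>
lemma spectral_measure_atom_ge:
  assumes V: "finite V" "V \<noteq> {}" and E: "\<And>u v. E u v \<longleftrightarrow> E v u"
    and J: "finite J" "\<And>j. j \<in> J \<Longrightarrow> f j \<in> eigenspace V (laplacian V E) l"
    and nz: "\<And>j. j \<in> J \<Longrightarrow> \<exists>v\<in>V. f j v \<noteq> 0"
    and disj: "\<And>i j v. i \<in> J \<Longrightarrow> j \<in> J \<Longrightarrow> i \<noteq> j \<Longrightarrow> f i v = 0 \<or> f j v = (0::real)"
  shows "finite_measure (spectral_measure V E)"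
    and "real (card J) / real (card V) \<le> measure (spectral_measure V E) {l}"
proof -
  note sm = spectral_measure_finite_sum[OF V(1) E]
  have "space (spectral_measure V E) = UNIV"
    using sets_eq_imp_space_eq[OF sm(1)] by simp
  then show fm: "finite_measure (spectral_measure V E)"
    by (intro finite_measureI) (simp add: sm(2))
  let ?W = "eigenspace V (laplacian V E) l"
  let ?\<tau> = "trace_on V (orth_proj V ?W)"
  have pos: "inner_on V (f j) (f j) > 0" if "j \<in> J" for j
    using nz[OF that] inner_on_self_eq_0[OF V(1), of "f j"] inner_on_self_nonneg[of V "f j"] by auto
  define g where "g j = (\<lambda>v. (1 / sqrt (inner_on V (f j) (f j))) * f j v)" for j
  have "orthonormal V J g"
    unfolding orthonormal_def
  proof (intro ballI)
    fix i j assume ij: "i \<in> J" "j \<in> J"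
    show "inner_on V (g i) (g j) = (if i = j then 1 else 0)"
    proof (cases "i = j")
      case True
      then show ?thesis using inner_on_normalized[OF pos[OF ij(1)]] by (simp add: g_def)
    next
      case False
      have "inner_on V (f i) (f j) = 0"
        unfolding inner_on_def using disj[OF ij False] by (intro sum.neutral) auto
      with False show ?thesis by (simp add: g_def inner_on_divide_left inner_on_divide_right)
    qed
  qed
  moreover have "g j \<in> ?W" if "j \<in> J" for j
    unfolding g_def by (intro linear_subspace_scale[OF linear_subspace_eigenspace] J(2) that)
  ultimately have le: "real (card J) \<le> ?\<tau>"
    using trace_orth_proj(2)[OF V(1) linear_subspace_eigenspace J(1)] by blast
  show "real (card J) / real (card V) \<le> measure (spectral_measure V E) {l}"
  proof (cases "J = {}")
    case False
    then have l: "l \<in> eigenvalues V (laplacian V E)"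
      using J(2) nz by (auto simp: eigenvalues_def)
    have "emeasure (spectral_measure V E) {l} = ennreal (?\<tau> / real (card V))"
      by (subst sm(2)) (use l in \<open>auto simp: Int_absorb1\<close>)
    then have "measure (spectral_measure V E) {l} = ?\<tau> / real (card V)"
      using le by (simp add: measure_def)
    with le show ?thesis by (simp add: divide_right_mono)
  qed simp
qed

section \<open>From finite graphs to the density of states\<close>

lemma jump_of_ids:
  assumes "real_distribution \<nu>"
  shows "Lim (at_right x) (ids \<nu>) - Lim (at_left x) (ids \<nu>) = measure \<nu> {x}"
proof -
  interpret real_distribution \<nu> by fact
  have ids: "ids \<nu> = cdf \<nu>" by (auto simp: ids_def)
  have "(cdf \<nu> \<longlongrightarrow> cdf \<nu> x) (at_right x)"
    using cdf_is_right_cont[of x] by (simp add: continuous_within)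
  then have r: "Lim (at_right x) (cdf \<nu>) = cdf \<nu> x" by (intro tendsto_Lim) auto
  have l: "Lim (at_left x) (cdf \<nu>) = measure \<nu> {..<x}"
    using cdf_at_left[of x] by (intro tendsto_Lim) auto
  have "measure \<nu> {..x} = measure \<nu> {..<x} + measure \<nu> {x}"
    by (subst finite_measure_Union[symmetric]) (auto intro: arg_cong[where f = "measure \<nu>"])
  then show ?thesis unfolding ids r l by (simp add: cdf_def)
qed

text \<open>Continuous functions that decrease to the indicator of \<open>{x}\<close>.\<close>
definition tent :: "nat \<Rightarrow> real \<Rightarrow> real \<Rightarrow> real" where
  "tent k x y = max 0 (1 - real k * \<bar>y - x\<bar>)"

lemma tent_bounds: "0 \<le> tent k x y" "tent k x y \<le> 1" "tent k x x = 1"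
  by (auto simp: tent_def)

lemma continuous_tent: "continuous_on UNIV (tent k x)"
  unfolding tent_def by (intro continuous_intros)

lemma tent_at_infinity:
  assumes "k > 0"
  shows "(tent k x \<longlongrightarrow> 0) at_infinity"
proof (rule tendsto_eventually)
  have "tent k x y = 0" if "\<bar>x\<bar> + 1 \<le> norm y" for y
  proof -
    have "1 * 1 \<le> real k * \<bar>y - x\<bar>" using that assms by (intro mult_mono) auto
    then show ?thesis by (simp add: tent_def)
  qed
  then show "\<forall>\<^sub>F y in at_infinity. tent k x y = 0" unfolding eventually_at_infinity by blast
qed

text \<open>Vague convergence cannot decrease the mass of a point in the limit: test with tent functions
  shrinking to the point.\<close>
lemma atom_ge_of_vague_limit:
  assumes \<nu>: "density_of_states T \<nu>"
    and ev: "\<And>\<epsilon>. \<epsilon> > 0 \<Longrightarrow> \<forall>\<^sub>F n in sequentially.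
      finite_measure (spectral_measure (tiles_upto T n) adj) \<and>
      sets (spectral_measure (tiles_upto T n) adj) = sets borel \<and>
      c - \<epsilon> \<le> measure (spectral_measure (tiles_upto T n) adj) {x}"
  shows "c \<le> measure \<nu> {x}"
proof -
  let ?M = "\<lambda>n. spectral_measure (tiles_upto T n) adj"
  have \<nu>1: "real_distribution \<nu>" using \<nu> by (simp add: density_of_states_def)
  interpret \<nu>: real_distribution \<nu> by fact
  have tent_meas: "tent k x \<in> borel_measurable borel" for k
    using continuous_tent by (rule borel_measurable_continuous_onI)
  have lower: "c \<le> (\<integral>y. tent k x y \<partial>\<nu>)" if k: "k > 0" for k
  proof (rule field_le_epsilon)
    fix \<epsilon> :: real assume e: "\<epsilon> > 0"
    have lim: "(\<lambda>n. \<integral>y. tent k x y \<partial>?M n) \<longlonglongrightarrow> (\<integral>y. tent k x y \<partial>\<nu>)"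
      using \<nu> continuous_tent[of k x] tent_at_infinity[OF k, of x] by (simp add: density_of_states_def)
    have "\<forall>\<^sub>F n in sequentially. c - \<epsilon> \<le> (\<integral>y. tent k x y \<partial>?M n)"
      using ev[OF e]
    proof eventually_elim
      case (elim n)
      then interpret M: finite_measure "?M n" by simp
      have meas: "tent k x \<in> borel_measurable (?M n)" "{x} \<in> sets (?M n)"
        using elim tent_meas by (auto cong: measurable_cong_sets)
      have int1: "integrable (?M n) (tent k x)"
        by (rule M.integrable_const_bound[where B = 1]) (use meas tent_bounds in auto)
      have int2: "integrable (?M n) (indicator {x} :: real \<Rightarrow> real)"
        by (rule M.integrable_const_bound[where B = 1]) (use meas in auto)
      have "measure (?M n) {x} = (\<integral>y. indicator {x} y \<partial>?M n)" using meas by simp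
      also have "\<dots> \<le> (\<integral>y. tent k x y \<partial>?M n)"
        using tent_bounds by (intro integral_mono int1 int2) (simp add: indicator_def)
      finally show ?case using elim by simp
    qed
    then have "c - \<epsilon> \<le> (\<integral>y. tent k x y \<partial>\<nu>)"
      using tendsto_lowerbound[OF lim] by simp
    then show "c \<le> (\<integral>y. tent k x y \<partial>\<nu>) + \<epsilon>" by simp
  qed
  have "(\<lambda>k. \<integral>y. tent k x y \<partial>\<nu>) \<longlonglongrightarrow> (\<integral>y. indicator {x} y \<partial>\<nu>)"
  proof (rule integral_dominated_convergence[where w = "\<lambda>_. 1"])
    show "AE y in \<nu>. (\<lambda>k. tent k x y) \<longlonglongrightarrow> indicator {x} y"
    proof (rule AE_I2)
      fix y
      show "(\<lambda>k. tent k x y) \<longlonglongrightarrow> indicator {x} y"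
      proof (cases "y = x")
        case False
        obtain m where m: "1 < real m * \<bar>y - x\<bar>"
          using reals_Archimedean3[of "\<bar>y - x\<bar>"] False by auto
        have "tent k x y = 0" if "k \<ge> m" for k
        proof -
          have "real m * \<bar>y - x\<bar> \<le> real k * \<bar>y - x\<bar>" using that by (intro mult_right_mono) auto
          with m show ?thesis by (simp add: tent_def)
        qed
        then have "\<forall>\<^sub>F k in sequentially. tent k x y = 0"
          unfolding eventually_sequentially by blast
        with False show ?thesis by (auto intro: tendsto_eventually)
      qed (simp add: tent_bounds)
    qed
  qed (use tent_meas tent_bounds in \<open>auto cong: measurable_cong_sets\<close>)
  then have "(\<lambda>k. \<integral>y. tent k x y \<partial>\<nu>) \<longlonglongrightarrow> measure \<nu> {x}" by simp
  moreover have "\<forall>\<^sub>F k in sequentially. c \<le> (\<integral>y. tent k x y \<partial>\<nu>)"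
    using eventually_gt_at_top[of 0] lower by (rule eventually_mono)
  ultimately show ?thesis using tendsto_lowerbound by force
qed

text \<open>\<open>Lat a b c d\<close> stands for \<open>a + b * zeta5 + c * zeta5\<^sup>2 + d * zeta5 ^ 3\<close> in the ring of integers of
  the fifth cyclotomic field. The unit of length is the circumradius \<open>rho\<close> of a pentagon with side 1,
  so that the vertices of that pentagon are the fifth roots of unity.\<close>
datatype lat = Lat int int int int

instantiation lat :: ab_group_add
begin
definition "0 = Lat 0 0 0 0"
fun plus_lat where "Lat a b c d + Lat a' b' c' d' = Lat (a + a') (b + b') (c + c') (d + d')"
fun minus_lat where "Lat a b c d - Lat a' b' c' d' = Lat (a - a') (b - b') (c - c') (d - d')"
fun uminus_lat where "- Lat a b c d = Lat (- a) (- b) (- c) (- d)"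
instance
proof
  fix x y z :: lat
  show "x + y + z = x + (y + z)" by (cases x; cases y; cases z) simp
  show "x + y = y + x" by (cases x; cases y) simp
  show "0 + x = x" by (cases x) (simp add: zero_lat_def)
  show "- x + x = 0" by (cases x) (simp add: zero_lat_def)
  show "x - y = x + - y" by (cases x; cases y) simp
qed
end

text \<open>Multiplication by \<open>- zeta5 ^ 3\<close>, the rotation by 36 degrees.\<close>
fun lrot1 :: "lat \<Rightarrow> lat" where
  "lrot1 (Lat a b c d) = Lat (b - c) (b - d) b (b - a)"

fun lrot :: "nat \<Rightarrow> lat \<Rightarrow> lat" where
  "lrot 0 z = z" | "lrot (Suc n) z = lrot1 (lrot n z)"

text \<open>Multiplication by the golden ratio \<open>zeta10 - zeta10 ^ 4\<close>.\<close>
definition lphi :: "lat \<Rightarrow> lat" where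
  "lphi z = lrot1 z - lrot 4 z"

definition lone :: lat where "lone = Lat 1 0 0 0"

text \<open>The position is the centre of the core or of the pentagon. The centre of a diamond is not in the
  lattice; its position is the point of the long diagonal at distance \<open>rho\<close> from the marked vertex. The
  direction counts steps of 36 degrees.\<close>
datatype atile = ATile (akind: tile_kind) (apos: lat) (adir: nat)

fun five_fold :: "tile_kind \<Rightarrow> bool" where
  "five_fold Star = True" | "five_fold PGamma = True" | "five_fold _ = False"

text \<open>A star and a \<gamma>-pentagon are invariant under rotations by 72 degrees, so that only the parity of
  their direction has a meaning. With directions reduced in this way equal tiles have equal
  representations.\<close>
definition dir_norm :: "tile_kind \<Rightarrow> nat \<Rightarrow> nat" where
  "dir_norm K d = (if five_fold K then d mod 2 else d mod 10)"

text \<open>The motion of the lattice that rotates by \<open>d\<close> steps and then translates by \<open>z\<close>.\<close>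
fun place :: "lat \<Rightarrow> nat \<Rightarrow> atile \<Rightarrow> atile" where
  "place z d (ATile K w f) = ATile K (z + lrot d w) (dir_norm K (f + d))"

text \<open>The corner pentagon between the sides \<open>i\<close> and \<open>i + 1\<close> of an enlarged pentagon, turned so that its
  distinguished side is the one with index \<open>j\<close>.\<close>
definition acorner :: "tile_kind \<Rightarrow> nat \<Rightarrow> nat \<Rightarrow> atile" where
  "acorner K i j = ATile K (lrot (2 * i + 2) (lphi lone)) (2 * j)"

definition aedge_diamond :: "nat \<Rightarrow> atile" where
  "aedge_diamond i = ATile Diamond (lrot (2 * i + 1) (Lat 2 0 0 0)) (2 * i + 1)"

text \<open>The boat and the \<alpha>-pentagon at the tip with index \<open>k\<close>.\<close>
definition atip :: "nat \<Rightarrow> atile list" where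
  "atip k = [ATile Boat (lrot (2 * k + 1) (lphi (lphi lone))) (2 * k + 8),
             ATile PAlpha (lrot (2 * k + 1) (lphi lone)) (2 * k)]"

fun kids0 :: "tile_kind \<Rightarrow> atile list" where
  "kids0 PGamma = ATile PGamma 0 5 # map (\<lambda>i. acorner PBeta i (i + 3)) [0,1,2,3,4]"
| "kids0 PBeta = ATile PGamma 0 5 # aedge_diamond 0 # acorner PAlpha 4 6 # acorner PAlpha 0 4 #
     map (\<lambda>i. acorner PBeta i (i + 3)) [1,2,3]"
| "kids0 PAlpha = [ATile PGamma 0 5, aedge_diamond 1, aedge_diamond 4, acorner PAlpha 0 2,
     acorner PAlpha 1 5, acorner PAlpha 3 5, acorner PAlpha 4 8, acorner PBeta 2 5]"
| "kids0 Star = ATile Star 0 9 # concat (map atip [0,1,2,3,4])"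
| "kids0 Boat = ATile Star 0 9 # concat (map atip [0,1,2])"
| "kids0 Diamond = [ATile Star (- lone) 4, ATile Boat (lphi lone) 7, ATile PAlpha (lphi lone - lone) 9]"

fun kids :: "atile \<Rightarrow> atile list" where
  "kids (ATile K z d) = map (place (lphi (lphi z)) d) (kids0 K)"

section \<open>The list of near pairs\<close>

text \<open>The tiles that can occur at a distance not larger than the sum of the two radii \<open>rad\<close> from a tile
  in standard position. Two properties of the list matter: it covers the near pairs among the children
  of one tile, and the near pairs of children of a pair in the list are again in the list.\<close>
fun nbrs :: "tile_kind \<Rightarrow> atile list" where
  "nbrs Star = [
    ATile Boat (Lat (-1) (-2) (-2) (-1)) 5, ATile Boat (Lat (-1) (-1) 0 1) 3, ATile Boat (Lat 0 1 2 1) 1,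
    ATile Boat (Lat 1 0 (-1) (-1)) 7, ATile Boat (Lat 1 2 1 0) 9, ATile Diamond (Lat (-3) (-2) (-1) (-1)) 8,
    ATile Diamond (Lat (-1) (-2) 1 0) 4, ATile Diamond (Lat (-1) 2 1 1) 2, ATile Diamond (Lat 1 (-2) (-1) 0) 0,
    ATile Diamond (Lat 1 2 2 3) 6, ATile Diamond (Lat 3 2 2 1) 0, ATile PAlpha (Lat (-1) (-1) 0 0) 5,
    ATile PAlpha (Lat 0 (-1) (-1) 0) 7, ATile PAlpha (Lat 0 0 (-1) (-1)) 9, ATile PAlpha (Lat 0 1 1 1) 3,
    ATile PAlpha (Lat 1 1 1 0) 1, ATile PBeta (Lat (-1) (-2) (-1) 0) 6, ATile PBeta (Lat (-1) 0 1 1) 4,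
    ATile PBeta (Lat 0 (-1) (-2) (-1)) 8, ATile PBeta (Lat 1 1 0 (-1)) 0, ATile PBeta (Lat 1 2 2 1) 2,
    ATile PGamma (Lat (-1) (-2) (-1) 0) 0, ATile PGamma (Lat (-1) 0 1 1) 0, ATile PGamma (Lat 1 2 2 1) 0]"
| "nbrs Boat = [
    ATile Boat (Lat (-2) (-2) (-1) 0) 2, ATile Boat (Lat 0 (-1) (-2) (-2)) 8, ATile Diamond (Lat (-1) 2 1 1) 2,
    ATile Diamond (Lat 1 1 2 (-1)) 4, ATile PAlpha (Lat (-1) (-2) (-1) 0) 4, ATile PAlpha (Lat (-1) (-1) (-1) (-1)) 2,
    ATile PAlpha (Lat 0 (-1) (-2) (-1)) 0, ATile PAlpha (Lat 0 1 1 1) 3, ATile PAlpha (Lat 1 1 1 0) 1,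
    ATile PBeta (Lat (-1) (-1) 0 0) 3, ATile PBeta (Lat 0 0 (-1) (-1)) 1, ATile PBeta (Lat 1 2 2 1) 2,
    ATile PGamma (Lat (-1) 0 1 1) 0, ATile PGamma (Lat 1 1 0 (-1)) 0, ATile Star (Lat (-1) (-2) (-2) (-1)) 1]"
| "nbrs Diamond = [
    ATile Boat (Lat (-3) (-2) (-2) (-1)) 8, ATile Boat (Lat (-1) 2 1 0) 6, ATile PAlpha (Lat (-2) (-1) (-1) (-1)) 1,
    ATile PAlpha (Lat (-1) 1 0 0) 7, ATile PBeta (Lat (-2) (-1) (-2) (-2)) 0, ATile PBeta (Lat (-1) 1 (-1) (-1)) 8,
    ATile PGamma (Lat (-2) 0 0 0) 0, ATile PGamma (Lat (-1) 0 (-2) (-2)) 1, ATile Star (Lat (-3) (-2) (-2) (-1)) 0,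
    ATile Star (Lat (-1) 2 1 0) 0]"
| "nbrs PAlpha = [
    ATile Boat (Lat (-1) (-2) (-2) (-1)) 6, ATile Boat (Lat (-1) (-1) 0 0) 7, ATile Boat (Lat (-1) (-1) 0 0) 9,
    ATile Boat (Lat 0 0 0 (-1)) 8, ATile Boat (Lat 0 1 2 1) 0, ATile Diamond (Lat 0 1 (-1) 0) 9,
    ATile Diamond (Lat 2 1 1 1) 3, ATile PAlpha (Lat (-1) (-2) (-1) (-1)) 8, ATile PAlpha (Lat (-1) 0 1 0) 2,
    ATile PAlpha (Lat 0 1 0 (-1)) 6, ATile PAlpha (Lat 1 0 0 (-1)) 4, ATile PBeta (Lat (-1) (-2) (-1) (-1)) 0,
    ATile PBeta (Lat (-1) 0 1 0) 0, ATile PBeta (Lat 0 (-1) (-1) (-1)) 9, ATile PBeta (Lat 0 1 1 0) 1,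
    ATile PGamma (Lat 0 (-1) (-1) (-1)) 1, ATile PGamma (Lat 0 1 1 0) 1, ATile Star (Lat (-1) (-1) 0 0) 1]"
| "nbrs PBeta = [
    ATile Boat (Lat (-1) (-1) 0 1) 8, ATile Boat (Lat 0 (-1) (-1) 0) 7, ATile Boat (Lat 0 1 1 1) 9,
    ATile Diamond (Lat (-1) 0 (-2) 0) 2, ATile Diamond (Lat 2 1 2 2) 0, ATile PAlpha (Lat (-1) (-1) (-1) 0) 9,
    ATile PAlpha (Lat 0 0 1 1) 1, ATile PAlpha (Lat 1 0 (-1) 0) 0, ATile PAlpha (Lat 1 2 1 1) 0,
    ATile PBeta (Lat 1 0 (-1) 0) 2, ATile PBeta (Lat 1 2 1 1) 8, ATile PGamma (Lat 1 1 0 0) 1,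
    ATile Star (Lat (-1) (-1) 0 1) 0]"
| "nbrs PGamma = [
    ATile Boat (Lat (-1) (-2) (-2) (-1)) 2, ATile Boat (Lat (-1) (-2) (-2) (-1)) 8, ATile Boat (Lat (-1) (-1) 0 1) 0,
    ATile Boat (Lat (-1) (-1) 0 1) 6, ATile Boat (Lat 0 1 2 1) 4, ATile Boat (Lat 0 1 2 1) 8,
    ATile Boat (Lat 1 0 (-1) (-1)) 0, ATile Boat (Lat 1 0 (-1) (-1)) 4, ATile Boat (Lat 1 2 1 0) 2,
    ATile Boat (Lat 1 2 1 0) 6, ATile Diamond (Lat (-2) (-2) (-2) (-2)) 8, ATile Diamond (Lat (-2) (-2) 0 (-1)) 1,
    ATile Diamond (Lat (-1) 0 (-2) (-2)) 5, ATile Diamond (Lat 0 2 0 0) 2, ATile Diamond (Lat 0 2 1 2) 9,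
    ATile Diamond (Lat 1 (-1) (-1) 1) 3, ATile Diamond (Lat 2 0 0 0) 0, ATile Diamond (Lat 2 1 2 0) 7,
    ATile PAlpha (Lat (-1) (-1) (-1) 0) 9, ATile PAlpha (Lat 0 (-1) (-1) (-1)) 1, ATile PAlpha (Lat 0 (-1) (-1) (-1)) 5,
    ATile PAlpha (Lat 0 1 1 0) 9, ATile PAlpha (Lat 1 1 0 0) 3, ATile PAlpha (Lat 1 1 0 0) 7,
    ATile PBeta (Lat (-1) (-1) (-1) 0) 1, ATile PBeta (Lat 0 (-1) (-1) (-1)) 3, ATile PBeta (Lat 0 0 1 1) 9,
    ATile PBeta (Lat 0 1 1 0) 7, ATile PBeta (Lat 1 1 0 0) 5, ATile Star (Lat (-1) (-2) (-2) (-1)) 0,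
    ATile Star (Lat 1 0 (-1) (-1)) 0, ATile Star (Lat 1 2 1 0) 0]"

section \<open>Certified inequalities between numbers \<open>A + B phi\<close>\<close>

text \<open>Sufficient for \<open>0 < A + B * phi\<close>, by \<open>1.618 < phi < 1.619\<close>.\<close>
definition surely_pos :: "int \<Rightarrow> int \<Rightarrow> bool" where
  "surely_pos A B \<longleftrightarrow> 0 < 1000 * A + (if B \<ge> 0 then 1618 else 1619) * B"

definition surely_nonneg :: "int \<Rightarrow> int \<Rightarrow> bool" where
  "surely_nonneg A B \<longleftrightarrow> A = 0 \<and> B = 0 \<or> surely_pos A B"

text \<open>The squared modulus of \<open>z\<close> is \<open>nsqA z + nsqB z * phi\<close>.\<close>
fun nsqA :: "lat \<Rightarrow> int" where
  "nsqA (Lat a b c d) = a * a + b * b + c * c + d * d - (a * b + b * c + c * d)"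
fun nsqB :: "lat \<Rightarrow> int" where
  "nsqB (Lat a b c d) = (a * b + b * c + c * d) - (a * c + b * d + a * d)"

fun is_large :: "tile_kind \<Rightarrow> bool" where
  "is_large Star = True" | "is_large Boat = True" | "is_large _ = False"

text \<open>Radii, in units of \<open>rho\<close>, of discs around the positions that contain the tiles. They are chosen
  not only to contain the tiles but such that \<open>phi\<^sup>2\<close> times the disc of a tile contains the discs of its
  children; this makes distance an invariant of the substitution: children of far tiles are far.\<close>
definition rad :: "tile_kind \<Rightarrow> real" where
  "rad K = (if is_large K then phi else 2 * phi - 2)"

text \<open>\<open>(rad K + rad L)\<^sup>2 = rsqA K L + rsqB K L * phi\<close>.\<close>
definition rsqA :: "tile_kind \<Rightarrow> tile_kind \<Rightarrow> int" where
  "rsqA K L = (if is_large K then if is_large L then 4 else 13 else if is_large L then 13 else 32)"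
definition rsqB :: "tile_kind \<Rightarrow> tile_kind \<Rightarrow> int" where
  "rsqB K L = (if is_large K then if is_large L then 4 else - 3 else if is_large L then - 3 else - 16)"

definition surely_far :: "atile \<Rightarrow> atile \<Rightarrow> bool" where
  "surely_far s t = (let z = apos t - apos s in
     surely_pos (nsqA z - rsqA (akind s) (akind t)) (nsqB z - rsqB (akind s) (akind t)))"

definition surely_near :: "atile \<Rightarrow> atile \<Rightarrow> bool" where
  "surely_near s t = (let z = apos t - apos s in
     surely_nonneg (rsqA (akind s) (akind t) - nsqA z) (rsqB (akind s) (akind t) - nsqB z))"

definition legal_at :: "atile \<Rightarrow> atile \<Rightarrow> bool" where
  "legal_at s t \<longleftrightarrow> list_ex (\<lambda>x. place (apos s) (adir s) x = t) (nbrs (akind s))"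

definition all_kinds :: "tile_kind list" where
  "all_kinds = [Star, Boat, Diamond, PAlpha, PBeta, PGamma]"

definition base :: "tile_kind \<Rightarrow> atile" where "base K = ATile K 0 0"

definition kids_ok :: "atile list \<Rightarrow> atile list \<Rightarrow> bool" where
  "kids_ok xs ys \<longleftrightarrow> list_all (\<lambda>s. list_all (\<lambda>t. surely_far s t \<or> s \<noteq> t \<and> legal_at s t) ys) xs"

lemma closure_check:
  "list_all (\<lambda>K. list_all (\<lambda>x. kids_ok (kids (base K)) (kids x)) (nbrs K)) all_kinds"
  by code_simp

lemma sibling_check:
  "list_all (\<lambda>K. distinct (kids (base K)) \<and>
     list_all (\<lambda>s. list_all (\<lambda>t. s = t \<or> surely_far s t \<or> legal_at s t) (kids (base K))) (kids (base K)))
   all_kinds"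
  by code_simp

text \<open>\<open>(phi\<^sup>2 * rad K - rad L)\<^sup>2 = dropA K L + dropB K L * phi\<close>.\<close>
definition dropA :: "tile_kind \<Rightarrow> tile_kind \<Rightarrow> int" where
  "dropA K L = (if is_large K then if is_large L then 2 else 9 else if is_large L then 1 else 4)"
definition dropB :: "tile_kind \<Rightarrow> tile_kind \<Rightarrow> int" where
  "dropB K L = (if is_large K then if is_large L then 3 else 0 else if is_large L then 1 else 0)"

lemma drop_check:
  "list_all (\<lambda>K. list_all (\<lambda>x. surely_nonneg (dropA K (akind x) - nsqA (apos x))
     (dropB K (akind x) - nsqB (apos x))) (kids0 K)) all_kinds"
  by code_simp

section \<open>Vertices, edges and convex parts\<close>

definition pverts :: "lat list" where "pverts = map (\<lambda>k. lrot (2 * k) lone) [0,1,2,3,4]"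

text \<open>In units of \<open>rho\<close> the core of a star has circumradius \<open>1 / phi = phi - 1\<close>, and the apices of its
  points have distance \<open>phi\<close> from the centre.\<close>
definition cvert :: "nat \<Rightarrow> lat" where "cvert k = lrot (2 * k) (lphi lone - lone)"
definition avert :: "nat \<Rightarrow> lat" where "avert k = lrot (2 * k + 1) (lphi lone)"
definition dverts :: "lat list" where
  "dverts = [- lone, Lat (-2) (-1) (-1) (-2), Lat (-2) 0 (-2) (-2), Lat (-1) 1 (-1) 0]"

definition apoint :: "nat \<Rightarrow> lat list" where "apoint k = [cvert k, avert k, cvert (k + 1)]"

text \<open>Convex polygons whose union is the region, in standard position.\<close>
fun parts0 :: "tile_kind \<Rightarrow> lat list list" where
  "parts0 Star = map cvert [0,1,2,3,4] # map apoint [0,1,2,3,4]"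
| "parts0 Boat = map cvert [0,1,2,3] # map apoint [0,1,2]"
| "parts0 Diamond = [dverts]"
| "parts0 _ = [pverts]"

definition alegs :: "nat \<Rightarrow> (lat \<times> lat) list" where
  "alegs k = [(cvert k, avert k), (avert k, cvert (k + 1))]"

fun edges0 :: "tile_kind \<Rightarrow> (lat \<times> lat) list" where
  "edges0 Star = concat (map alegs [0,1,2,3,4])"
| "edges0 Boat = concat (map alegs [0,1,2]) @ [(cvert 3, cvert 0)]"
| "edges0 Diamond = zip dverts (rotate1 dverts)"
| "edges0 _ = zip pverts (rotate1 pverts)"

text \<open>From the frame of a tile to the coordinates of the lattice.\<close>
fun put :: "atile \<Rightarrow> lat \<Rightarrow> lat" where "put (ATile K z d) v = z + lrot d v"

definition aparts :: "atile \<Rightarrow> lat list list" where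
  "aparts t = map (map (put t)) (parts0 (akind t))"

definition aedges :: "atile \<Rightarrow> (lat \<times> lat) list" where
  "aedges t = map (map_prod (put t) (put t)) (edges0 (akind t))"

definition shares :: "atile \<Rightarrow> atile \<Rightarrow> bool" where
  "shares s t \<longleftrightarrow> list_ex (\<lambda>e. list_ex (\<lambda>f. e = f \<or> e = prod.swap f) (aedges t)) (aedges s)"

lemma radius_check:
  "list_all (\<lambda>K. list_all (list_all (\<lambda>v. surely_nonneg ((if is_large K then 1 else 8) - nsqA v)
     ((if is_large K then 1 else - 4) - nsqB v))) (parts0 K)) all_kinds"
  by code_simp

text \<open>Twice the real part of \<open>z\<close> is \<open>htA z + htB z * phi\<close>.\<close>
fun htA :: "lat \<Rightarrow> int" where "htA (Lat a b c d) = 2 * a - b"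
fun htB :: "lat \<Rightarrow> int" where "htB (Lat a b c d) = b - c - d"

text \<open>All points of \<open>vs\<close> lie strictly in front of a line through \<open>w\<close> that is normal to one of the ten
  directions, so \<open>w\<close> is not in their convex hull.\<close>
definition separated :: "lat \<Rightarrow> lat list \<Rightarrow> bool" where
  "separated w vs \<longleftrightarrow> list_ex (\<lambda>d. list_all (\<lambda>v. let x = lrot d (v - w) in surely_pos (htA x) (htB x)) vs)
     [0,1,2,3,4,5,6,7,8,9]"

definition outside :: "atile \<Rightarrow> lat \<Rightarrow> bool" where
  "outside t w \<longleftrightarrow> list_all (separated w) (aparts t)"

lemma centre_check:
  "list_all (\<lambda>K. list_all (\<lambda>x. outside (base K) (apos x) \<and>
     surely_nonneg (nsqA (apos x) - 1) (nsqB (apos x))) (nbrs K)) all_kinds"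
  by code_simp

section \<open>The ring\<close>

definition turns :: "atile \<Rightarrow> atile list" where
  "turns t = map (\<lambda>k. place 0 (2 * k) t) [0,1,2,3,4]"

text \<open>Coordinates relative to \<open>phi ^ 4\<close> times the centre of the pentagon that is substituted twice. The
  lists \<open>ring_pos\<close> and \<open>ring_neg\<close> are the two classes of the ring, \<open>ring_inner\<close> the neighbours of
  the ring that come from the same pentagon. The remaining neighbours depend on the surroundings: each
  outer notch between two pentagons of the ring is filled either by a boat or by a star.\<close>
definition ring_pos :: "atile list" where "ring_pos = turns (ATile PAlpha (Lat 1 1 (-1) (-1)) 6)"
definition ring_neg :: "atile list" where "ring_neg = turns (ATile PAlpha (Lat 0 (-1) (-2) (-2)) 2)"
definition ring_inner :: "atile list" where
  "ring_inner = turns (ATile Diamond (Lat (-1) 0 (-2) (-2)) 5) @ turns (ATile PGamma (Lat 1 0 (-2) (-2)) 1)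
     @ turns (ATile PBeta (Lat 1 1 0 0) 5)"
definition ring_boats :: "atile list" where "ring_boats = turns (ATile Boat (Lat 2 2 0 (-1)) 3)"
definition ring_stars :: "atile list" where "ring_stars = turns (ATile Star (Lat 2 2 0 (-1)) 1)"
definition ring_outer :: "atile list" where "ring_outer = ring_boats @ ring_stars"

definition grandkids :: "atile \<Rightarrow> atile list" where "grandkids t = concat (map kids (kids t))"

lemma ring_in_grandkids:
  "list_all (\<lambda>K. list_all (\<lambda>x. x \<in> set (grandkids (base K))) (ring_pos @ ring_neg @ ring_inner))
    [PAlpha, PBeta, PGamma]"
  by code_simp

text \<open>Two tiles too close to each other in a relative position that is not in the list of near pairs. The direction
  of \<open>Y\<close> has to be meaningful for the comparison with the list to be decisive.\<close>
definition clash :: "atile \<Rightarrow> atile \<Rightarrow> bool" where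
  "clash Y X \<longleftrightarrow> \<not> five_fold (akind Y) \<and> Y \<noteq> X \<and> surely_near Y X \<and> \<not> legal_at Y X"

definition clashing :: "atile \<Rightarrow> bool" where
  "clashing X \<longleftrightarrow> list_ex (\<lambda>Y. clash Y X) (ring_pos @ ring_neg @ ring_inner)"

text \<open>A point just outside the pentagon \<open>R\<close>, beyond the side opposite to its vertex with index 0. For a
  pentagon of the ring this side faces the outer notch.\<close>
definition beyond :: "atile \<Rightarrow> lat" where
  "beyond R = put R (- lone)"

text \<open>A tile near a pentagon \<open>R\<close> of the ring either clashes with a tile that is known to be present, or
  it is listed if it shares an edge with \<open>R\<close>, and it covers the point beyond \<open>R\<close> only if it is one
  of the two candidates for the notch.\<close>
lemma ring_check:
  "list_all (\<lambda>R. outside R (beyond R) \<and>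
     list_all (\<lambda>x. let X = place (apos R) (adir R) x in
       (shares R X \<longrightarrow> X \<in> set (ring_inner @ ring_outer) \<or> clashing X) \<and>
       (X \<in> set ring_outer \<and> shares R X \<or> outside X (beyond R) \<or> clashing X)) (nbrs PAlpha))
     (ring_pos @ ring_neg)"
  by code_simp

lemma ring_balance_check:
  "list_all (\<lambda>X. length (filter (\<lambda>R. shares R X) ring_pos) = length (filter (\<lambda>R. shares R X) ring_neg))
     (ring_inner @ ring_outer)"
  by code_simp

text \<open>Three neighbours come from the inner side; the candidates for the notch exclude each other.\<close>
lemma ring_degree_check:
  "list_all (\<lambda>R. length (filter (shares R) ring_inner) = 3 \<and>
     list_all (\<lambda>X. list_all (\<lambda>Y. X = Y \<or> clash X Y \<or> clash Y X) (filter (shares R) ring_outer))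
       (filter (shares R) ring_outer))
     (ring_pos @ ring_neg)"
  by code_simp

lemma ring_distinct_check: "distinct (ring_pos @ ring_neg @ ring_inner @ ring_outer)"
  by code_simp

section \<open>The golden ratio and the tenth roots of unity\<close>

lemma phi_sq: "phi * phi = phi + 1"
proof -
  have "sqrt 5 * sqrt 5 = (5::real)" by simp
  then show ?thesis unfolding phi_def by (simp add: field_simps)
qed

lemma phi_bounds: "1618 / 1000 < phi" "phi < 1619 / 1000"
proof -
  have "2236/1000 < sqrt 5" by (rule real_less_rsqrt) (simp add: power2_eq_square)
  moreover have "sqrt 5 < 2238/1000" by (rule real_less_lsqrt) (simp_all add: power2_eq_square)
  ultimately show "1618 / 1000 < phi" "phi < 1619 / 1000" by (simp_all add: phi_def)
qed

lemma phi_pos: "phi > 0" "phi > 1" "phi \<noteq> 0" using phi_bounds by auto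

lemma inverse_phi: "1 / phi = phi - 1"
  using phi_pos phi_sq by (simp add: field_simps)

definition zeta10 :: complex where "zeta10 = cis (pi / 5)"

lemma zeta10_power: "zeta10 ^ n = cis (real n * pi / 5)"
  by (simp add: zeta10_def Complex.DeMoivre)

lemma zeta10_5: "zeta10 ^ 5 = - 1" by (simp add: zeta10_power)
lemma zeta10_10: "zeta10 ^ 10 = 1"
proof -
  have "zeta10 ^ 10 = (zeta10 ^ 5)\<^sup>2" by (simp flip: power_mult)
  then show ?thesis by (simp add: zeta10_5)
qed

lemma zeta5_eq: "zeta5 = zeta10\<^sup>2" by (simp add: zeta5_def zeta10_power)

lemma norm_zeta10 [simp]: "norm zeta10 = 1" by (simp add: zeta10_def)

lemma zeta10_nonzero [simp]: "zeta10 \<noteq> 0" using norm_zeta10 by force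

lemma zeta10_minpoly: "zeta10 ^ 4 = zeta10 ^ 3 - zeta10\<^sup>2 + zeta10 - 1"
proof -
  have "(zeta10 + 1) * (zeta10 ^ 4 - zeta10 ^ 3 + zeta10\<^sup>2 - zeta10 + 1) = zeta10 ^ 5 + 1"
    by (simp add: algebra_simps power_numeral_reduce)
  moreover have "zeta10 + 1 \<noteq> 0"
  proof
    assume "zeta10 + 1 = 0"
    then have "zeta10 = - 1" by (rule eq_neg_iff_add_eq_0[THEN iffD2])
    then have "sin (pi / 5) = 0" by (auto simp: zeta10_def complex_eq_iff)
    moreover have "sin (pi / 5) > 0" by (intro sin_gt_zero) auto
    ultimately show False by simp
  qed
  ultimately have "zeta10 ^ 4 - zeta10 ^ 3 + zeta10\<^sup>2 - zeta10 + 1 = 0"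
    by (simp add: zeta10_5)
  then show ?thesis by (simp add: algebra_simps)
qed

lemma zeta10_powers:
  "zeta10 ^ 4 = zeta10 ^ 3 - zeta10\<^sup>2 + zeta10 - 1"
  "zeta10 ^ 5 = - 1" "zeta10 ^ 6 = - zeta10" "zeta10 ^ 7 = - zeta10\<^sup>2" "zeta10 ^ 8 = - (zeta10 ^ 3)"
  "zeta10 ^ 9 = - (zeta10 ^ 4)"
  using zeta10_minpoly zeta10_5
    power_add[of zeta10 5 1] power_add[of zeta10 5 2] power_add[of zeta10 5 3] power_add[of zeta10 5 4]
  by simp_all

lemma cnj_zeta10: "cnj zeta10 = - (zeta10 ^ 4)"
proof -
  have "zeta10 * cnj zeta10 = 1" by (simp add: zeta10_def cis_cnj cis_mult)
  moreover have "zeta10 * (- (zeta10 ^ 4)) = 1" using zeta10_5 by (simp add: power_numeral_reduce)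
  ultimately show ?thesis by (metis zeta10_nonzero mult_left_cancel)
qed

text \<open>The golden ratio is \<open>2 cos 36\<close>: compare the two roots of \<open>x\<^sup>2 = x + 1\<close>.\<close>
lemma zeta10_plus_cnj: "zeta10 + cnj zeta10 = complex_of_real phi"
proof -
  let ?c = "2 * cos (pi / 5)"
  note cnj = cnj_zeta10
  have eq: "zeta10 + cnj zeta10 = complex_of_real ?c" by (simp add: zeta10_def complex_eq_iff)
  have "(zeta10 - zeta10 ^ 4) * (zeta10 - zeta10 ^ 4) = (zeta10 - zeta10 ^ 4) + 1"
  proof -
    have "(zeta10 - zeta10 ^ 4) * (zeta10 - zeta10 ^ 4) = zeta10\<^sup>2 - 2 * zeta10 ^ 5 + zeta10 ^ 8"
      by (simp add: algebra_simps power2_eq_square flip: power_add power_Suc power_Suc2)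
    also have "\<dots> = (zeta10 - zeta10 ^ 4) + 1" by (simp add: zeta10_powers)
    finally show ?thesis .
  qed
  then have "complex_of_real (?c * ?c) = complex_of_real (?c + 1)"
    using eq unfolding cnj by simp
  then have c2: "?c * ?c = ?c + 1" by (simp only: of_real_eq_iff)
  then have "(?c - phi) * (?c + phi - 1) = 0" using phi_sq by (simp add: algebra_simps)
  moreover have "cos (pi / 5) > 0" by (intro cos_gt_zero) auto
  ultimately have "?c = phi" using phi_pos by auto
  then show ?thesis using eq by simp
qed

lemma phi_zeta10: "complex_of_real phi = zeta10 - zeta10 ^ 4"
  using zeta10_plus_cnj by (simp add: cnj_zeta10)

lemma cos36: "cos (pi / 5) = phi / 2"
  using zeta10_plus_cnj by (simp add: zeta10_def complex_eq_iff)

section \<open>The lattice\<close>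

fun ev :: "lat \<Rightarrow> complex" where
  "ev (Lat a b c d) = of_int a + of_int b * zeta5 + of_int c * zeta5\<^sup>2 + of_int d * zeta5 ^ 3"

lemma ev_add: "ev (z + w) = ev z + ev w"
  by (cases z; cases w) (simp add: algebra_simps)
lemma ev_diff: "ev (z - w) = ev z - ev w"
  by (cases z; cases w) (simp add: algebra_simps)
lemma ev_minus: "ev (- z) = - ev z"
  by (cases z) (simp add: algebra_simps)
lemma ev_0: "ev 0 = 0" by (simp add: zero_lat_def)
lemma ev_one: "ev lone = 1" by (simp add: lone_def)

lemma zeta5_powers: "zeta5 = zeta10\<^sup>2" "zeta5\<^sup>2 = zeta10 ^ 4" "zeta5 ^ 3 = - zeta10" "zeta5 ^ 4 = - (zeta10 ^ 3)"
  "zeta5 ^ 5 = 1"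
  by (simp_all add: zeta5_eq zeta10_powers zeta10_10 flip: power_mult)

lemma ev_rot1: "ev (lrot1 z) = zeta10 * ev z"
proof (cases z)
  case (Lat a b c d)
  have "zeta10 * zeta5 = zeta10 ^ 3" by (simp add: zeta5_powers(1) power_numeral_reduce)
  moreover have "zeta10 * zeta5\<^sup>2 = - 1"
    unfolding zeta5_powers(2) using zeta10_5 by (simp flip: power_Suc)
  moreover have "zeta10 * zeta5 ^ 3 = - (zeta10\<^sup>2)"
    unfolding zeta5_powers(3) by (simp add: power2_eq_square)
  moreover have "zeta10 * ev z = of_int a * zeta10 + of_int b * (zeta10 * zeta5) +
      of_int c * (zeta10 * zeta5\<^sup>2) + of_int d * (zeta10 * zeta5 ^ 3)"
    by (simp add: Lat algebra_simps)
  ultimately have "zeta10 * ev z = of_int a * zeta10 + of_int b * zeta10 ^ 3 - of_int c - of_int d * zeta10\<^sup>2"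
    by simp
  moreover have "ev (lrot1 z) = of_int (b - c) + of_int (b - d) * zeta10\<^sup>2 + of_int b * zeta10 ^ 4 - of_int (b - a) * zeta10"
    by (simp add: Lat zeta5_powers(2,3)) (simp add: zeta5_powers(1))
  moreover have "\<dots> = of_int a * zeta10 + of_int b * zeta10 ^ 3 - of_int c - of_int d * zeta10\<^sup>2"
    unfolding zeta10_minpoly by (simp add: algebra_simps)
  ultimately show ?thesis by simp
qed

lemma ev_rot: "ev (lrot n z) = zeta10 ^ n * ev z"
  by (induction n) (simp_all add: ev_rot1)

lemma ev_phi: "ev (lphi z) = phi * ev z"
  by (simp add: lphi_def ev_diff ev_rot1 ev_rot phi_zeta10 algebra_simps)

lemma norm_ev_rot [simp]: "norm (ev (lrot n z)) = norm (ev z)"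
  by (simp add: ev_rot norm_mult norm_power)

lemma sin36_sq: "sin (pi / 5) * sin (pi / 5) = (3 - phi) / 4"
proof -
  have "sin (pi / 5) * sin (pi / 5) + phi / 2 * (phi / 2) = 1"
    using sin_cos_squared_add[of "pi / 5"] by (simp only: cos36 power2_eq_square)
  then have "sin (pi / 5) * sin (pi / 5) = 1 - phi * phi / 4" by simp
  then show ?thesis by (simp add: phi_sq field_simps)
qed

lemma re_im_ev:
  fixes a b c d :: int
  shows "Re (ev (Lat a b c d)) = a + b * (phi - 1) / 2 - (c + d) * phi / 2" (is ?re)
    and "Im (ev (Lat a b c d)) = sin (pi / 5) * (b * phi + c - d)" (is ?im)
proof -
  let ?s = "sin (pi / 5)"
  have z: "zeta10 = Complex (phi / 2) ?s" by (simp add: zeta10_def complex_eq_iff cos36)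
  have "phi / 2 * (phi / 2) - ?s * ?s = (phi - 1) / 2"
    unfolding sin36_sq using phi_sq by (simp add: field_simps)
  then have 1: "zeta5 = Complex ((phi - 1) / 2) (?s * phi)"
    by (simp add: zeta5_powers(1) z power2_eq_square complex_eq_iff)
  have 3: "zeta5 ^ 3 = Complex (- phi / 2) (- ?s)" by (simp add: zeta5_powers(3) z complex_eq_iff)
  have "zeta10 ^ 4 = zeta10 - complex_of_real phi" using phi_zeta10 by simp
  then have 2: "zeta5\<^sup>2 = Complex (- phi / 2) ?s"
    by (simp add: zeta5_powers(2) z complex_eq_iff)
  show ?re ?im
    unfolding ev.simps 2 3 unfolding 1
    by (simp_all add: algebra_simps add_divide_distrib diff_divide_distrib)
qed

lemma sin36_pos: "sin (pi / 5) > 0" by (intro sin_gt_zero) auto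

text \<open>Infinite descent: a solution has both entries even.\<close>
lemma golden_form_anisotropic:
  fixes A B :: int
  assumes "A * A + A * B = B * B"
  shows "B = 0"
  using assms
proof (induction "nat \<bar>B\<bar>" arbitrary: A B rule: less_induct)
  case less
  have "even A \<and> even B" using arg_cong[OF less.prems, of even] by auto
  then obtain a b where ab: "A = 2 * a" "B = 2 * b" by (auto elim!: evenE)
  then have "a * a + a * b = b * b" using less.prems by simp
  with less.hyps[of b a] ab show "B = 0" by (cases "b = 0") (auto simp: abs_mult)
qed

lemma phi_irrational:
  assumes "real_of_int A + real_of_int B * phi = 0"
  shows "A = 0 \<and> B = 0"
proof -
  have A: "real_of_int A = - real_of_int B * phi" using assms by simp
  have "real_of_int A * real_of_int A = real_of_int B * real_of_int B * (phi * phi)"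
    unfolding A by (simp add: algebra_simps)
  then have "real_of_int A * real_of_int A + real_of_int A * real_of_int B = real_of_int B * real_of_int B"
    unfolding phi_sq using A by (simp add: algebra_simps)
  then have "real_of_int (A * A + A * B) = real_of_int (B * B)" by simp
  then have "A * A + A * B = B * B" by (simp only: of_int_eq_iff)
  then have "B = 0" by (rule golden_form_anisotropic)
  with assms show ?thesis by simp
qed

lemma ev_eq_0: "ev z = 0 \<Longrightarrow> z = 0"
proof (cases z)
  case (Lat a b c d)
  assume "ev z = 0"
  then have re: "a + b * (phi - 1) / 2 - (c + d) * phi / 2 = (0::real)"
    and im: "b * phi + c - d = (0::real)"
    using re_im_ev[of a b c d] sin36_pos by (auto simp: Lat)
  from im have "real_of_int (c - d) + real_of_int b * phi = 0" by simp
  then have 1: "b = 0" "c = d" using phi_irrational[of "c - d" b] by auto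
  with re have "real_of_int a + real_of_int (- c) * phi = 0" by simp
  then have "a = 0" "c = 0" using phi_irrational[of a "- c"] by auto
  with 1 show ?thesis by (simp add: Lat zero_lat_def)
qed

lemma ev_inj: "ev z = ev w \<longleftrightarrow> z = w"
  using ev_eq_0[of "z - w"] by (auto simp: ev_diff)

lemma surely_pos: "surely_pos A B \<Longrightarrow> real_of_int A + real_of_int B * phi > 0"
proof -
  assume a: "surely_pos A B"
  show ?thesis
  proof (cases "B \<ge> 0")
    case True
    then have "real_of_int B * (1618 / 1000) \<le> real_of_int B * phi"
      using phi_bounds by (intro mult_left_mono) auto
    moreover have "0 < 1000 * A + 1618 * B" using a True by (simp add: surely_pos_def)
    then have "0 < 1000 * real_of_int A + 1618 * real_of_int B" by linarith
    ultimately show ?thesis by simp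
  next
    case False
    then have "real_of_int B * (1619 / 1000) \<le> real_of_int B * phi"
      using phi_bounds by (intro mult_left_mono_neg) auto
    moreover have "0 < 1000 * A + 1619 * B" using a False by (simp add: surely_pos_def)
    then have "0 < 1000 * real_of_int A + 1619 * real_of_int B" by linarith
    ultimately show ?thesis by simp
  qed
qed

lemma surely_nonneg: "surely_nonneg A B \<Longrightarrow> real_of_int A + real_of_int B * phi \<ge> 0"
  using surely_pos[of A B] by (auto simp: surely_nonneg_def)

lemma norm_ev: "(norm (ev z))\<^sup>2 = nsqA z + nsqB z * phi"
proof (cases z)
  case (Lat i j k l)
  define a b c d :: real where "a = i" "b = j" "c = k" "d = l"
  have "(2 * a + b * (p - 1) - (c + d) * p) * (2 * a + b * (p - 1) - (c + d) * p)
      + (3 - p) * ((b * p + c - d) * (b * p + c - d))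
      = 4 * (a * a + b * b + c * c + d * d - (a * b + b * c + c * d)
      + ((a * b + b * c + c * d) - (a * c + b * d + a * d)) * p)"
    if "p * p = p + 1" for p using that by algebra
  from this[OF phi_sq]
  have 4: "4 * ((a + b * (phi - 1) / 2 - (c + d) * phi / 2) * (a + b * (phi - 1) / 2 - (c + d) * phi / 2)
      + (3 - phi) / 4 * ((b * phi + c - d) * (b * phi + c - d)))
      = 4 * (a * a + b * b + c * c + d * d - (a * b + b * c + c * d)
      + ((a * b + b * c + c * d) - (a * c + b * d + a * d)) * phi)" (is "4 * ?l = 4 * ?r")
    by (simp add: field_simps)
  then have "?l = ?r" by simp
  moreover have "(norm (ev z))\<^sup>2 = ?l"
    unfolding cmod_power2 Lat re_im_ev a_b_c_d_def sin36_sq[symmetric]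
    by (simp add: power2_eq_square)
  moreover have "nsqA z + nsqB z * phi = ?r" by (simp add: Lat a_b_c_d_def)
  ultimately show ?thesis by simp
qed

lemma height_ev: "2 * Re (ev z) = htA z + htB z * phi"
  by (cases z) (simp only: re_im_ev htA.simps htB.simps, simp add: algebra_simps add_divide_distrib diff_divide_distrib)

section \<open>Realizing abstract tiles in the plane\<close>

declare lrot.simps(2) [simp del]

definition pt :: "complex \<Rightarrow> complex \<Rightarrow> lat \<Rightarrow> complex" where "pt a b w = b + a * ev w"

text \<open>The tile in the plane that is represented by an abstract tile, in the frame that sends the lattice
  point \<open>w\<close> to \<open>b + a * w\<close>. Unit edges correspond to \<open>norm a = rho\<close>.\<close>
fun conc :: "complex \<Rightarrow> complex \<Rightarrow> atile \<Rightarrow> tile" where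
  "conc a b (ATile K z d) = (let c = pt a b z; r = a * zeta10 ^ d in
     case K of Star \<Rightarrow> star c (r / phi) | Boat \<Rightarrow> boat c (r / phi)
     | Diamond \<Rightarrow> diamond (c - r) (r / rho) | PGamma \<Rightarrow> pent PGamma c r {}
     | _ \<Rightarrow> pent K c r (side c r 0))"

lemma rho_eq: "1 / rho = 2 * sin (pi / 5)" by (simp add: rho_def)
lemma rho_pos: "rho > 0" using sin36_pos by (simp add: rho_def)

lemma zeta10_mod: "zeta10 ^ n = zeta10 ^ (n mod 10)"
proof -
  have "zeta10 ^ n = zeta10 ^ (10 * (n div 10) + n mod 10)" by simp
  also have "\<dots> = zeta10 ^ (n mod 10)"
    unfolding power_add power_mult zeta10_10 by simp
  finally show ?thesis .
qed

lemma zeta5_pow5: "zeta5 ^ 5 = 1" by (simp add: zeta5_eq zeta10_10 flip: power_mult)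

lemma zeta5_mod: "zeta5 ^ n = zeta5 ^ (n mod 5)"
proof -
  have "zeta5 ^ n = zeta5 ^ (5 * (n div 5) + n mod 5)" by simp
  also have "\<dots> = zeta5 ^ (n mod 5)" unfolding power_add power_mult zeta5_pow5 by simp
  finally show ?thesis .
qed

lemma zeta5_pow: "zeta5 ^ k = zeta10 ^ (2 * k)" by (simp add: zeta5_eq power_mult)

lemma vtx_ev: "vtx c r k = pt r c (lrot (2 * k) lone)"
  by (simp add: vtx_def pt_def ev_rot ev_one zeta5_pow)

lemma vtx_core_ev:
  fixes r :: complex
  shows "vtx c (r / phi) k = pt r c (cvert k)"
proof -
  have "r / phi = r * complex_of_real (1 / phi)" by simp
  then have eq: "r / phi = r * (complex_of_real phi - 1)" unfolding inverse_phi by simp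
  show ?thesis unfolding eq
    by (simp add: vtx_def pt_def cvert_def ev_rot ev_diff ev_phi ev_one zeta5_pow algebra_simps)
qed

lemma apex_vtx:
  fixes r :: complex
  shows "apex c r k = vtx c (phi\<^sup>2 * r * zeta10) k"
proof -
  have 1: "cnj zeta5 * zeta5 = 1" by (simp add: zeta5_def cis_cnj cis_mult)
  have 2: "cnj zeta5 = - (zeta10 ^ 3)"
  proof -
    have "- (zeta10 ^ 3) * zeta5 = 1" using zeta10_5 by (simp add: zeta5_eq flip: power_add)
    then show ?thesis using 1 by (metis mult_cancel_right zero_neq_one mult_zero_right)
  qed
  have "lone + lphi (lone + lrot 3 lone) = lphi (lphi (lrot 1 lone))" by code_simp
  then have "1 + phi * (1 - cnj zeta5) = phi\<^sup>2 * zeta10"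
    unfolding 2 ev_inj[symmetric] ev_add ev_phi ev_rot ev_one by (simp add: power2_eq_square)
  then have 3: "r * zeta5 ^ k * (1 + phi * (1 - cnj zeta5)) = r * zeta5 ^ k * (phi\<^sup>2 * zeta10)" by simp
  have "apex c r k = c + r * zeta5 ^ k + phi * (r * zeta5 ^ k * (cnj zeta5 * zeta5) - r * zeta5 ^ k * cnj zeta5)"
    by (simp add: apex_def vtx_def scaleR_conv_of_real algebra_simps)
  also have "\<dots> = c + r * zeta5 ^ k * (1 + phi * (1 - cnj zeta5))" unfolding 1 by (simp add: algebra_simps)
  also have "\<dots> = vtx c (phi\<^sup>2 * r * zeta10) k" unfolding 3 by (simp add: vtx_def algebra_simps)
  finally show ?thesis .
qed

lemma apex_ev:
  fixes r :: complex
  shows "apex c (r / phi) k = pt r c (avert k)"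
  unfolding apex_vtx using phi_pos
  by (simp add: vtx_def pt_def avert_def ev_rot ev_phi ev_one zeta5_pow power2_eq_square)

lemma dvtx_ev:
  fixes r :: complex
  assumes k: "k < 4"
  shows "dvtx (c - r) (r / rho) k = pt r c (dverts ! k)"
proof -
  have half: "cis (pi / 10) - cis (- pi / 10) = 2 * \<i> * sin (pi / 10)" by (simp add: complex_eq_iff)
  have i: "zeta10 ^ 7 * \<i> = cis (- pi / 10)" "zeta10 ^ 8 * \<i> = cis (pi / 10)"
  proof -
    have c: "\<i> = cis (pi / 2)" by simp
    have "zeta10 ^ 7 * \<i> = cis (7 * pi / 5 + pi / 2)" unfolding c zeta10_power cis_mult by simp
    also have "\<dots> = cis (- pi / 10 + 2 * pi)" by (rule arg_cong[where f = cis]) simp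
    finally show "zeta10 ^ 7 * \<i> = cis (- pi / 10)" by (simp only: cis_mult[symmetric] cis_2pi mult_1_right)
    have "zeta10 ^ 8 * \<i> = cis (8 * pi / 5 + pi / 2)" unfolding c zeta10_power cis_mult by simp
    also have "\<dots> = cis (pi / 10 + 2 * pi)" by (rule arg_cong[where f = cis]) simp
    finally show "zeta10 ^ 8 * \<i> = cis (pi / 10)" by (simp only: cis_mult[symmetric] cis_2pi mult_1_right)
  qed
  have "zeta10 - cnj zeta10 = 2 * \<i> * sin (pi / 5)" by (simp add: zeta10_def complex_eq_iff)
  then have s: "2 * sin (pi / 5) * \<i> = zeta10 + zeta10 ^ 4" unfolding cnj_zeta10 by simp
  have "1 / rho * cis (- pi / 10) = zeta10 ^ 7 * (2 * sin (pi / 5) * \<i>)"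
    unfolding rho_eq i[symmetric] by simp
  also have "\<dots> = ev (lrot 7 (lrot 1 lone + lrot 4 lone))"
    unfolding s ev_rot ev_add ev_one by simp
  also have "lrot 7 (lrot 1 lone + lrot 4 lone) = Lat (-1) (-1) (-1) (-2)" by code_simp
  finally have 1: "cis (- pi / 10) / rho = ev (Lat (-1) (-1) (-1) (-2))" by simp
  have "1 / rho * cis (pi / 10) = zeta10 ^ 8 * (2 * sin (pi / 5) * \<i>)"
    unfolding rho_eq i[symmetric] by simp
  also have "\<dots> = ev (lrot 8 (lrot 1 lone + lrot 4 lone))"
    unfolding s ev_rot ev_add ev_one by simp
  also have "lrot 8 (lrot 1 lone + lrot 4 lone) = Lat 0 1 (-1) 0" by code_simp
  finally have 2: "cis (pi / 10) / rho = ev (Lat 0 1 (-1) 0)" by simp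
  have "dverts = [- lone, Lat (-1) (-1) (-1) (-2) - lone, Lat (-1) (-1) (-1) (-2) + Lat 0 1 (-1) 0 - lone,
      Lat 0 1 (-1) 0 - lone]" by code_simp
  then have d: "dvtx (c - r) (r / rho) k = pt r c (dverts ! k) \<longleftrightarrow>
    [c - r, c - r + r * (cis (- pi / 10) / rho), c - r + r * (cis (- pi / 10) / rho) + r * (cis (pi / 10) / rho),
      c - r + r * (cis (pi / 10) / rho)] ! k =
    map (pt r c) [- lone, Lat (-1) (-1) (-1) (-2) - lone, Lat (-1) (-1) (-1) (-2) + Lat 0 1 (-1) 0 - lone,
      Lat 0 1 (-1) 0 - lone] ! k"
    using k by (simp add: dvtx_def dverts_def[THEN arg_cong[where f = length]])
  show ?thesis unfolding d 1 2
    by (rule arg_cong[where f = "\<lambda>l. l ! k"])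
      (simp only: list.map pt_def ev_add ev_diff ev_minus ev_one, simp add: algebra_simps)
qed

section \<open>Edges and regions of realized tiles\<close>

lemma lrot_mod: "lrot n z = lrot (n mod 10) z"
  using ev_inj[of "lrot n z" "lrot (n mod 10) z"] by (simp add: ev_rot flip: zeta10_mod)

lemma lrot_add: "lrot n (z + w) = lrot n z + lrot n w" by (simp flip: ev_inj add: ev_rot ev_add algebra_simps)
lemma lrot_lrot: "lrot n (lrot m z) = lrot (n + m) z" by (simp flip: ev_inj add: ev_rot power_add)
lemma lrot_diff: "lrot n (z - w) = lrot n z - lrot n w" by (simp flip: ev_inj add: ev_rot ev_diff algebra_simps)
lemma lrot_phi: "lrot n (lphi z) = lphi (lrot n z)" by (simp flip: ev_inj add: ev_rot ev_phi)
lemma lphi_add: "lphi (z + w) = lphi z + lphi w" by (simp flip: ev_inj add: ev_phi ev_add algebra_simps)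
lemma lrot_0: "lrot n 0 = 0" by (simp flip: ev_inj add: ev_rot ev_0)

lemma conc_base: "conc a b (ATile K z d) = conc (a * zeta10 ^ d) (pt a b z) (base K)"
  by (cases K) (simp_all add: base_def pt_def ev_0)

lemma pt_put: "pt a b (put (ATile K z d) v) = pt (a * zeta10 ^ d) (pt a b z) v"
  by (simp add: pt_def ev_add ev_rot algebra_simps)

lemma lessThan_small: "{..<3::nat} = {0,1,2}" "{..<4::nat} = {0,1,2,3}" "{..<5::nat} = {0,1,2,3,4}"
  by auto

lemma side_ev: "side c r k = closed_segment (pt r c (lrot (2 * k) lone)) (pt r c (lrot (2 * k + 2) lone))"
  by (simp add: side_def vtx_ev)

lemma lrot_10: "lrot 10 z = z" using lrot_mod[of 10 z] by simp

lemma edges_conc_base: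
  "edges (conc a b (base K)) = (\<lambda>(p, q). closed_segment (pt a b p) (pt a b q)) ` set (edges0 K)"
proof -
  have p: "side b a ` {..<5} = (\<lambda>(p, q). closed_segment (pt a b p) (pt a b q)) ` set (zip pverts (rotate1 pverts))"
    by (simp add: lessThan_small side_ev pverts_def lrot_10 numeral_2_eq_2[symmetric])
  have legs: "legs b (a / phi) k = (\<lambda>(p, q). closed_segment (pt a b p) (pt a b q)) ` set (alegs k)" for k
    by (simp add: legs_def alegs_def vtx_core_ev apex_ev)
  show ?thesis
  proof (cases K)
    case Star
    have "set (edges0 Star) = (\<Union>k<5. set (alegs k))"
      by (simp only: edges0.simps set_concat set_map lessThan_small list.set image_image)
    then show ?thesis using Star legs
      by (simp only: star_def base_def conc.simps tile_kind.case Let_def tile.sel image_UN)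
        (simp add: pt_def[of a b 0] ev_0)
  next
    case Boat
    have "set (edges0 Boat) = (\<Union>k<3. set (alegs k)) \<union> {(cvert 3, cvert 0)}"
      by (simp only: edges0.simps set_append set_concat set_map lessThan_small list.set image_image)
    then show ?thesis using Boat legs
      by (simp only: boat_def base_def conc.simps tile_kind.case Let_def tile.sel image_UN image_Un)
        (simp add: pt_def[of a b 0] ev_0 vtx_core_ev)
  next
    case Diamond
    have "length dverts = 4" by (simp add: dverts_def)
    with Diamond show ?thesis
      by (simp add: diamond_def numeral_2_eq_2[symmetric] base_def pt_def[of a b 0] ev_0 lessThan_small dvtx_ev dverts_def)
  qed (use p in \<open>simp_all add: base_def pt_def[of a b 0] ev_0 pent_def\<close>)
qed

lemma region_conc_base:
  "region (conc a b (base K)) = (\<Union>P\<in>set (parts0 K). convex hull (pt a b ` set P))"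
proof -
  have p: "vtx b a ` {..<5} = pt a b ` set pverts"
    by (simp add: lessThan_small vtx_ev pverts_def)
  show ?thesis
  proof (cases K)
    case Star
    then show ?thesis
      by (simp add: star_def numeral_2_eq_2[symmetric] base_def pt_def[of a b 0] ev_0 point_def lessThan_small apoint_def vtx_core_ev apex_ev)
  next
    case Boat
    then show ?thesis
      by (simp add: boat_def numeral_2_eq_2[symmetric] base_def pt_def[of a b 0] ev_0 point_def lessThan_small apoint_def vtx_core_ev apex_ev)
  next
    case Diamond
    with Diamond show ?thesis
      by (simp add: diamond_def numeral_2_eq_2[symmetric] base_def pt_def[of a b 0] ev_0 lessThan_small dvtx_ev dverts_def)
  qed (use p in \<open>simp_all add: base_def pt_def[of a b 0] ev_0 pent_def\<close>)
qed

lemma edges_conc: "edges (conc a b t) = (\<lambda>(p, q). closed_segment (pt a b p) (pt a b q)) ` set (aedges t)"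
  by (cases t) (simp only: conc_base edges_conc_base aedges_def set_map image_image case_prod_unfold
      map_prod_simp fst_map_prod snd_map_prod pt_put atile.sel)

lemma region_conc: "region (conc a b t) = (\<Union>P\<in>set (aparts t). convex hull (pt a b ` set P))"
  by (cases t) (simp only: conc_base region_conc_base aparts_def set_map image_image pt_put atile.sel SUP_image o_def)

section \<open>A tile determines its frame\<close>

text \<open>The vertices of a tile, recovered from its set of edges.\<close>
definition endpoints :: "complex set set \<Rightarrow> complex set" where
  "endpoints E = {x. \<exists>y. closed_segment x y \<in> E}"

definition vlist :: "tile_kind \<Rightarrow> lat list" where "vlist K = map fst (edges0 K)"

lemma vlist_check:
  "list_all (\<lambda>K. distinct (vlist K) \<and> list_all (\<lambda>e. snd e \<in> set (vlist K)) (edges0 K)) all_kinds"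
  by code_simp

lemma all_kinds: "K \<in> set all_kinds" by (cases K) (simp_all add: all_kinds_def)

lemma endpoints_conc: "endpoints (edges (conc a b (base K))) = pt a b ` set (vlist K)"
proof (intro set_eqI iffI)
  fix x assume "x \<in> endpoints (edges (conc a b (base K)))"
  then obtain y p q where pq: "(p, q) \<in> set (edges0 K)"
    and "closed_segment x y = closed_segment (pt a b p) (pt a b q)"
    by (auto simp: endpoints_def edges_conc_base)
  then have "x \<in> {pt a b p, pt a b q}" by auto
  moreover have "p \<in> set (vlist K)" using pq by (force simp: vlist_def)
  moreover have "q \<in> set (vlist K)"
    using vlist_check all_kinds[of K] pq by (force simp: list_all_iff)
  ultimately show "x \<in> pt a b ` set (vlist K)" by auto
next
  fix x assume "x \<in> pt a b ` set (vlist K)"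
  then obtain p q where "(p, q) \<in> set (edges0 K)" "x = pt a b p" by (auto simp: vlist_def)
  then show "x \<in> endpoints (edges (conc a b (base K)))"
    by (force simp: endpoints_def edges_conc_base)
qed

lemma inj_pt: "a \<noteq> 0 \<Longrightarrow> inj (pt a b)" by (auto intro!: injI simp: pt_def ev_inj)

lemma pt_image_nonzero:
  assumes "a \<noteq> 0" "u \<in> set L" "v \<in> set L" "u \<noteq> v" "pt a b ` set L = pt a' b' ` set L"
  shows "a' \<noteq> 0"
proof
  assume "a' = 0"
  then have "pt a b ` set L \<subseteq> {b'}" using assms(5) by (auto simp: pt_def)
  then have "pt a b u = pt a b v" using assms(2,3) by blast
  then show False using inj_pt[OF assms(1), of b] assms(4) by (auto dest: injD)
qed

text \<open>An affine map that carries one list of points onto another respects their centroids; this locates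
  the centre of a frame.\<close>
lemma centroid_eq:
  fixes b b' :: complex
  assumes "a \<noteq> 0" "a' \<noteq> 0" "distinct L" "pt a b ` set L = pt a' b' ` set L"
  shows "length L * b + a * ev (sum_list L) = length L * b' + a' * ev (sum_list L)"
proof -
  have s: "(\<Sum>x\<in>pt a b ` set L. x) = length L * b + a * ev (sum_list L)" if "a \<noteq> 0" for a b :: complex
  proof -
    have ev: "ev (sum_list L) = (\<Sum>v\<leftarrow>L. ev v)" by (induction L) (simp_all add: ev_0 ev_add)
    have "(\<Sum>x\<in>pt a b ` set L. x) = (\<Sum>v\<in>set L. pt a b v)"
      using inj_pt[OF that] by (subst sum.reindex) (auto intro: inj_on_subset)
    also have "\<dots> = length L * b + a * (\<Sum>v\<in>set L. ev v)"
      using assms(3) by (simp add: pt_def sum.distrib sum_distrib_left distinct_card)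
    also have "(\<Sum>v\<in>set L. ev v) = ev (sum_list L)"
      unfolding ev using assms(3) by (simp add: sum_list_distinct_conv_sum_set)
    finally show ?thesis .
  qed
  from s[OF assms(1), of b] s[OF assms(2), of b'] assms(4) show ?thesis by simp
qed

text \<open>A similarity that preserves a finite set preserves the points farthest from its centre.\<close>
lemma extremal_eq:
  fixes a a' :: complex and s :: "'a \<Rightarrow> complex"
  assumes "F \<noteq> {}" "F \<subseteq> S" "M > 0" "\<And>v. v \<in> F \<Longrightarrow> norm (s v) = M"
    "\<And>v. v \<in> S - F \<Longrightarrow> norm (s v) < M" "(\<lambda>v. a * s v) ` S = (\<lambda>v. a' * s v) ` S"
  shows "norm a = norm a'" "(\<lambda>v. a * s v) ` F = (\<lambda>v. a' * s v) ` F"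
proof -
  have le: "norm (s v) \<le> M" if "v \<in> S" for v using assms(4,5)[of v] that by fastforce
  have step: "norm c \<le> norm c'" if eq: "(\<lambda>v. c * s v) ` S = (\<lambda>v. c' * s v) ` S" for c c'
  proof -
    obtain v where v: "v \<in> F" using assms(1) by auto
    then have "c * s v \<in> (\<lambda>v. c' * s v) ` S" using assms(2) eq by blast
    then obtain w where w: "w \<in> S" "c * s v = c' * s w" by auto
    have "norm c * M = norm c' * norm (s w)" using arg_cong[OF w(2), of norm] assms(4)[OF v]
      by (simp add: norm_mult)
    also have "\<dots> \<le> norm c' * M" using le[OF w(1)] by (intro mult_left_mono) auto
    finally show ?thesis using assms(3) by simp
  qed
  show n: "norm a = norm a'" using step[OF assms(6)] step[OF assms(6)[symmetric]] by simp
  have sub: "(\<lambda>v. c * s v) ` F \<subseteq> (\<lambda>v. c' * s v) ` F"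
    if eq: "(\<lambda>v. c * s v) ` S = (\<lambda>v. c' * s v) ` S" and n: "norm c = norm c'" for c c'
  proof
    fix x assume "x \<in> (\<lambda>v. c * s v) ` F"
    then obtain v where v: "v \<in> F" "x = c * s v" by auto
    then have "x \<in> (\<lambda>v. c' * s v) ` S" using assms(2) eq by blast
    then obtain w where w: "w \<in> S" "x = c' * s w" by auto
    have "c * s v = c' * s w" using v w by simp
    from arg_cong[OF this, of norm] have "norm c * M = norm c' * norm (s w)"
      using assms(4)[OF v(1)] by (simp add: norm_mult)
    then have "c' = 0 \<or> norm (s w) = M" using n by auto
    then show "x \<in> (\<lambda>v. c' * s v) ` F"
    proof
      assume "c' = 0" then show ?thesis using v w by auto
    next
      assume "norm (s w) = M"
      then have "w \<in> F" using assms(5)[of w] w(1) by auto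
      then show ?thesis using w by auto
    qed
  qed
  show "(\<lambda>v. a * s v) ` F = (\<lambda>v. a' * s v) ` F"
    using sub[OF assms(6) n] sub[OF assms(6)[symmetric] n[symmetric]] by blast
qed

lemma sum_list_0: "sum_list pverts = 0" "sum_list (vlist Star) = 0" by code_simp+

lemma pverts_distinct: "distinct pverts" by code_simp

lemma pverts_frame:
  assumes a: "a \<noteq> 0" and eq: "pt a b ` set pverts = pt a' b' ` set pverts"
  shows "b = b'" "\<exists>k<5. a' = a * zeta10 ^ (2 * k)"
proof -
  have ne: "lone \<in> set pverts" "lrot 2 lone \<in> set pverts" "lone \<noteq> lrot 2 lone" by code_simp+
  have a': "a' \<noteq> 0" by (rule pt_image_nonzero[OF a ne eq])
  have "length pverts = 5" by code_simp
  then show b: "b = b'" using centroid_eq[OF a a' pverts_distinct eq] by (simp add: sum_list_0 ev_0)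
  have "pt a' b' lone \<in> pt a b ` set pverts" using eq ne(1) by blast
  then have "\<exists>k\<in>{0,1,2,3,4}. a' = a * zeta10 ^ (2 * k)"
    by (auto simp: b pt_def pverts_def ev_rot ev_one)
  then obtain k where "k \<in> {0,1,2,3,4}" "a' = a * zeta10 ^ (2 * k)" by blast
  then show "\<exists>k<5. a' = a * zeta10 ^ (2 * k)" by (intro exI[of _ k]) auto
qed

lemma mark_check:
  "list_all (\<lambda>k. k = 0 \<or> \<not> list_all (\<lambda>v. v \<in> {lone, lrot 2 lone}) [lrot (2 * k) lone, lrot (2 * k + 2) lone])
    [0,1,2,3,4]"
  by code_simp

lemma side_frame:
  assumes "a \<noteq> 0" "side b a 0 = side b (a * zeta10 ^ (2 * k)) 0" "k < 5"
  shows "k = 0"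
proof -
  have "k \<in> set [0,1,2,3,4]" using assms(3) by auto
  have p: "pt (a * zeta10 ^ (2 * k)) b v = pt a b (lrot (2 * k) v)" for v
    by (simp add: pt_def ev_rot)
  have "{pt a b lone, pt a b (lrot 2 lone)} = {pt a b (lrot (2 * k) lone), pt a b (lrot (2 * k + 2) lone)}"
    using assms(2) by (simp add: side_ev p lrot_lrot numeral_2_eq_2[symmetric])
  then have "pt a b ` {lrot (2 * k) lone, lrot (2 * k + 2) lone} \<subseteq> pt a b ` {lone, lrot 2 lone}" by simp
  then have "{lrot (2 * k) lone, lrot (2 * k + 2) lone} \<subseteq> {lone, lrot 2 lone}"
    using inj_pt[OF assms(1), of b] by (simp only: inj_image_subset_iff)
  then show ?thesis using mark_check \<open>k \<in> set [0,1,2,3,4]\<close> by (auto simp: list_all_iff)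
qed

text \<open>Seven times the vector from the centroid of the seven vertices of a boat to \<open>v\<close>. The two outer
  apices are the farthest from the centroid, and their sum fixes the direction.\<close>
definition bcen :: "lat \<Rightarrow> lat" where "bcen v = v + v + v + v + v + v + v - sum_list (vlist Boat)"

lemma boat_far_check:
  "list_all (\<lambda>v. v = avert 0 \<or> v = avert 2 \<or>
     surely_pos (nsqA (bcen (avert 0)) - nsqA (bcen v)) (nsqB (bcen (avert 0)) - nsqB (bcen v))) (vlist Boat)"
  "nsqA (bcen (avert 0)) = nsqA (bcen (avert 2))" "nsqB (bcen (avert 0)) = nsqB (bcen (avert 2))"
  "surely_pos (nsqA (bcen (avert 0))) (nsqB (bcen (avert 0)))"
  "bcen (avert 0) + bcen (avert 2) \<noteq> 0" "avert 0 \<in> set (vlist Boat)" "avert 2 \<in> set (vlist Boat)"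
  "avert 0 \<noteq> avert 2" "bcen (avert 0) \<noteq> bcen (avert 2)" "length (vlist Boat) = 7"
  by code_simp+

lemma star_far_check:
  "list_all (\<lambda>v. v \<in> set (map avert [0,1,2,3,4]) \<or> surely_pos (nsqA (avert 0) - nsqA v) (nsqB (avert 0) - nsqB v)) (vlist Star)"
  "list_all (\<lambda>v. v \<in> set (vlist Star)) (map avert [0,1,2,3,4])" "length (vlist Star) = 10"
  by code_simp+

definition dtip :: lat where "dtip = Lat (-2) 0 (-2) (-2)"

lemma diamond_far_check:
  "list_all (\<lambda>v. v = dtip \<or> surely_pos (nsqA (dtip + lone) - nsqA (v + lone)) (nsqB (dtip + lone) - nsqB (v + lone))) (vlist Diamond)"
  "dtip \<in> set (vlist Diamond)" "dtip + lone \<noteq> 0"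
  by code_simp+

lemma norm_less_of_nsq:
  assumes "surely_pos (nsqA w - nsqA v) (nsqB w - nsqB v)"
  shows "norm (ev v) < norm (ev w)"
proof -
  have "(norm (ev v))\<^sup>2 < (norm (ev w))\<^sup>2"
    using surely_pos[OF assms] unfolding norm_ev by (simp add: algebra_simps)
  then show ?thesis by (rule power2_less_imp_less) simp
qed

lemma avert_ev: "ev (avert k) = phi * zeta10 ^ (2 * k + 1)"
  by (simp add: avert_def ev_rot ev_phi ev_one)

lemma kind_conc [simp]: "kind (conc a b t) = akind t"
  by (cases t) (auto simp: star_def boat_def diamond_def pent_def Let_def split: tile_kind.split)

text \<open>The substitution is defined on tiles as subsets of the plane. To follow it in coordinates, the
  frame has to be recovered from the tile: the centre from the centroid of the vertices, the direction
  from the vertices farthest from it, and from the distinguished side of a pentagon.\<close>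
theorem conc_frame:
  assumes eq: "conc a b (base K) = conc a' b' (base K')" and a: "a \<noteq> 0"
  shows "K' = K" "b' = b" "\<exists>k<5. a' = a * zeta10 ^ (2 * k)" "\<not> five_fold K \<Longrightarrow> a' = a"
proof -
  show K: "K' = K" using arg_cong[OF eq, of kind] unfolding kind_conc by (simp add: base_def)
  have V: "pt a b ` set (vlist K) = pt a' b' ` set (vlist K)"
    using arg_cong[OF eq, of "\<lambda>t. endpoints (edges t)"] unfolding K endpoints_conc .
  have D: "distinct (vlist K)" using vlist_check all_kinds[of K] by (auto simp: list_all_iff)
  have "b' = b \<and> (\<exists>k<5. a' = a * zeta10 ^ (2 * k)) \<and> (\<not> five_fold K \<longrightarrow> a' = a)"
  proof (cases "K \<in> {PAlpha, PBeta, PGamma}")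
    case True
    have "vlist K = pverts" using True by (elim insertE emptyE) (simp_all add: vlist_def map_fst_zip)
    then have p: "b = b'" "\<exists>k<5. a' = a * zeta10 ^ (2 * k)" using pverts_frame[OF a, of b a' b'] V by simp_all
    have "a' = a" if "\<not> five_fold K"
    proof -
      have "side b a 0 = side b' a' 0"
        using arg_cong[OF eq, of mark] True that unfolding K
        by (auto simp: base_def pent_def pt_def ev_0)
      moreover obtain k where k: "k < 5" "a' = a * zeta10 ^ (2 * k)" using p(2) by blast
      ultimately have "k = 0" using side_frame[OF a _ k(1)] p(1) by simp
      then show ?thesis using k by simp
    qed
    with p show ?thesis by simp
  next
    case False
    then consider (S) "K = Star" | (B) "K = Boat" | (D) "K = Diamond" by (cases K) auto
    then show ?thesis
    proof cases
      case S
      have "avert 0 \<in> set (vlist K)" "avert 1 \<in> set (vlist K)" "avert 0 \<noteq> avert 1"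
        using star_far_check(2) by (simp_all add: S) code_simp
      then have a': "a' \<noteq> 0" by (rule pt_image_nonzero[OF a _ _ _ V])
      have b: "b' = b" using centroid_eq[OF a a' D V] star_far_check(3) by (simp add: S sum_list_0 ev_0)
      have im: "(\<lambda>v. a * ev v) ` set (vlist K) = (\<lambda>v. a' * ev v) ` set (vlist K)"
        using arg_cong[OF V, of "image (\<lambda>x. x - b)"] unfolding b by (simp add: image_image pt_def)
      have ex: "(\<lambda>v. a * ev v) ` (avert ` {0,1,2,3,4}) = (\<lambda>v. a' * ev v) ` (avert ` {0,1,2,3,4})"
      proof (rule extremal_eq(2)[OF _ _ phi_pos(1) _ _ im])
        show "avert ` {0,1,2,3,4} \<subseteq> set (vlist K)" using star_far_check(2) by (simp add: S)
        show n: "norm (ev v) = phi" if "v \<in> avert ` {0,1,2,3,4}" for v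
          using that phi_pos by (auto simp: avert_ev norm_mult norm_power)
        show "norm (ev v) < phi" if "v \<in> set (vlist K) - avert ` {0,1,2,3,4}" for v
        proof -
          have "surely_pos (nsqA (avert 0) - nsqA v) (nsqB (avert 0) - nsqB v)"
            using star_far_check(1) that by (auto simp: S list_all_iff)
          from norm_less_of_nsq[OF this] n[of "avert 0"] show ?thesis by simp
        qed
      qed simp
      have "a' * ev (avert 0) \<in> (\<lambda>v. a * ev v) ` (avert ` {0,1,2,3,4})" unfolding ex by blast
      then obtain k where k: "k \<in> {0,1,2,3,4}" "a' * ev (avert 0) = a * ev (avert k)"
        by blast
      then have "a' = a * zeta10 ^ (2 * k)" using phi_pos by (simp add: avert_ev)
      moreover have "k < 5" using k(1) by auto
      ultimately show ?thesis using b S by auto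
    next
      case B
      note bc = boat_far_check
      have a': "a' \<noteq> 0" using pt_image_nonzero[OF a _ _ bc(8) V] bc(6,7) by (simp add: B)
      have cen: "7 * b + a * ev (sum_list (vlist Boat)) = 7 * b' + a' * ev (sum_list (vlist Boat))"
        using centroid_eq[OF a a' D V] bc by (simp add: B)
      have id: "a * ev (bcen v) = 7 * pt a b v - (7 * b + a * ev (sum_list (vlist Boat)))" for a b v
        by (simp add: pt_def bcen_def ev_add ev_diff algebra_simps)
      \<comment> \<open>Both frames have the same centroid, so the sets of vectors from it to the vertices coincide.\<close>
      define X where "X = 7 * b + a * ev (sum_list (vlist Boat))"
      have "(\<lambda>v. a * ev (bcen v)) ` set (vlist K) = (\<lambda>x. 7 * x - X) ` pt a b ` set (vlist K)"
        unfolding image_image id[of a _ b] X_def ..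
      moreover have "(\<lambda>v. a' * ev (bcen v)) ` set (vlist K) = (\<lambda>x. 7 * x - X) ` pt a' b' ` set (vlist K)"
        unfolding image_image id[of a' _ b'] X_def cen ..
      ultimately have im: "(\<lambda>v. a * ev (bcen v)) ` set (vlist K) = (\<lambda>v. a' * ev (bcen v)) ` set (vlist K)"
        unfolding V by simp
      define M where "M = norm (ev (bcen (avert 0)))"
      have M: "norm (ev (bcen (avert 2))) = M"
      proof -
        have "(norm (ev (bcen (avert 2))))\<^sup>2 = M\<^sup>2" unfolding M_def norm_ev bc(2,3) ..
        then show ?thesis by (simp add: M_def)
      qed
      have "(\<lambda>v. a * ev (bcen v)) ` {avert 0, avert 2} = (\<lambda>v. a' * ev (bcen v)) ` {avert 0, avert 2}"
      proof (rule extremal_eq(2)[OF _ _ _ _ _ im])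
        have "M\<^sup>2 > 0" unfolding M_def norm_ev using surely_pos[OF bc(4)] .
        then show "M > 0" by (simp add: M_def)
        show "norm (ev (bcen v)) < M" if "v \<in> set (vlist K) - {avert 0, avert 2}" for v
          unfolding M_def by (rule norm_less_of_nsq) (use bc(1) that in \<open>auto simp: B list_all_iff\<close>)
      qed (use bc M M_def in \<open>auto simp: B\<close>)
      then have set2: "{a * ev (bcen (avert 0)), a * ev (bcen (avert 2))} = {a' * ev (bcen (avert 0)), a' * ev (bcen (avert 2))}"
        by simp
      \<comment> \<open>The two farthest vertices may be exchanged, which does not change their sum.\<close>
      have "a * ev (bcen (avert 0)) + a * ev (bcen (avert 2)) = a' * ev (bcen (avert 0)) + a' * ev (bcen (avert 2))"
        using set2 by (auto simp: doubleton_eq_iff)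
      then have "(a - a') * ev (bcen (avert 0) + bcen (avert 2)) = 0" by (simp add: ev_add algebra_simps)
      then have "a' = a" using bc(5) ev_eq_0[of "bcen (avert 0) + bcen (avert 2)"] by auto
      moreover from this cen have "b' = b" by simp
      ultimately show ?thesis by (auto intro!: exI[of _ "0::nat"])
    next
      case D
      have m: "b - a = b' - a'" using arg_cong[OF eq, of mark] unfolding K
        by (simp add: D base_def diamond_def pt_def ev_0)
      have id: "a * ev (v + lone) = pt a b v - (b - a)" for a b v
        by (simp add: pt_def ev_add ev_one algebra_simps)
      have "(\<lambda>v. a * ev (v + lone)) ` set (vlist K) = (\<lambda>x. x - (b - a)) ` pt a b ` set (vlist K)"
        unfolding image_image id[of a _ b] ..
      moreover have "(\<lambda>v. a' * ev (v + lone)) ` set (vlist K) = (\<lambda>x. x - (b - a)) ` pt a' b' ` set (vlist K)"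
        unfolding image_image id[of a' _ b'] m ..
      ultimately have im: "(\<lambda>v. a * ev (v + lone)) ` set (vlist K) = (\<lambda>v. a' * ev (v + lone)) ` set (vlist K)"
        unfolding V by simp
      have nz: "ev (dtip + lone) \<noteq> 0" using diamond_far_check(3) ev_eq_0 by blast
      have "(\<lambda>v. a * ev (v + lone)) ` {dtip} = (\<lambda>v. a' * ev (v + lone)) ` {dtip}"
      proof (rule extremal_eq(2)[OF _ _ _ _ _ im])
        show "norm (ev (dtip + lone)) > 0" using nz by simp
        show "norm (ev (v + lone)) < norm (ev (dtip + lone))" if "v \<in> set (vlist K) - {dtip}" for v
          by (rule norm_less_of_nsq) (use diamond_far_check(1) that in \<open>auto simp: D list_all_iff\<close>)
      qed (use diamond_far_check in \<open>auto simp: D\<close>)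
      then have "a' = a" using nz by simp
      moreover from this m have "b' = b" by simp
      ultimately show ?thesis by (auto intro!: exI[of _ "0::nat"])
    qed
  qed
  then show "b' = b" "\<exists>k<5. a' = a * zeta10 ^ (2 * k)" "\<not> five_fold K \<Longrightarrow> a' = a" by auto
qed

section \<open>Placing abstract tiles\<close>

lemma UN_shift5:
  assumes "g (5::nat) = g 0"
  shows "(\<Union>k<5. g (Suc k)) = (\<Union>k<5. g k)"
proof -
  have "(\<Union>k<5. g k) = (\<Union>k\<in>{..<5}. g k) \<union> g 5" using assms by (auto intro!: bexI[of _ 0])
  also have "\<dots> = (\<Union>k\<in>{..<Suc 5}. g k)" unfolding lessThan_Suc by (simp only: UN_insert Un_commute)
  also have "\<dots> = g 0 \<union> (\<Union>k<5. g (Suc k))" unfolding lessThan_Suc_eq_insert_0 by (simp only: UN_insert SUP_image o_def)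
  also have "\<dots> = (\<Union>k<5. g (Suc k))"
    using assms UN_upper[of 4 "{..<5}" "\<lambda>k. g (Suc k)"] by auto
  finally show ?thesis by simp
qed

lemma image_shift5: "f (5::nat) = f 0 \<Longrightarrow> (\<lambda>k. f (Suc k)) ` {..<5} = f ` {..<5}"
  using UN_shift5[of "\<lambda>k. {f k}"] by (simp only: UNION_singleton_eq_range)

lemma zeta5_pow6: "zeta5 ^ 6 = zeta5" using zeta5_mod[of 6] by simp

lemma vtx_turn: "vtx c (r * zeta5) k = vtx c r (Suc k)" by (simp add: vtx_def)

lemma vtx_image_turn: "vtx c (r * zeta5) ` {..<5} = vtx c r ` {..<5}"
  unfolding vtx_turn by (rule image_shift5) (simp add: vtx_def zeta5_pow5)

lemma star_turn: "star c (r * zeta5) = star c r"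
proof -
  have "apex c (r * zeta5) k = apex c r (Suc k)" for k by (simp add: apex_def vtx_turn)
  then have "point c (r * zeta5) k = point c r (Suc k)" "legs c (r * zeta5) k = legs c r (Suc k)" for k
    by (simp_all add: point_def legs_def vtx_turn)
  moreover have "point c r 5 = point c r 0" "legs c r 5 = legs c r 0"
    by (simp_all add: point_def legs_def apex_def vtx_def zeta5_pow5 zeta5_pow6)
  ultimately show ?thesis
    by (simp add: star_def vtx_image_turn UN_shift5[of "point c r"] UN_shift5[of "legs c r"])
qed

lemma pent_turn: "pent K c (r * zeta5) D = pent K c r D"
proof -
  have "side c (r * zeta5) = (\<lambda>k. side c r (Suc k))" by (simp add: side_def vtx_turn fun_eq_iff)
  moreover have "side c r 5 = side c r 0" by (simp add: side_def vtx_def zeta5_pow5 zeta5_pow6)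
  ultimately have "side c (r * zeta5) ` {..<5} = side c r ` {..<5}"
    by (simp only: image_shift5)
  then show ?thesis by (simp add: pent_def vtx_image_turn)
qed

lemma zeta10_turn: "r * zeta10 ^ (2 * Suc k) = r * zeta10 ^ (2 * k) * zeta5"
  by (simp add: zeta5_eq power2_eq_square mult_ac)

lemma star_turns: "star c (r * zeta10 ^ (2 * k)) = star c r"
proof (induction k)
  case (Suc k)
  then show ?case unfolding zeta10_turn star_turn .
qed simp

lemma pent_turns: "pent K c (r * zeta10 ^ (2 * k)) D = pent K c r D"
proof (induction k)
  case (Suc k)
  then show ?case unfolding zeta10_turn pent_turn .
qed simp

lemma conc_mod10: "conc a b (ATile K z (d mod 10)) = conc a b (ATile K z d)"
  by (simp flip: zeta10_mod)

lemma conc_dir_norm: "conc a b (ATile K z (dir_norm K d)) = conc a b (ATile K z d)"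
proof (cases "five_fold K")
  case True
  have d: "d = d mod 2 + 2 * (d div 2)" by simp
  have e: "a * zeta10 ^ d = a * zeta10 ^ (d mod 2) * zeta10 ^ (2 * (d div 2))"
    by (subst d) (simp only: power_add mult.assoc)
  have f: "a * zeta10 ^ d / phi = a * zeta10 ^ (d mod 2) / phi * zeta10 ^ (2 * (d div 2))"
    unfolding e by simp
  have "K = Star \<or> K = PGamma" using True by (cases K) simp_all
  then show ?thesis
  proof
    assume "K = Star"
    then show ?thesis
      by (simp only: dir_norm_def five_fold.simps if_True conc.simps Let_def tile_kind.case f star_turns)
  next
    assume "K = PGamma"
    then show ?thesis
      by (simp only: dir_norm_def five_fold.simps if_True conc.simps Let_def tile_kind.case e pent_turns)
  qed
qed (simp add: dir_norm_def conc_mod10 del: conc.simps)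

lemma conc_place: "conc a b (place z d x) = conc (a * zeta10 ^ d) (pt a b z) x"
proof (cases x)
  case (ATile K w f)
  have "conc a b (place z d x) = conc a b (ATile K (z + lrot d w) (f + d))"
    by (simp only: ATile place.simps conc_dir_norm)
  also have "\<dots> = conc (a * zeta10 ^ (f + d)) (pt a b (z + lrot d w)) (base K)" by (rule conc_base)
  also have "a * zeta10 ^ (f + d) = a * zeta10 ^ d * zeta10 ^ f" by (simp add: power_add)
  also have "pt a b (z + lrot d w) = pt (a * zeta10 ^ d) (pt a b z) w"
    using pt_put[of a b K z d w] by simp
  finally show ?thesis by (simp only: ATile conc_base[of "a * zeta10 ^ d"])
qed

lemma pt_0: "pt a b 0 = b" by (simp add: pt_def ev_0)

lemma five_fold_kids_check:
  "list_all (\<lambda>K. five_fold K \<longrightarrow> list_all (\<lambda>k. list_all (\<lambda>x. place 0 (2 * k) x \<in> set (map (place 0 0) (kids0 K))) (kids0 K))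
     [0,1,2,3,4]) all_kinds"
  by code_simp

lemma kids0_turn:
  assumes "five_fold K" "k < 5" "x \<in> set (kids0 K)"
  shows "\<exists>x'\<in>set (kids0 K). conc (a * zeta10 ^ (2 * k)) b x = conc a b x'"
proof -
  have "k \<in> set [0,1,2,3,4]" using assms(2) by auto
  then have "place 0 (2 * k) x \<in> set (map (place 0 0) (kids0 K))"
    using five_fold_kids_check all_kinds[of K] assms(1,3) unfolding list_all_iff by blast
  then obtain x' where x': "x' \<in> set (kids0 K)" "place 0 (2 * k) x = place 0 0 x'" by auto
  have "conc (a * zeta10 ^ (2 * k)) b x = conc a b (place 0 (2 * k) x)" by (simp add: conc_place pt_0 del: conc.simps)
  also have "\<dots> = conc a b x'" unfolding x'(2) by (simp add: conc_place pt_0 del: conc.simps)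
  finally show ?thesis using x'(1) by blast
qed

section \<open>Children of realized tiles\<close>

declare conc.simps [simp del]

lemma conc_simps:
  fixes a b :: complex
  shows "conc a b (ATile Star z d) = star (pt a b z) (a * zeta10 ^ d / phi)"
    "conc a b (ATile Boat z d) = boat (pt a b z) (a * zeta10 ^ d / phi)"
    "conc a b (ATile Diamond z d) = diamond (pt a b z - a * zeta10 ^ d) (a * zeta10 ^ d / rho)"
    "conc a b (ATile PGamma z d) = pent PGamma (pt a b z) (a * zeta10 ^ d) {}"
    "conc a b (ATile PAlpha z d) = pent PAlpha (pt a b z) (a * zeta10 ^ d) (side (pt a b z) (a * zeta10 ^ d) 0)"
    "conc a b (ATile PBeta z d) = pent PBeta (pt a b z) (a * zeta10 ^ d) (side (pt a b z) (a * zeta10 ^ d) 0)"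
  by (simp_all add: conc.simps Let_def)

lemma conc_base_simps:
  fixes a b :: complex
  shows "conc a b (base Star) = star b (a / phi)" "conc a b (base Boat) = boat b (a / phi)"
    "conc a b (base Diamond) = diamond (b - a) (a / rho)" "conc a b (base PGamma) = pent PGamma b a {}"
    "conc a b (base PAlpha) = pent PAlpha b a (side b a 0)" "conc a b (base PBeta) = pent PBeta b a (side b a 0)"
  by (simp_all add: base_def conc_simps pt_0)

lemma enl_eq:
  fixes z :: complex
  shows "enl z = phi * phi * z"
  by (simp add: enl_def scaleR_conv_of_real power2_eq_square)

lemma phi_sq_complex: "complex_of_real phi * complex_of_real phi = complex_of_real phi + 1"
  using arg_cong[OF phi_sq, of complex_of_real] by simp

lemma centre_conc: "pent PGamma (enl c) (- r) {} = conc r (enl c) (ATile PGamma 0 5)"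
  by (simp add: conc_simps pt_0 zeta10_5)

lemma corner_conc:
  assumes "K \<in> {PAlpha, PBeta}"
  shows "corner K c r i j = conc r (enl c) (acorner K i j)"
proof -
  have c: "corner_centre c r i = pt r (enl c) (lrot (2 * i + 2) (lphi lone))"
  proof -
    have "corner_centre c r i = vtx (enl c) (enl r) (i + 1) - (1 / phi\<^sup>2) *\<^sub>R (enl r * zeta5 ^ (i + 1))"
      by (simp add: corner_centre_def vtx_def Let_def)
    also have "(1 / phi\<^sup>2) *\<^sub>R (enl r * zeta5 ^ (i + 1)) = r * zeta5 ^ (i + 1)"
      unfolding enl_def mult_scaleR_left scaleR_scaleR using phi_pos by simp
    also have "vtx (enl c) (enl r) (i + 1) = enl c + (phi + 1) * r * zeta5 ^ (i + 1)"
      unfolding vtx_def enl_eq[of r] phi_sq ..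
    also have "enl c + (phi + 1) * r * zeta5 ^ (i + 1) - r * zeta5 ^ (i + 1) = enl c + phi * r * zeta5 ^ (i + 1)"
      by (simp add: algebra_simps)
    finally show ?thesis
      unfolding zeta5_pow by (simp add: pt_def ev_rot ev_phi ev_one algebra_simps)
  qed
  have s: "side C (r * zeta10 ^ (2 * j)) 0 = side C r j" for C
    by (simp add: side_def vtx_def zeta5_pow algebra_simps)
  show ?thesis using assms
    by (auto simp: corner_def acorner_def conc_simps pent_turns s c)
qed

lemma edge_diamond_conc:
  assumes r: "norm r = rho"
  shows "edge_diamond c r i = conc r (enl c) (aedge_diamond i)"
proof -
  let ?q = "r * zeta10 ^ (2 * i + 1)"
  have p: "midpoint (vtx (enl c) (enl r) i) (vtx (enl c) (enl r) (i + 1)) = enl c + complex_of_real (phi ^ 3 / 2) * ?q"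
  proof -
    have "1 + zeta5 = phi * zeta10"
    proof -
      have "lone + lrot 2 lone = lphi (lrot 1 lone)" by code_simp
      then show ?thesis unfolding ev_inj[symmetric] ev_add ev_rot ev_phi ev_one by (simp add: zeta5_eq)
    qed
    then have z: "zeta5 = phi * zeta10 - 1" by (simp add: algebra_simps)
    have "midpoint (vtx (enl c) (enl r) i) (vtx (enl c) (enl r) (i + 1))
        = enl c + enl r * zeta5 ^ i * (1 + zeta5) / 2"
      by (simp add: midpoint_def vtx_def scaleR_conv_of_real field_simps)
    also have "\<dots> = enl c + complex_of_real (phi ^ 3 / 2) * ?q"
      unfolding \<open>1 + zeta5 = phi * zeta10\<close> enl_eq[of r] zeta5_pow by (simp add: power3_eq_cube)
    finally show ?thesis .
  qed
  have nq: "norm ?q = rho" by (simp add: norm_mult norm_power r)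
  have n: "sgn (enl c - (enl c + complex_of_real (phi ^ 3 / 2) * ?q)) = - (?q / rho)"
  proof -
    have "norm (complex_of_real (phi ^ 3 / 2) * ?q) = phi ^ 3 / 2 * rho"
      using phi_pos by (simp only: norm_mult[of "complex_of_real _"] nq norm_of_real) simp
    then show ?thesis using phi_pos rho_pos
      by (simp add: sgn_eq divide_simps)
  qed
  have "cos (pi / 10) * (2 * sin (pi / 5)) = sin (3 * pi / 10) + sin (pi / 10)"
    using sin_times_cos[of "pi / 5" "pi / 10"] by (simp add: algebra_simps)
  also have "sin (3 * pi / 10) = cos (pi / 5)" unfolding sin_cos_eq by (rule arg_cong[where f = cos]) simp
  also have "sin (pi / 10) = cos (2 * (pi / 5))" unfolding sin_cos_eq by (rule arg_cong[where f = cos]) simp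
  also have "cos (2 * (pi / 5)) = (phi - 1) / 2"
    unfolding cos_double_cos cos36 using phi_sq by (simp add: power2_eq_square)
  finally have "cos (pi / 10) * (1 / rho) = (2 * phi - 1) / 2"
    unfolding rho_eq by (simp add: cos36 field_simps)
  then have "phi ^ 3 / 2 - cos (pi / 10) / rho = 1"
    using phi_sq by (simp add: power3_eq_cube algebra_simps)
  then have "complex_of_real (phi ^ 3 / 2) - complex_of_real (cos (pi / 10) / rho) = 1"
    by (metis of_real_1 of_real_diff)
  then have "(complex_of_real (phi ^ 3 / 2) - complex_of_real (cos (pi / 10) / rho)) * ?q = ?q" by simp
  then have m: "complex_of_real (phi ^ 3 / 2) * ?q - complex_of_real (cos (pi / 10)) * (?q / rho) = ?q"
    by (simp add: left_diff_distrib)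
  have "enl c + complex_of_real (phi ^ 3 / 2) * ?q + cos (pi / 10) *\<^sub>R (- (?q / rho))
      = enl c + (complex_of_real (phi ^ 3 / 2) * ?q - complex_of_real (cos (pi / 10)) * (?q / rho))"
    by (simp only: scaleR_conv_of_real mult_minus_right add_uminus_conv_diff add_diff_eq)
  then have m': "enl c + complex_of_real (phi ^ 3 / 2) * ?q + cos (pi / 10) *\<^sub>R (- (?q / rho)) = enl c + ?q"
    unfolding m .
  have e2: "ev (Lat 2 0 0 0) = 2" by simp
  have "edge_diamond c r i = diamond (enl c + ?q) (?q / rho)"
    unfolding edge_diamond_def Let_def p n m' minus_minus ..
  also have "\<dots> = conc r (enl c) (aedge_diamond i)"
    unfolding aedge_diamond_def conc_simps
    by (simp add: pt_def ev_rot e2 mult_ac add_ac del: ev.simps)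
  finally show ?thesis .
qed

lemma vtx_image_frame:
  assumes "r \<noteq> 0" "vtx c r ` {..<5} = vtx c' r' ` {..<5}"
  shows "c = c'" "\<exists>k<5. r' = r * zeta10 ^ (2 * k)"
proof -
  have "vtx c r ` {..<5} = pt r c ` set pverts" for c r
    by (simp add: lessThan_small vtx_ev pverts_def)
  then show "c = c'" "\<exists>k<5. r' = r * zeta10 ^ (2 * k)"
    using pverts_frame[OF assms(1), of c r' c'] assms(2) by simp_all
qed

lemma core_star_conc:
  fixes q r :: complex
  assumes r: "norm r = rho / phi" and eq: "apex c r ` {..<5} = vtx C (phi * q) ` {..<5}"
  shows "star c r = star C (q * zeta10 ^ 9 / phi)"
proof -
  have r0: "r \<noteq> 0" using r rho_pos phi_pos by auto
  have "vtx c (phi\<^sup>2 * r * zeta10) ` {..<5} = vtx C (phi * q) ` {..<5}"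
    using eq by (simp add: apex_vtx)
  from vtx_image_frame[OF _ this] obtain k where k: "c = C" "phi * q = phi\<^sup>2 * r * zeta10 * zeta10 ^ (2 * k)"
    using r0 phi_pos by auto
  from k(2) have "q = phi * r * zeta10 * zeta10 ^ (2 * k)" using phi_pos by (simp add: power2_eq_square)
  moreover have "zeta10 * zeta10 ^ 9 = 1" using zeta10_10 by (simp flip: power_Suc)
  ultimately have "q * zeta10 ^ 9 / phi = r * zeta10 ^ (2 * k)" using phi_pos by (simp add: mult_ac)
  then show ?thesis using star_turns[of C r k] k(1) by simp
qed

lemma leg_dir: "ev (cvert 1) \<noteq> ev (avert 1)" unfolding ev_inj by code_simp

text \<open>The boat at a tip is given by the apex of its middle point and the direction of a leg; this
  determines its centre and direction.\<close>
lemma tip_boat_frame: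
  fixes a p A c r :: complex
  assumes a: "norm a = rho" and A: "A = p + phi * phi * (a * zeta10 ^ d) * (ev (cvert 1) - ev (avert 1))"
    and b: "is_tip_boat p A B c r"
  shows "phi * r = a * zeta10 ^ d" "c = p - a * zeta10 ^ d * ev (avert 1)"
proof -
  let ?e = "ev (cvert 1) - ev (avert 1)"
  have r: "norm r = rho / phi" and p: "apex c r 1 = p" and v: "vtx c r 1 \<in> closed_segment p A"
    using b by (auto simp: is_tip_boat_def)
  have r': "r = (phi * r) / phi" using phi_pos by simp
  have p': "p = c + phi * r * ev (avert 1)" using p by (subst (asm) r') (simp only: apex_ev pt_def)
  have "vtx c r 1 = c + phi * r * ev (cvert 1)" by (subst r') (simp only: vtx_core_ev pt_def)
  then have vp: "vtx c r 1 = p + phi * r * ?e" by (simp add: p' algebra_simps)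
  from v obtain u where u: "0 \<le> u" "u \<le> 1" "vtx c r 1 = (1 - u) *\<^sub>R p + u *\<^sub>R A"
    by (auto simp: in_segment)
  then have "phi * r * ?e = complex_of_real (u * phi * phi) * (a * zeta10 ^ d) * ?e"
    unfolding vp A by (simp add: scaleR_conv_of_real algebra_simps)
  then have e: "phi * r = complex_of_real (u * phi * phi) * (a * zeta10 ^ d)" using leg_dir by simp
  have "rho = norm (phi * r)" using phi_pos by (simp add: norm_mult r)
  also have "\<dots> = u * phi * phi * rho"
    unfolding e using u(1) phi_pos by (simp only: norm_mult norm_of_real) (simp add: norm_power a)
  finally have "u * phi * phi = 1" using rho_pos by simp
  with e show 1: "phi * r = a * zeta10 ^ d" by simp
  show "c = p - a * zeta10 ^ d * ev (avert 1)" using p' 1 by simp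
qed

lemma tip_children:
  fixes a p A :: complex
  assumes a: "norm a = rho" and A: "A = p + phi * phi * (a * zeta10 ^ d) * (ev (cvert 1) - ev (avert 1))"
    and b: "is_tip_boat p A B c r" and p: "p = pt a C P"
  shows "boat c r = conc a C (ATile Boat (P - lrot (d + 3) (lphi lone)) d)"
    and "vtx c' r' 0 = vtx c r 0 \<Longrightarrow> vtx c' r' 1 = vtx c r 3 \<Longrightarrow>
      pent PAlpha c' r' (side c' r' 0) = conc a C (ATile PAlpha (P - lrot (d + 3) (lphi (lphi lone))) (d + 2))"
proof -
  note f = tip_boat_frame[OF a A b]
  have av: "ev (avert 1) = phi * zeta10 ^ 3" by (simp add: avert_ev)
  have c: "c = pt a C (P - lrot (d + 3) (lphi lone))"
    unfolding f(2) p av by (simp add: pt_def ev_diff ev_rot ev_phi ev_one power_add algebra_simps)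
  have r: "r = a * zeta10 ^ d / phi" using f(1) phi_pos by (simp add: field_simps)
  show "boat c r = conc a C (ATile Boat (P - lrot (d + 3) (lphi lone)) d)"
    unfolding conc_simps c r ..
  assume v: "vtx c' r' 0 = vtx c r 0" "vtx c' r' 1 = vtx c r 3"
  let ?q = "a * zeta10 ^ d"
  have v0: "c' + r' = c + ?q * ev (cvert 0)" and v1: "c' + r' * zeta5 = c + ?q * ev (cvert 3)"
    using v unfolding r vtx_core_ev by (simp_all add: vtx_def pt_def)
  have l: "cvert 3 - cvert 0 = lrot 4 lone - lrot 2 lone" "cvert 0 = lrot 2 lone - lrot 3 lone"
    by code_simp+
  have l1: "ev (cvert 3) - ev (cvert 0) = zeta10 ^ 4 - zeta10\<^sup>2"
    using arg_cong[OF l(1), of ev] by (simp add: ev_diff ev_rot ev_one)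
  have l2: "ev (cvert 0) = zeta10\<^sup>2 - zeta10 ^ 3"
    using arg_cong[OF l(2), of ev] by (simp add: ev_diff ev_rot ev_one)
  have "r' * (zeta5 - 1) = ?q * (ev (cvert 3) - ev (cvert 0))" 
  proof -
    have "(c' + r' * zeta5) - (c' + r') = (c + ?q * ev (cvert 3)) - (c + ?q * ev (cvert 0))"
      unfolding v0 v1 ..
    then show ?thesis by (simp add: algebra_simps)
  qed
  also have "\<dots> = ?q * zeta10\<^sup>2 * (zeta5 - 1)" unfolding l1 by (simp add: zeta5_eq algebra_simps power_numeral_reduce)
  finally have "r' = ?q * zeta10\<^sup>2 \<or> zeta5 = 1" by auto
  moreover have "zeta5 \<noteq> 1"
  proof -
    have "ev (lrot 2 lone) \<noteq> ev lone" unfolding ev_inj by code_simp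
    then show ?thesis by (simp add: ev_rot ev_one zeta5_eq)
  qed
  ultimately have r': "r' = a * zeta10 ^ (d + 2)" by (simp add: power_add power2_eq_square)
  have "c' = c + ?q * (zeta10\<^sup>2 - zeta10 ^ 3) - r'" using v0 unfolding l2 by (simp add: algebra_simps)
  also have "\<dots> = c - ?q * zeta10 ^ 3" unfolding r' by (simp add: power_add power2_eq_square algebra_simps)
  also have "\<dots> = pt a C (P - lrot (d + 3) (lphi (lphi lone)))"
    unfolding c using phi_sq_complex
    by (simp add: pt_def ev_diff ev_rot ev_phi ev_one power_add algebra_simps)
  finally have c': "c' = pt a C (P - lrot (d + 3) (lphi (lphi lone)))" .
  show "pent PAlpha c' r' (side c' r' 0) = conc a C (ATile PAlpha (P - lrot (d + 3) (lphi (lphi lone))) (d + 2))"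
    unfolding conc_simps c' r' ..
qed

lemma atip_check:
  "list_all (\<lambda>k. let P = lphi (lphi (avert k)); d = 2 * k + 8 in
     map (place 0 0) (atip k) = map (place 0 0) [ATile Boat (P - lrot (d + 3) (lphi lone)) d,
       ATile PAlpha (P - lrot (d + 3) (lphi (lphi lone))) (d + 2)] \<and>
     cvert k - avert k = lrot d (cvert 1 - avert 1)) [0,1,2,3,4]"
  by code_simp

lemma diamond_tip_check:
  "let P = lphi (lphi dtip); d = 7 in
     map (place 0 0) [ATile Boat (lphi lone) 7, ATile PAlpha (lphi lone - lone) 9] =
     map (place 0 0) [ATile Boat (P - lrot (d + 3) (lphi lone)) d,
       ATile PAlpha (P - lrot (d + 3) (lphi (lphi lone))) (d + 2)] \<and>
     dverts ! 1 - dtip = lrot d (cvert 1 - avert 1) \<and> dverts ! 2 = dtip"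
  by code_simp

lemma conc_place0: "place 0 0 x = place 0 0 y \<Longrightarrow> conc a b x = conc a b y"
  using conc_place[of a b 0 0 x] conc_place[of a b 0 0 y] by (simp add: pt_0)

lemma piece_of_tip:
  fixes a b :: complex
  assumes a: "norm a = rho" and k: "k < 5" and A: "is_tip_boat (enl (apex b (a / phi) k)) (enl (vtx b (a / phi) k)) B c r"
  shows "\<exists>x\<in>set (atip k). boat c r = conc a (enl b) x"
    and "vtx c' r' 0 = vtx c r 0 \<Longrightarrow> vtx c' r' 1 = vtx c r 3 \<Longrightarrow>
      \<exists>x\<in>set (atip k). pent PAlpha c' r' (side c' r' 0) = conc a (enl b) x"
proof -
  let ?P = "lphi (lphi (avert k))" and ?d = "2 * k + 8"
  have "k \<in> set [0,1,2,3,4]" using k by auto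
  then have ch: "map (place 0 0) (atip k) = map (place 0 0) [ATile Boat (?P - lrot (?d + 3) (lphi lone)) ?d,
       ATile PAlpha (?P - lrot (?d + 3) (lphi (lphi lone))) (?d + 2)]"
    and leg: "cvert k - avert k = lrot ?d (cvert 1 - avert 1)"
    using atip_check unfolding list_all_iff Let_def by blast+
  have p: "enl (apex b (a / phi) k) = pt a (enl b) ?P"
    unfolding apex_ev by (simp add: pt_def enl_eq ev_phi algebra_simps)
  have leg': "ev (cvert k) - ev (avert k) = zeta10 ^ ?d * (ev (cvert 1) - ev (avert 1))"
    using arg_cong[OF leg, of ev] by (simp only: ev_diff ev_rot)
  have "enl (vtx b (a / phi) k) = enl (apex b (a / phi) k) + phi * phi * a * (ev (cvert k) - ev (avert k))"
    unfolding apex_ev vtx_core_ev pt_def enl_eq by (simp add: algebra_simps)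
  then have v: "enl (vtx b (a / phi) k) = enl (apex b (a / phi) k)
      + phi * phi * (a * zeta10 ^ ?d) * (ev (cvert 1) - ev (avert 1))"
    unfolding leg' by (simp add: mult.assoc)
  note tc = tip_children[OF a v A p]
  have *: "\<exists>x\<in>set (atip k). conc a (enl b) y = conc a (enl b) x"
    if y: "y \<in> {ATile Boat (?P - lrot (?d + 3) (lphi lone)) ?d, ATile PAlpha (?P - lrot (?d + 3) (lphi (lphi lone))) (?d + 2)}" for y
  proof -
    have "place 0 0 y \<in> set (map (place 0 0) (atip k))" unfolding ch using y by (elim insertE emptyE) simp_all
    then obtain x where "x \<in> set (atip k)" "place 0 0 y = place 0 0 x"
      unfolding set_map by (elim imageE) (rule that)
    then show ?thesis by (intro bexI[of _ x] conc_place0)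
  qed
  show "\<exists>x\<in>set (atip k). boat c r = conc a (enl b) x" unfolding tc(1) by (rule *) simp
  assume v: "vtx c' r' 0 = vtx c r 0" "vtx c' r' 1 = vtx c r 3"
  show "\<exists>x\<in>set (atip k). pent PAlpha c' r' (side c' r' 0) = conc a (enl b) x"
    unfolding tc(2)[OF v] by (rule *) simp
qed

lemma piece_of_diamond_tip:
  fixes a b :: complex
  assumes a: "norm a = rho"
    and A: "is_tip_boat (enl (dvtx (b - a) (a / rho) 2)) (enl (dvtx (b - a) (a / rho) 1)) B c r"
  shows "\<exists>x\<in>set (kids0 Diamond). boat c r = conc a (enl b) x"
    and "vtx c' r' 0 = vtx c r 0 \<Longrightarrow> vtx c' r' 1 = vtx c r 3 \<Longrightarrow>
      \<exists>x\<in>set (kids0 Diamond). pent PAlpha c' r' (side c' r' 0) = conc a (enl b) x"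
proof -
  let ?P = "lphi (lphi dtip)" and ?d = "7 :: nat"
  have ch: "map (place 0 0) [ATile Boat (lphi lone) 7, ATile PAlpha (lphi lone - lone) 9] =
     map (place 0 0) [ATile Boat (?P - lrot (?d + 3) (lphi lone)) ?d,
       ATile PAlpha (?P - lrot (?d + 3) (lphi (lphi lone))) (?d + 2)]"
    and leg: "dverts ! 1 - dtip = lrot ?d (cvert 1 - avert 1)" and tip: "dverts ! 2 = dtip"
    using diamond_tip_check unfolding Let_def by blast+
  have p: "enl (dvtx (b - a) (a / rho) 2) = pt a (enl b) ?P"
    by (simp add: dvtx_ev tip pt_def enl_eq ev_phi algebra_simps)
  have leg': "ev (dverts ! 1) - ev dtip = zeta10 ^ ?d * (ev (cvert 1) - ev (avert 1))"
    using arg_cong[OF leg, of ev] by (simp only: ev_diff ev_rot)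
  have "dvtx (b - a) (a / rho) 1 = pt a b (dverts ! 1)" "dvtx (b - a) (a / rho) 2 = pt a b dtip"
    using dvtx_ev[of 1 b a] dvtx_ev[of 2 b a] tip by simp_all
  then have "enl (dvtx (b - a) (a / rho) 1) = enl (dvtx (b - a) (a / rho) 2) + phi * phi * a * (ev (dverts ! 1) - ev dtip)"
    unfolding pt_def enl_eq by (simp add: algebra_simps)
  then have v: "enl (dvtx (b - a) (a / rho) 1) = enl (dvtx (b - a) (a / rho) 2)
      + phi * phi * (a * zeta10 ^ ?d) * (ev (cvert 1) - ev (avert 1))"
    unfolding leg' by (simp add: mult.assoc)
  note tc = tip_children[OF a v A p]
  have *: "\<exists>x\<in>set (kids0 Diamond). conc a (enl b) y = conc a (enl b) x"
    if y: "y \<in> {ATile Boat (?P - lrot (?d + 3) (lphi lone)) ?d, ATile PAlpha (?P - lrot (?d + 3) (lphi (lphi lone))) (?d + 2)}" for y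
  proof -
    have "place 0 0 y \<in> set (map (place 0 0) [ATile Boat (lphi lone) 7, ATile PAlpha (lphi lone - lone) 9])"
      unfolding ch using y by (elim insertE emptyE) simp_all
    then obtain x where "x \<in> set [ATile Boat (lphi lone) 7, ATile PAlpha (lphi lone - lone) 9]" "place 0 0 y = place 0 0 x"
      unfolding set_map by (elim imageE) (rule that)
    then show ?thesis by (intro bexI[of _ x] conc_place0) auto
  qed
  show "\<exists>x\<in>set (kids0 Diamond). boat c r = conc a (enl b) x" unfolding tc(1) by (rule *) simp
  assume v: "vtx c' r' 0 = vtx c r 0" "vtx c' r' 1 = vtx c r 3"
  show "\<exists>x\<in>set (kids0 Diamond). pent PAlpha c' r' (side c' r' 0) = conc a (enl b) x"
    unfolding tc(2)[OF v] by (rule *) simp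
qed

text \<open>Inversion in a standard frame; the statement is closed under turning the frame of a star or
  a \<gamma>-pentagon because their lists of children are.\<close>
definition child_of :: "tile_kind \<Rightarrow> complex \<Rightarrow> complex \<Rightarrow> tile \<Rightarrow> bool" where
  "child_of K a b t' \<longleftrightarrow> (\<exists>x\<in>set (kids0 K). t' = conc a (enl b) x)"

lemma core_diamond_conc:
  fixes m u :: complex
  assumes q: "norm (rho * u) = rho"
    and V0: "vtx C R 0 = enl m"
    and V23: "{vtx C R 2, vtx C R 3} = {enl (dvtx m u 1), enl (dvtx m u 3)}"
    and star: "norm r = rho / phi" "apex c r ` {..<5} = vtx C R ` {..<5}"
  shows "child_of Diamond (rho * u) (m + rho * u) (star c r)"
proof -
  let ?q = "rho * u"
  have q0: "?q \<noteq> 0" using q rho_pos by auto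
  have dv: "dvtx m u k = m + ?q * (ev (dverts ! k) + 1)" if "k < 4" for k
    using dvtx_ev[OF that, of "m + ?q" ?q] rho_pos by (simp add: pt_def algebra_simps)
  have l: "lphi (lphi (dverts ! 1 + lone)) = - lphi (lrot 4 lone - lone)"
    "lphi (lphi (dverts ! 3 + lone)) = - lphi (lrot 6 lone - lone)" by code_simp+
  have d1: "phi * (phi * (ev (dverts ! 1) + 1)) = - (phi * (zeta10 ^ 4 - 1))"
    using arg_cong[OF l(1), of ev] by (simp only: ev_phi ev_add ev_minus ev_diff ev_rot ev_one mult_1_right)
  have d3: "phi * (phi * (ev (dverts ! 3) + 1)) = - (phi * (zeta10 ^ 6 - 1))"
    using arg_cong[OF l(2), of ev] by (simp only: ev_phi ev_add ev_minus ev_diff ev_rot ev_one mult_1_right)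
  have "enl (dvtx m u 1) = enl m + ?q * (phi * (phi * (ev (dverts ! 1) + 1)))"
    "enl (dvtx m u 3) = enl m + ?q * (phi * (phi * (ev (dverts ! 3) + 1)))"
    by (simp_all add: dv enl_eq algebra_simps)
  then have o: "enl (dvtx m u 1) = enl m - phi * ?q * (zeta10 ^ 4 - 1)" "enl (dvtx m u 3) = enl m - phi * ?q * (zeta10 ^ 6 - 1)"
    unfolding d1 d3 by (simp_all add: algebra_simps)
  have C: "C = enl m - R" using V0 by (simp add: vtx_def algebra_simps)
  have v2: "vtx C R 2 = enl m + R * (zeta10 ^ 4 - 1)" and v3: "vtx C R 3 = enl m + R * (zeta10 ^ 6 - 1)"
    by (simp_all add: C vtx_def zeta5_pow algebra_simps)
  have ne: "zeta10 ^ 4 - 1 \<noteq> 0"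
  proof -
    have "ev (lrot 4 lone) \<noteq> ev lone" unfolding ev_inj by code_simp
    then show ?thesis by (simp add: ev_rot ev_one)
  qed
  have R: "R = - (phi * ?q)"
  proof -
    consider "vtx C R 2 = enl (dvtx m u 1)" | "vtx C R 2 = enl (dvtx m u 3)" "vtx C R 3 = enl (dvtx m u 1)"
      using V23 unfolding doubleton_eq_iff by blast
    then show ?thesis
    proof cases
      case 1
      then have "(R + phi * ?q) * (zeta10 ^ 4 - 1) = 0" unfolding v2 o by (simp add: algebra_simps)
      then have "R + phi * ?q = 0" using ne by (simp only: mult_eq_0_iff) simp
      then show ?thesis by (rule eq_neg_iff_add_eq_0[THEN iffD2])
    next
      case 2
      define x y P where "x = zeta10 ^ 4 - 1" "y = zeta10 ^ 6 - 1" "P = phi * ?q"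
      have 1: "R * x = - (P * y)" and 2: "R * y = - (P * x)"
        using 2 unfolding v2 v3 o x_y_P_def by (simp_all add: algebra_simps)
      have "P * (y * y) = - (R * x) * y" unfolding 1 by simp
      also have "\<dots> = - (R * y) * x" by simp
      also have "\<dots> = P * (x * x)" unfolding 2 by simp
      finally have "y * y = x * x" using q0 phi_pos by (simp add: x_y_P_def(3))
      then have "zeta10 ^ 12 - zeta10 ^ 6 - zeta10 ^ 6 = zeta10 ^ 8 - zeta10 ^ 4 - zeta10 ^ 4"
        unfolding x_y_P_def by (simp add: algebra_simps flip: power_add)
      moreover have "ev (lrot 12 lone - lrot 6 lone - lrot 6 lone) \<noteq> ev (lrot 8 lone - lrot 4 lone - lrot 4 lone)"
        unfolding ev_inj by code_simp
      ultimately show ?thesis by (simp add: ev_diff ev_rot ev_one)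
    qed
  qed
  have "apex c r ` {..<5} = vtx C (phi * (- ?q)) ` {..<5}" using star(2) R by simp
  from core_star_conc[OF star(1) this]
  have t': "star c r = star C (- ?q * zeta10 ^ 9 / phi)" .
  have "zeta10 ^ 9 = - (zeta10 ^ 4)" by (rule zeta10_powers(6))
  then have "star c r = star C (?q * zeta10 ^ 4 / phi)" unfolding t' by simp
  moreover have "C = pt ?q (enl (m + ?q)) (- lone)"
  proof -
    have "C = enl m + phi * ?q" unfolding C R by simp
    also have "\<dots> = enl m + (phi + 1) * ?q - ?q" by (simp add: algebra_simps)
    also have "\<dots> = enl (m + ?q) - ?q" unfolding enl_eq phi_sq by (simp add: algebra_simps)
    finally show ?thesis by (simp add: pt_def ev_minus ev_one)
  qed
  ultimately show ?thesis by (simp add: child_of_def conc_simps)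
qed

lemma child_of_frame:
  assumes "conc a b (base K) = conc a' b' (base K')" "norm a = rho" "child_of K' a' b' t'"
  shows "child_of K a b t'"
proof -
  have a: "a \<noteq> 0" using assms(2) rho_pos by auto
  note f = conc_frame[OF assms(1) a]
  obtain k where k: "k < 5" "a' = a * zeta10 ^ (2 * k)" using f(3) by blast
  obtain x where x: "x \<in> set (kids0 K)" "t' = conc a' (enl b) x"
    using assms(3) f(1,2) by (auto simp: child_of_def)
  show ?thesis
  proof (cases "five_fold K")
    case True
    then show ?thesis using kids0_turn[OF True k(1) x(1), of a "enl b"] x(2) k(2) by (auto simp: child_of_def)
  qed (use f(4) x in \<open>auto simp: child_of_def\<close>)
qed

lemma frame_norm:
  assumes "conc a b (base K) = conc a' b' (base K')" "norm a = rho"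
  shows "norm a' = rho"
proof -
  have a: "a \<noteq> 0" using assms(2) rho_pos by auto
  from conc_frame(3)[OF assms(1) a] show ?thesis using assms(2) by (auto simp: norm_mult norm_power)
qed

lemma star_frame:
  fixes r u :: complex
  shows "star c r = conc (phi * r) c (base Star)" "boat c r = conc (phi * r) c (base Boat)"
  "diamond m u = conc (rho * u) (m + rho * u) (base Diamond)"
  using phi_pos rho_pos by (simp_all add: conc_base_simps)

lemma piece_conc_base:
  assumes "piece t t'" "t = conc a b (base K)" "norm a = rho"
  shows "child_of K a b t'"
  using assms(1)
proof cases
  case (gamma_centre c r)
  have "child_of PGamma r c t'" unfolding gamma_centre(2) centre_conc by (simp add: child_of_def)
  then show ?thesis
    by (rule child_of_frame[rotated 2]) (use assms gamma_centre in \<open>simp_all add: conc_base_simps\<close>)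
next
  case (gamma_corner i c r)
  have "i \<in> set [0,1,2,3,4]" using gamma_corner(3) by auto
  then have "child_of PGamma r c t'" unfolding gamma_corner(2) corner_inner_def
    by (subst corner_conc) (auto simp: child_of_def)
  then show ?thesis
    by (rule child_of_frame[rotated 2]) (use assms gamma_corner in \<open>simp_all add: conc_base_simps\<close>)
next
  case (beta_centre c r)
  have "child_of PBeta r c t'" unfolding beta_centre(2) centre_conc by (simp add: child_of_def)
  then show ?thesis
    by (rule child_of_frame[rotated 2]) (use assms beta_centre in \<open>simp_all add: conc_base_simps\<close>)
next
  case (beta_corner_40 c r)
  have "child_of PBeta r c t'" unfolding beta_corner_40(2) corner_g_next_def
    by (subst corner_conc) (auto simp: child_of_def)
  then show ?thesis
    by (rule child_of_frame[rotated 2]) (use assms beta_corner_40 in \<open>simp_all add: conc_base_simps\<close>)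
next
  case (beta_corner_01 c r)
  have "child_of PBeta r c t'" unfolding beta_corner_01(2) corner_g_this_def
    by (subst corner_conc) (auto simp: child_of_def)
  then show ?thesis
    by (rule child_of_frame[rotated 2]) (use assms beta_corner_01 in \<open>simp_all add: conc_base_simps\<close>)
next
  case (beta_corner i c r)
  have "child_of PBeta r c t'" using beta_corner(3) unfolding beta_corner(2) corner_inner_def
    by (subst corner_conc) (auto simp: child_of_def)
  then show ?thesis
    by (rule child_of_frame[rotated 2]) (use assms beta_corner in \<open>simp_all add: conc_base_simps\<close>)
next
  case (beta_diamond c r)
  have eq: "conc a b (base K) = conc r c (base PBeta)" using assms beta_diamond by (simp add: conc_base_simps)
  have "child_of PBeta r c t'" unfolding beta_diamond(2) edge_diamond_conc[OF frame_norm[OF eq assms(3)]]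
    by (simp add: child_of_def)
  then show ?thesis by (rule child_of_frame[OF eq assms(3)])
next
  case (alpha_centre c r)
  have "child_of PAlpha r c t'" unfolding alpha_centre(2) centre_conc by (simp add: child_of_def)
  then show ?thesis
    by (rule child_of_frame[rotated 2]) (use assms alpha_centre in \<open>simp_all add: conc_base_simps\<close>)
next
  case (alpha_corner_01 c r)
  have "child_of PAlpha r c t'" unfolding alpha_corner_01(2) corner_g_next_def
    by (subst corner_conc) (auto simp: child_of_def numeral_2_eq_2[symmetric])
  then show ?thesis
    by (rule child_of_frame[rotated 2]) (use assms alpha_corner_01 in \<open>simp_all add: conc_base_simps\<close>)
next
  case (alpha_corner_12 c r)
  have "child_of PAlpha r c t'" unfolding alpha_corner_12(2) corner_g_this_def
    by (subst corner_conc) (auto simp: child_of_def)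
  then show ?thesis
    by (rule child_of_frame[rotated 2]) (use assms alpha_corner_12 in \<open>simp_all add: conc_base_simps\<close>)
next
  case (alpha_corner_34 c r)
  have "child_of PAlpha r c t'" unfolding alpha_corner_34(2) corner_g_next_def
    by (subst corner_conc) (auto simp: child_of_def)
  then show ?thesis
    by (rule child_of_frame[rotated 2]) (use assms alpha_corner_34 in \<open>simp_all add: conc_base_simps\<close>)
next
  case (alpha_corner_40 c r)
  have "child_of PAlpha r c t'" unfolding alpha_corner_40(2) corner_g_this_def
    by (subst corner_conc) (auto simp: child_of_def)
  then show ?thesis
    by (rule child_of_frame[rotated 2]) (use assms alpha_corner_40 in \<open>simp_all add: conc_base_simps\<close>)
next
  case (alpha_corner_23 c r)
  have "child_of PAlpha r c t'" unfolding alpha_corner_23(2) corner_inner_def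
    by (subst corner_conc) (auto simp: child_of_def)
  then show ?thesis
    by (rule child_of_frame[rotated 2]) (use assms alpha_corner_23 in \<open>simp_all add: conc_base_simps\<close>)
next
  case (alpha_diamond i c r)
  have eq: "conc a b (base K) = conc r c (base PAlpha)" using assms alpha_diamond by (simp add: conc_base_simps)
  have "child_of PAlpha r c t'" using alpha_diamond(3)
    unfolding alpha_diamond(2) edge_diamond_conc[OF frame_norm[OF eq assms(3)]]
    by (auto simp: child_of_def)
  then show ?thesis by (rule child_of_frame[OF eq assms(3)])
next
  case (core_star C R r c)
  from core_star(2) show ?thesis
  proof cases
    case (1 c0 r0)
    have eq: "conc a b (base K) = conc (phi * r0) c0 (base Star)" using assms 1 by (simp add: star_frame)
    have "apex c r ` {..<5} = vtx C (phi * (phi * r0)) ` {..<5}"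
      using core_star(4) 1 by (simp add: enl_eq mult.assoc)
    from core_star_conc[OF core_star(3) this]
    have "child_of Star (phi * r0) c0 t'" unfolding core_star(1) 1
      by (simp add: child_of_def conc_simps pt_0)
    then show ?thesis by (rule child_of_frame[OF eq assms(3)])
  next
    case (2 c0 r0)
    have eq: "conc a b (base K) = conc (phi * r0) c0 (base Boat)" using assms 2 by (simp add: star_frame)
    have "apex c r ` {..<5} = vtx C (phi * (phi * r0)) ` {..<5}"
      using core_star(4) 2 by (simp add: enl_eq mult.assoc)
    from core_star_conc[OF core_star(3) this]
    have "child_of Boat (phi * r0) c0 t'" unfolding core_star(1) 2
      by (simp add: child_of_def conc_simps pt_0)
    then show ?thesis by (rule child_of_frame[OF eq assms(3)])
  next
    case (3 m u)
    have eq: "conc a b (base K) = conc (rho * u) (m + rho * u) (base Diamond)" using assms 3 by (simp add: star_frame)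
    have "child_of Diamond (rho * u) (m + rho * u) (star c r)"
      by (rule core_diamond_conc[OF frame_norm[OF eq assms(3)] 3(2,3) core_star(3,4)])
    then have "child_of Diamond (rho * u) (m + rho * u) t'" unfolding core_star(1) .
    then show ?thesis by (rule child_of_frame[OF eq assms(3)])
  qed
next
  case (boat_at_tip p A B c r)
  from boat_at_tip(2) show ?thesis
  proof cases
    case (1 k c0 r0)
    have eq: "conc a b (base K) = conc (phi * r0) c0 (base Star)" using assms 1 by (simp add: star_frame)
    have "k \<in> {0,1,2,3,4}" using 1 by auto
    moreover have "\<exists>x\<in>set (atip k). boat c r = conc (phi * r0) (enl c0) x"
      by (rule piece_of_tip(1)[OF frame_norm[OF eq assms(3)]]) (use 1 boat_at_tip phi_pos in simp_all)
    ultimately have "child_of Star (phi * r0) c0 t'" unfolding boat_at_tip(1) by (auto simp: child_of_def)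
    then show ?thesis by (rule child_of_frame[OF eq assms(3)])
  next
    case (2 k c0 r0)
    have eq: "conc a b (base K) = conc (phi * r0) c0 (base Boat)" using assms 2 by (simp add: star_frame)
    have "k \<in> {0,1,2}" using 2 by auto
    moreover have "\<exists>x\<in>set (atip k). boat c r = conc (phi * r0) (enl c0) x"
      by (rule piece_of_tip(1)[OF frame_norm[OF eq assms(3)]]) (use 2 boat_at_tip phi_pos in simp_all)
    ultimately have "child_of Boat (phi * r0) c0 t'" unfolding boat_at_tip(1) by (auto simp: child_of_def)
    then show ?thesis by (rule child_of_frame[OF eq assms(3)])
  next
    case (3 m u)
    have eq: "conc a b (base K) = conc (rho * u) (m + rho * u) (base Diamond)" using assms 3 by (simp add: star_frame)
    have "\<exists>x\<in>set (kids0 Diamond). boat c r = conc (rho * u) (enl (m + rho * u)) x"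
      by (rule piece_of_diamond_tip(1)[OF frame_norm[OF eq assms(3)]]) (use 3 boat_at_tip rho_pos in simp_all)
    then have "child_of Diamond (rho * u) (m + rho * u) t'" unfolding boat_at_tip(1) child_of_def .
    then show ?thesis by (rule child_of_frame[OF eq assms(3)])
  qed
next
  case (pent_at_tip p A B c r c' r')
  from pent_at_tip(2) show ?thesis
  proof cases
    case (1 k c0 r0)
    have eq: "conc a b (base K) = conc (phi * r0) c0 (base Star)" using assms 1 by (simp add: star_frame)
    have "k \<in> {0,1,2,3,4}" using 1 by auto
    moreover have "\<exists>x\<in>set (atip k). pent PAlpha c' r' (side c' r' 0) = conc (phi * r0) (enl c0) x"
      by (rule piece_of_tip(2)[OF frame_norm[OF eq assms(3)]]) (use 1 pent_at_tip phi_pos in simp_all)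
    ultimately have "child_of Star (phi * r0) c0 t'" unfolding pent_at_tip(1) by (auto simp: child_of_def)
    then show ?thesis by (rule child_of_frame[OF eq assms(3)])
  next
    case (2 k c0 r0)
    have eq: "conc a b (base K) = conc (phi * r0) c0 (base Boat)" using assms 2 by (simp add: star_frame)
    have "k \<in> {0,1,2}" using 2 by auto
    moreover have "\<exists>x\<in>set (atip k). pent PAlpha c' r' (side c' r' 0) = conc (phi * r0) (enl c0) x"
      by (rule piece_of_tip(2)[OF frame_norm[OF eq assms(3)]]) (use 2 pent_at_tip phi_pos in simp_all)
    ultimately have "child_of Boat (phi * r0) c0 t'" unfolding pent_at_tip(1) by (auto simp: child_of_def)
    then show ?thesis by (rule child_of_frame[OF eq assms(3)])
  next
    case (3 m u)
    have eq: "conc a b (base K) = conc (rho * u) (m + rho * u) (base Diamond)" using assms 3 by (simp add: star_frame)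
    have "\<exists>x\<in>set (kids0 Diamond). pent PAlpha c' r' (side c' r' 0) = conc (rho * u) (enl (m + rho * u)) x"
      by (rule piece_of_diamond_tip(2)[OF frame_norm[OF eq assms(3)]]) (use 3 pent_at_tip rho_pos in simp_all)
    then have "child_of Diamond (rho * u) (m + rho * u) t'" unfolding pent_at_tip(1) child_of_def .
    then show ?thesis by (rule child_of_frame[OF eq assms(3)])
  qed
qed

text \<open>Once the frame of the tile is recovered by \<open>conc_frame\<close>, each case of the definition of pieces is
  a computation with lattice points.\<close>
theorem piece_conc:
  assumes "piece (conc a b x) t'" "norm a = rho"
  shows "\<exists>y\<in>set (kids x). t' = conc a (enl b) y"
proof (cases x)
  case (ATile K z d)
  have n: "norm (a * zeta10 ^ d) = rho" using assms(2) by (simp add: norm_mult norm_power)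
  have "child_of K (a * zeta10 ^ d) (pt a b z) t'"
    by (rule piece_conc_base[OF assms(1) _ n]) (simp add: ATile conc_base[of a b K z d])
  then obtain y where y: "y \<in> set (kids0 K)" "t' = conc (a * zeta10 ^ d) (enl (pt a b z)) y"
    by (auto simp: child_of_def)
  have "enl (pt a b z) = pt a (enl b) (lphi (lphi z))" by (simp add: pt_def enl_eq ev_phi algebra_simps)
  then have "t' = conc a (enl b) (place (lphi (lphi z)) d y)" by (simp add: y(2) conc_place)
  then show ?thesis using y(1) by (auto simp: ATile)
qed

section \<open>Near pairs of tiles\<close>

definition far :: "atile \<Rightarrow> atile \<Rightarrow> bool" where
  "far s t \<longleftrightarrow> rad (akind s) + rad (akind t) < norm (ev (apos t - apos s))"

text \<open>The relative position of the two tiles occurs in the list of near pairs.\<close>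
definition legal :: "atile \<Rightarrow> atile \<Rightarrow> bool" where
  "legal s t \<longleftrightarrow> (\<exists>z d K x. x \<in> set (nbrs K) \<and> s = place z d (base K) \<and> t = place z d x)"

definition normal :: "atile \<Rightarrow> bool" where
  "normal t \<longleftrightarrow> dir_norm (akind t) (adir t) = adir t"

lemma rad_pos: "rad K > 1 / 2" using phi_bounds by (simp add: rad_def)

lemma rad_le: "rad K \<le> phi" using phi_bounds by (simp add: rad_def)

lemma rad_sq: "(rad K)\<^sup>2 = real_of_int (if is_large K then 1 else 8) + real_of_int (if is_large K then 1 else - 4) * phi"
proof -
  have "phi\<^sup>2 = 1 + 1 * phi" "(2 * phi - 2)\<^sup>2 = 8 + (- 4) * phi" using phi_sq by algebra+
  then show ?thesis by (simp add: rad_def)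
qed

lemma rsq: "real_of_int (rsqA K L) + rsqB K L * phi = (rad K + rad L)\<^sup>2"
proof -
  have "4 + 4 * phi = (phi + phi)\<^sup>2" "13 + (- 3) * phi = (phi + (2 * phi - 2))\<^sup>2"
    "13 + (- 3) * phi = ((2 * phi - 2) + phi)\<^sup>2" "32 + (- 16) * phi = ((2 * phi - 2) + (2 * phi - 2))\<^sup>2"
    using phi_sq by algebra+
  then show ?thesis
    by (cases "is_large K"; cases "is_large L") (simp_all only: rsqA_def rsqB_def rad_def if_True if_False
      of_int_numeral of_int_minus)
qed

lemma surely_far_imp:
  assumes "surely_far s t"
  shows "far s t"
proof -
  let ?z = "apos t - apos s" and ?A = "rsqA (akind s) (akind t)" and ?B = "rsqB (akind s) (akind t)"
  have "surely_pos (nsqA ?z - ?A) (nsqB ?z - ?B)" using assms by (simp only: surely_far_def Let_def)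
  from surely_pos[OF this] have "real_of_int ?A + ?B * phi < nsqA ?z + nsqB ?z * phi"
    unfolding of_int_diff left_diff_distrib by linarith
  then have "(rad (akind s) + rad (akind t))\<^sup>2 < (norm (ev ?z))\<^sup>2" by (simp only: rsq norm_ev)
  then show ?thesis unfolding far_def by (rule power2_less_imp_less) simp
qed

lemma surely_near_imp:
  assumes "surely_near s t"
  shows "\<not> far s t"
proof -
  let ?z = "apos t - apos s" and ?A = "rsqA (akind s) (akind t)" and ?B = "rsqB (akind s) (akind t)"
  have "surely_nonneg (?A - nsqA ?z) (?B - nsqB ?z)" using assms by (simp only: surely_near_def Let_def)
  from surely_nonneg[OF this] have "nsqA ?z + nsqB ?z * phi \<le> real_of_int ?A + ?B * phi"
    unfolding of_int_diff left_diff_distrib by linarith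
  then have "(norm (ev ?z))\<^sup>2 \<le> (rad (akind s) + rad (akind t))\<^sup>2" by (simp only: rsq norm_ev)
  moreover have "0 \<le> rad (akind s) + rad (akind t)" using rad_pos[of "akind s"] rad_pos[of "akind t"] by linarith
  ultimately show ?thesis unfolding far_def not_less by (rule power2_le_imp_le)
qed

lemma place_sel [simp]: "akind (place z d x) = akind x" "apos (place z d x) = z + lrot d (apos x)"
  "adir (place z d x) = dir_norm (akind x) (adir x + d)"
  by (cases x; simp)+

lemma dir_norm_add: "dir_norm K (dir_norm K f + d) = dir_norm K (f + d)"
  by (simp add: dir_norm_def mod_add_left_eq)

lemma dir_norm_idem: "dir_norm K (dir_norm K f) = dir_norm K f"
  by (simp add: dir_norm_def)

lemma normal_place [simp]: "normal (place z d x)" by (simp add: normal_def dir_norm_idem)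

lemma lrot_lrot': "lrot n (lrot m z) = lrot (m + n) z"
  unfolding lrot_lrot by (subst add.commute) (rule refl)

lemma place_place: "place z d (place z' d' x) = place (z + lrot d z') (d' + d) x"
  by (cases x) (simp add: lrot_add lrot_lrot' dir_norm_add add.assoc)

lemma place_self: "normal s \<Longrightarrow> s = place (apos s) (adir s) (base (akind s))"
  by (cases s) (simp add: normal_def base_def lrot_0)

lemma far_place: "far (place z d s) (place z d t) \<longleftrightarrow> far s t"
proof -
  have "(z + lrot d (apos t)) - (z + lrot d (apos s)) = lrot d (apos t - apos s)"
    by (simp add: lrot_diff)
  then show ?thesis by (simp add: far_def)
qed

lemma legal_place: "legal s t \<Longrightarrow> legal (place z d s) (place z d t)"
proof -
  assume "legal s t"
  then obtain z' d' K x where "x \<in> set (nbrs K)" "s = place z' d' (base K)" "t = place z' d' x"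
    by (auto simp: legal_def)
  then show ?thesis
    unfolding legal_def by (intro exI[of _ "z + lrot d z'"] exI[of _ "d' + d"] exI[of _ K] exI[of _ x])
      (simp add: place_place)
qed

lemma legal_at_imp: "normal s \<Longrightarrow> legal_at s t \<Longrightarrow> legal s t"
proof -
  assume s: "normal s" and "legal_at s t"
  then obtain x where x: "x \<in> set (nbrs (akind s))" "place (apos s) (adir s) x = t"
    unfolding legal_at_def list_ex_iff by blast
  show ?thesis unfolding legal_def
    by (intro exI[of _ "apos s"] exI[of _ "adir s"] exI[of _ "akind s"] exI[of _ x] conjI x(1) place_self[OF s] x(2)[symmetric])
qed

lemma place_mod10: "place z (d mod 10) x = place z d x"
proof (cases x)
  case (ATile K w f)
  have "(f + d mod 10) mod 2 = (f + d mod 10 mod 2) mod 2" by (rule mod_add_right_eq[symmetric])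
  also have "d mod 10 mod 2 = d mod 2" by (rule mod_mod_cancel) simp
  also have "(f + d mod 2) mod 2 = (f + d) mod 2" by (rule mod_add_right_eq)
  finally have "dir_norm K (f + d mod 10) = dir_norm K (f + d)"
    by (simp only: dir_norm_def mod_add_right_eq)
  then show ?thesis by (simp only: ATile place.simps lrot_mod[of d w, symmetric])
qed

text \<open>For the kinds without five-fold symmetry the frame of a tile is determined by the tile.\<close>
lemma legal_at_of_legal:
  assumes "legal s t" "\<not> five_fold (akind s)"
  shows "legal_at s t"
proof -
  obtain z d K x where x: "x \<in> set (nbrs K)" "s = place z d (base K)" "t = place z d x"
    using assms(1) by (auto simp: legal_def)
  have 1: "akind s = K" "apos s = z" "adir s = dir_norm K d" by (simp_all add: x(2) base_def lrot_0)
  then have "adir s = d mod 10" using assms(2) by (simp add: dir_norm_def)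
  note 1(1,2) this
  then have "place (apos s) (adir s) x = t" using 1(1,2) by (simp add: x(3) place_mod10 del: place.simps)
  then show ?thesis unfolding legal_at_def list_ex_iff using x(1) \<open>akind s = K\<close> by blast
qed

lemma turn_kids0:
  assumes "five_fold K"
  shows "place z (d + 2 * k) ` set (kids0 K) \<subseteq> place z d ` set (kids0 K)"
proof
  fix y assume "y \<in> place z (d + 2 * k) ` set (kids0 K)"
  then obtain x where x: "x \<in> set (kids0 K)" "y = place z (d + 2 * k) x" by auto
  have k: "k mod 5 \<in> set [0,1,2,3,4]" by auto
  have "(d + 2 * k) mod 10 = (d + (2 * k) mod (2 * 5)) mod 10" by (simp add: mod_add_right_eq)
  then have "(d + 2 * k) mod 10 = (d + 2 * (k mod 5)) mod 10" by (simp only: mult_mod_right)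
  from arg_cong[OF this, of "\<lambda>n. place z n x"]
  have "y = place z (d + 2 * (k mod 5)) x" by (simp only: x(2) place_mod10)
  then have y: "y = place z d (place 0 (2 * (k mod 5)) x)"
    unfolding place_place lrot_0 by (simp add: add.commute)
  have "place 0 (2 * (k mod 5)) x \<in> set (map (place 0 0) (kids0 K))"
    using five_fold_kids_check all_kinds[of K] assms x(1) k unfolding list_all_iff by blast
  then obtain x' where x': "x' \<in> set (kids0 K)" "place 0 (2 * (k mod 5)) x = place 0 0 x'" by auto
  have "y = place z d x'" unfolding y x'(2) place_place lrot_0 by simp
  then show "y \<in> place z d ` set (kids0 K)" using x'(1) by blast
qed

lemma kids_place: "set (kids (place z d x)) = place (lphi (lphi z)) d ` set (kids x)"
proof (cases x)
  case (ATile K w f)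
  let ?z = "lphi (lphi (z + lrot d w))"
  have "place (lphi (lphi z)) d ` set (kids x) = place ?z (f + d) ` set (kids0 K)"
    by (simp add: ATile image_image place_place lphi_add lrot_phi)
  also have "\<dots> = place ?z (dir_norm K (f + d)) ` set (kids0 K)"
  proof (cases "five_fold K")
    case True
    define n where "n = f + d"
    have n: "dir_norm K n = n mod 2" using True by (simp add: dir_norm_def)
    have e1: "n = n mod 2 + 2 * (n div 2)" by simp
    have e2: "place ?z (n mod 2) y = place ?z (n + 2 * (4 * (n div 2))) y" for y
    proof -
      have "n + 2 * (4 * (n div 2)) = n mod 2 + 10 * (n div 2)" using e1 by linarith
      then have "(n + 2 * (4 * (n div 2))) mod 10 = n mod 2 mod 10" by (simp only: mod_mult_self2)
      from arg_cong[OF this, of "\<lambda>n. place ?z n y"] show ?thesis by (simp only: place_mod10)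
    qed
    have "place ?z n ` set (kids0 K) \<subseteq> place ?z (n mod 2) ` set (kids0 K)"
      using turn_kids0[OF True, of ?z "n mod 2" "n div 2"] unfolding e1[symmetric] .
    moreover have "place ?z (n mod 2) ` set (kids0 K) \<subseteq> place ?z n ` set (kids0 K)"
      using turn_kids0[OF True, of ?z n "4 * (n div 2)"] unfolding e2 .
    ultimately show ?thesis unfolding n_def[symmetric] n by blast
  next
    case False
    then show ?thesis by (simp add: dir_norm_def place_mod10)
  qed
  finally show ?thesis by (simp add: ATile)
qed

section \<open>The supertile hierarchy\<close>

definition kidset :: "atile set \<Rightarrow> atile set" where "kidset X = (\<Union>x\<in>X. set (kids x))"

text \<open>The property that is inherited by all levels of the hierarchy. It describes the relative position
  of any two tiles that are not far from each other.\<close>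
definition coherent :: "atile set \<Rightarrow> bool" where
  "coherent X \<longleftrightarrow> (\<forall>x\<in>X. normal x) \<and> (\<forall>s\<in>X. \<forall>t\<in>X. s \<noteq> t \<longrightarrow> far s t \<or> legal s t)"

lemma normal_kids: "y \<in> set (kids x) \<Longrightarrow> normal y" by (cases x) auto

lemma drop_sq: "real_of_int (dropA K L) + dropB K L * phi = (phi * phi * rad K - rad L)\<^sup>2"
proof -
  have "2 + 3 * phi = (phi * phi * phi - phi)\<^sup>2" "9 + 0 * phi = (phi * phi * phi - (2 * phi - 2))\<^sup>2"
    "1 + 1 * phi = (phi * phi * (2 * phi - 2) - phi)\<^sup>2"
    "4 + 0 * phi = (phi * phi * (2 * phi - 2) - (2 * phi - 2))\<^sup>2"
    using phi_sq by algebra+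
  then show ?thesis
    by (cases "is_large K"; cases "is_large L") (simp_all only: dropA_def dropB_def rad_def if_True if_False
      of_int_numeral of_int_0 of_int_1)
qed

lemma drop_pos: "phi * phi * rad K - rad L \<ge> 0"
proof -
  have "phi * phi * phi = 2 * phi + 1" "phi * phi * (2 * phi - 2) = 2 * phi" using phi_sq by algebra+
  then have "phi * phi * rad K = (if is_large K then 2 * phi + 1 else 2 * phi)" by (cases "is_large K") (simp_all only: rad_def if_True if_False)
  then show ?thesis using phi_bounds by (simp add: rad_def)
qed

lemma kid_displacement:
  assumes "y \<in> set (kids x)"
  shows "norm (ev (apos y) - phi * phi * ev (apos x)) \<le> phi * phi * rad (akind x) - rad (akind y)"
proof (cases x)
  case (ATile K z d)
  then obtain u where u: "u \<in> set (kids0 K)" "y = place (lphi (lphi z)) d u" using assms by auto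
  have "surely_nonneg (dropA K (akind u) - nsqA (apos u)) (dropB K (akind u) - nsqB (apos u))"
    using drop_check all_kinds[of K] u(1) unfolding list_all_iff by blast
  from surely_nonneg[OF this] have "(norm (ev (apos u)))\<^sup>2 \<le> (phi * phi * rad K - rad (akind u))\<^sup>2"
    unfolding norm_ev drop_sq[symmetric] by (simp add: algebra_simps)
  then have "norm (ev (apos u)) \<le> phi * phi * rad K - rad (akind u)"
    using drop_pos by (rule power2_le_imp_le)
  moreover have "ev (apos y) - phi * phi * ev (apos x) = ev (lrot d (apos u))"
    by (simp add: ATile u(2) ev_add ev_phi)
  ultimately show ?thesis by (simp add: ATile u(2))
qed

text \<open>The discs of radius \<open>rad\<close> are disjoint after enlargement, and each contains the discs of the
  children.\<close>
lemma far_kids: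
  assumes "far x y" "s \<in> set (kids x)" "t \<in> set (kids y)"
  shows "far s t"
proof -
  let ?X = "phi * phi * ev (apos x)" and ?Y = "phi * phi * ev (apos y)"
  have "norm (?Y - ?X) = phi * phi * norm (ev (apos y - apos x))"
    using phi_pos by (simp add: ev_diff norm_mult flip: right_diff_distrib)
  moreover have "phi * phi * (rad (akind x) + rad (akind y)) < phi * phi * norm (ev (apos y - apos x))"
    using assms(1) phi_pos by (simp add: far_def)
  ultimately have 1: "phi * phi * rad (akind x) + phi * phi * rad (akind y) < norm (?Y - ?X)"
    by (simp add: algebra_simps)
  have "?Y - ?X = (?Y - ev (apos t)) + (ev (apos t) - ev (apos s)) + (ev (apos s) - ?X)" by simp
  then have "norm (?Y - ?X) \<le> norm (?Y - ev (apos t)) + norm (ev (apos t) - ev (apos s)) + norm (ev (apos s) - ?X)"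
    by (metis norm_triangle_mono norm_triangle_ineq order_refl)
  moreover have "norm (?Y - ev (apos t)) = norm (ev (apos t) - ?Y)" by (rule norm_minus_commute)
  ultimately show ?thesis
    unfolding far_def ev_diff using 1 kid_displacement[OF assms(2)] kid_displacement[OF assms(3)] by linarith
qed

lemma not_far_self: "\<not> far s s" using rad_pos[of "akind s"] by (simp add: far_def ev_0)

lemma kids_ok_imp:
  assumes "kids_ok xs ys" "s \<in> set xs" "t \<in> set ys" "normal s"
  shows "far s t \<or> legal s t" "s \<noteq> t"
proof -
  have "surely_far s t \<or> s \<noteq> t \<and> legal_at s t" using assms unfolding kids_ok_def list_all_iff by blast
  then show "far s t \<or> legal s t" "s \<noteq> t"
    using surely_far_imp legal_at_imp[OF assms(4)] not_far_self by blast+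
qed

lemma legal_kids:
  assumes "legal x y" "s \<in> set (kids x)" "t \<in> set (kids y)"
  shows "far s t \<or> legal s t" "s \<noteq> t"
proof -
  obtain z d K u where u: "u \<in> set (nbrs K)" "x = place z d (base K)" "y = place z d u"
    using assms(1) by (auto simp: legal_def)
  let ?p = "place (lphi (lphi z)) d"
  obtain s' t' where s: "s' \<in> set (kids (base K))" "s = ?p s'" and t: "t' \<in> set (kids u)" "t = ?p t'"
    using assms(2,3) by (auto simp: u kids_place)
  have "kids_ok (kids (base K)) (kids u)"
    using closure_check all_kinds[of K] u(1) unfolding list_all_iff by blast
  note ok = kids_ok_imp[OF this s(1) t(1) normal_kids[OF s(1)]]
  show fl: "far s t \<or> legal s t" using ok(1) legal_place far_place by (auto simp: s t)
  show "s \<noteq> t"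
  proof
    assume "s = t"
    then have "apos s' = apos t'"
      unfolding s t by (metis add_left_cancel place_sel(2) ev_inj ev_rot mult_cancel_left zeta10_nonzero power_not_zero)
    then have "\<not> far s' t'" using rad_pos[of "akind s'"] rad_pos[of "akind t'"] by (simp add: far_def ev_0)
    then have "legal s' t'" using ok(1) by blast
    then obtain z d K x where "x \<in> set (nbrs K)" "s' = place z d (base K)" "t' = place z d x"
      by (auto simp: legal_def)
    moreover from this have "lrot d (apos x) = 0" using \<open>apos s' = apos t'\<close> by (simp add: base_def lrot_0)
    ultimately have "x \<in> set (nbrs K)" "ev (apos x) = 0" using ev_rot[of d "apos x"] by (auto simp: ev_0)
    moreover have "surely_nonneg (nsqA (apos x) - 1) (nsqB (apos x))" if "x \<in> set (nbrs K)" for x K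
      using centre_check all_kinds[of K] that unfolding list_all_iff by blast
    ultimately show False using surely_nonneg[of "nsqA (apos x) - 1" "nsqB (apos x)"] norm_ev[of "apos x"] by force
  qed
qed

lemma sibling_kids:
  assumes "s \<in> set (kids x)" "t \<in> set (kids x)" "normal x"
  shows "s = t \<or> far s t \<or> legal s t"
proof -
  let ?p = "place (lphi (lphi (apos x))) (adir x)"
  have "set (kids x) = ?p ` set (kids (base (akind x)))"
    by (subst place_self[OF assms(3)]) (rule kids_place)
  then obtain s' t' where s: "s' \<in> set (kids (base (akind x)))" "s = ?p s'"
    and t: "t' \<in> set (kids (base (akind x)))" "t = ?p t'"
    using assms by auto
  have "s' = t' \<or> surely_far s' t' \<or> legal_at s' t'"
    using sibling_check all_kinds[of "akind x"] s(1) t(1) unfolding list_all_iff by blast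
  then show ?thesis
    using surely_far_imp legal_at_imp[OF normal_kids[OF s(1)]] legal_place far_place by (auto simp: s t)
qed

text \<open>Children of far tiles are far, children of a near pair and siblings are checked in the list.\<close>
theorem coherent_kidset:
  assumes "coherent X"
  shows "coherent (kidset X)"
  unfolding coherent_def
proof (intro conjI ballI impI)
  fix s assume "s \<in> kidset X" then show "normal s" using normal_kids by (auto simp: kidset_def)
next
  fix s t assume "s \<in> kidset X" "t \<in> kidset X" and st: "s \<noteq> t"
  then obtain x y where x: "x \<in> X" "s \<in> set (kids x)" and y: "y \<in> X" "t \<in> set (kids y)"
    by (auto simp: kidset_def)
  show "far s t \<or> legal s t"
  proof (cases "x = y")
    case True
    then show ?thesis using sibling_kids[of s x t] x y st assms by (auto simp: coherent_def)
  next
    case False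
    then have "far x y \<or> legal x y" using assms x y by (auto simp: coherent_def)
    then show ?thesis using far_kids[OF _ x(2) y(2)] legal_kids(1)[OF _ x(2) y(2)] by blast
  qed
qed

lemma disjoint_kids:
  assumes "coherent X" "x \<in> X" "y \<in> X" "x \<noteq> y"
  shows "set (kids x) \<inter> set (kids y) = {}"
proof -
  have "far x y \<or> legal x y" using assms by (auto simp: coherent_def)
  then show ?thesis using far_kids[of x y] legal_kids(2)[of x y] not_far_self by blast
qed

lemma legal_spaced:
  assumes "legal s t"
  shows "1 \<le> norm (ev (apos t - apos s))"
proof -
  obtain z d K x where x: "x \<in> set (nbrs K)" "s = place z d (base K)" "t = place z d x"
    using assms by (auto simp: legal_def)
  have "surely_nonneg (nsqA (apos x) - 1) (nsqB (apos x))"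
    using centre_check all_kinds[of K] x(1) unfolding list_all_iff by blast
  from surely_nonneg[OF this] have "1\<^sup>2 \<le> (norm (ev (apos x)))\<^sup>2" unfolding norm_ev by simp
  then have "1 \<le> norm (ev (apos x))" by (rule power2_le_imp_le) simp
  then show ?thesis using x by (simp add: base_def lrot_0 ev_rot norm_mult norm_power)
qed

lemma coherent_spaced:
  assumes "coherent X" "s \<in> X" "t \<in> X" "s \<noteq> t"
  shows "1 \<le> norm (ev (apos t - apos s))"
proof -
  have "far s t \<or> legal s t" using assms by (auto simp: coherent_def)
  then show ?thesis
    using legal_spaced rad_pos[of "akind s"] rad_pos[of "akind t"] by (auto simp: far_def)
qed

section \<open>Centres and regions\<close>

lemma separated_imp:
  assumes "separated w vs" "a \<noteq> 0"
  shows "pt a b w \<notin> convex hull (pt a b ` set vs)"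
proof -
  obtain d where d: "\<And>v. v \<in> set vs \<Longrightarrow> surely_pos (htA (lrot d (v - w))) (htB (lrot d (v - w)))"
    using assms(1) unfolding separated_def list_ex_iff list_all_iff Let_def by blast
  define c where "c = zeta10 ^ d / a"
  define H where "H = {x. Re (c * pt a b w) < Re (c * x)}"
  have "H = {x. inner (cnj c) x > Re (c * pt a b w)}" by (simp add: H_def inner_complex_def)
  then have cH: "convex H" by (simp add: convex_halfspace_gt)
  have "pt a b v \<in> H" if "v \<in> set vs" for v
  proof -
    have "0 < 2 * Re (ev (lrot d (v - w)))" unfolding height_ev using surely_pos[OF d[OF that]] .
    also have "ev (lrot d (v - w)) = c * pt a b v - c * pt a b w"
      using assms(2) by (simp add: ev_rot ev_diff c_def pt_def field_simps)
    finally show ?thesis by (simp add: H_def)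
  qed
  then have "convex hull (pt a b ` set vs) \<subseteq> H" by (intro hull_minimal cH) auto
  then show ?thesis by (auto simp: H_def)
qed

lemma outside_imp: "outside t w \<Longrightarrow> a \<noteq> 0 \<Longrightarrow> pt a b w \<notin> region (conc a b t)"
  unfolding region_conc outside_def list_all_iff using separated_imp by blast

lemma legal_centre_outside:
  assumes "legal s t" "a \<noteq> 0"
  shows "pt a b (apos t) \<notin> region (conc a b s)"
proof -
  obtain z d K x where x: "x \<in> set (nbrs K)" "s = place z d (base K)" "t = place z d x"
    using assms by (auto simp: legal_def)
  have "outside (base K) (apos x)"
    using centre_check all_kinds[of K] x(1) unfolding list_all_iff by blast
  then have "pt (a * zeta10 ^ d) (pt a b z) (apos x) \<notin> region (conc (a * zeta10 ^ d) (pt a b z) (base K))"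
    using assms(2) by (intro outside_imp) auto
  moreover have "pt (a * zeta10 ^ d) (pt a b z) (apos x) = pt a b (apos t)"
    by (simp add: x pt_def ev_add ev_rot algebra_simps)
  ultimately show ?thesis by (simp add: x conc_place)
qed

lemma vertex_radius:
  assumes "P \<in> set (parts0 K)" "v \<in> set P"
  shows "norm (ev v) \<le> rad K"
proof -
  have "surely_nonneg ((if is_large K then 1 else 8) - nsqA v) ((if is_large K then 1 else - 4) - nsqB v)"
    by (rule radius_check[unfolded list_all_iff, rule_format, OF all_kinds assms])
  from surely_nonneg[OF this] have "(norm (ev v))\<^sup>2 \<le> (rad K)\<^sup>2"
    unfolding norm_ev rad_sq of_int_diff left_diff_distrib by linarith
  then show ?thesis by (rule power2_le_imp_le) (use rad_pos[of K] in linarith)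
qed

lemma dist_pt: "norm a = rho \<Longrightarrow> dist (pt a b p) (pt a b q) = rho * norm (ev (q - p))"
proof -
  assume a: "norm a = rho"
  have "pt a b p - pt a b q = - (a * ev (q - p))" by (simp add: pt_def ev_diff algebra_simps)
  then show ?thesis by (simp add: dist_norm norm_mult a)
qed

lemma region_subset_cball:
  assumes "norm a = rho"
  shows "region (conc a b t) \<subseteq> cball (pt a b (apos t)) (rho * rad (akind t))"
proof (cases t)
  case (ATile K z d)
  have "pt a b ` set Q \<subseteq> cball (pt a b z) (rho * rad K)" if Q: "Q \<in> set (aparts t)" for Q
  proof
    fix x assume "x \<in> pt a b ` set Q"
    then obtain y where y: "y \<in> set Q" "x = pt a b y" by auto
    obtain P where "P \<in> set (parts0 K)" "Q = map (put t) P" using Q by (auto simp: aparts_def ATile)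
    then obtain v where P: "P \<in> set (parts0 K)" "v \<in> set P" "x = pt a b (z + lrot d v)"
      using y by (auto simp: ATile)
    have "dist (pt a b z) x = rho * norm (ev (lrot d v))"
      unfolding P(3) dist_pt[OF assms] by (simp only: add_diff_cancel_left')
    then show "x \<in> cball (pt a b z) (rho * rad K)" using vertex_radius[OF P(1,2)] rho_pos
      by (simp only: norm_ev_rot mem_cball) (rule mult_left_mono, simp_all)
  qed
  then have "(\<Union>Q\<in>set (aparts t). convex hull (pt a b ` set Q)) \<subseteq> cball (pt a b z) (rho * rad K)"
    by (intro UN_least hull_minimal convex_cball)
  then show ?thesis unfolding region_conc by (simp add: ATile)
qed

lemma far_centre_outside:
  assumes "far s t" "norm a = rho"
  shows "pt a b (apos t) \<notin> region (conc a b s)"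
proof
  assume "pt a b (apos t) \<in> region (conc a b s)"
  then have "dist (pt a b (apos s)) (pt a b (apos t)) \<le> rho * rad (akind s)"
    using subsetD[OF region_subset_cball[OF assms(2)]] by (simp only: mem_cball)
  also have "dist (pt a b (apos s)) (pt a b (apos t)) = rho * norm (ev (apos t - apos s))"
    by (rule dist_pt[OF assms(2)])
  finally have "norm (ev (apos t - apos s)) \<le> rad (akind s)" using rho_pos by simp
  then show False using assms(1) rad_pos[of "akind t"] by (simp add: far_def)
qed

text \<open>For far tiles by the radii, for near pairs by the inspection of the list.\<close>
lemma centre_outside:
  assumes "coherent X" "s \<in> X" "t \<in> X" "s \<noteq> t" "norm a = rho"
  shows "pt a b (apos t) \<notin> region (conc a b s)"
proof -
  have "a \<noteq> 0" using assms(5) rho_pos by auto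
  moreover have "far s t \<or> legal s t" using assms by (auto simp: coherent_def)
  ultimately show ?thesis using far_centre_outside legal_centre_outside assms(5) by blast
qed

lemma conc_pos_eq: "conc a b s = conc a b t \<Longrightarrow> a \<noteq> 0 \<Longrightarrow> apos s = apos t"
proof (cases s; cases t)
  fix K z d L w e
  assume *: "conc a b s = conc a b t" "a \<noteq> 0" "s = ATile K z d" "t = ATile L w e"
  have "conc (a * zeta10 ^ d) (pt a b z) (base K) = conc (a * zeta10 ^ e) (pt a b w) (base L)"
    using *(1) unfolding *(3,4) conc_base[of a b K z d] conc_base[of a b L w e] .
  from conc_frame(2)[OF this] have "pt a b w = pt a b z" using *(2) by simp
  then show ?thesis using *(2-4) by (simp add: pt_def ev_inj)
qed

lemma inj_conc:
  assumes "coherent X" "a \<noteq> 0"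
  shows "inj_on (conc a b) X"
proof (rule inj_onI, rule ccontr)
  fix s t assume *: "s \<in> X" "t \<in> X" "conc a b s = conc a b t" "s \<noteq> t"
  then show False
    using coherent_spaced[OF assms(1) *(1,2,4)] conc_pos_eq[OF *(3) assms(2)] by (simp add: ev_0)
qed

lemma edge_radius_check:
  "list_all (\<lambda>K. list_all (\<lambda>e. surely_nonneg ((if is_large K then 1 else 8) - nsqA (fst e))
     ((if is_large K then 1 else - 4) - nsqB (fst e)) \<and> surely_nonneg ((if is_large K then 1 else 8) - nsqA (snd e))
     ((if is_large K then 1 else - 4) - nsqB (snd e))) (edges0 K)) all_kinds"
  by code_simp

lemma edge_radius:
  assumes "(p, q) \<in> set (edges0 K)"
  shows "norm (ev p) \<le> rad K" "norm (ev q) \<le> rad K"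
proof -
  have *: "norm (ev v) \<le> rad K" if "surely_nonneg ((if is_large K then 1 else 8) - nsqA v) ((if is_large K then 1 else - 4) - nsqB v)" for v
  proof -
    from surely_nonneg[OF that] have "(norm (ev v))\<^sup>2 \<le> (rad K)\<^sup>2"
      unfolding norm_ev rad_sq of_int_diff left_diff_distrib by linarith
    then show ?thesis by (rule power2_le_imp_le) (use rad_pos[of K] in linarith)
  qed
  have "surely_nonneg ((if is_large K then 1 else 8) - nsqA p) ((if is_large K then 1 else - 4) - nsqB p) \<and>
    surely_nonneg ((if is_large K then 1 else 8) - nsqA q) ((if is_large K then 1 else - 4) - nsqB q)"
    using edge_radius_check all_kinds[of K] assms unfolding list_all_iff by force
  then show "norm (ev p) \<le> rad K" "norm (ev q) \<le> rad K" using * by blast+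
qed

lemma aedge_radius:
  assumes "(p, q) \<in> set (aedges t)"
  shows "norm (ev p - ev (apos t)) \<le> rad (akind t)" "norm (ev q - ev (apos t)) \<le> rad (akind t)"
proof -
  obtain K z d where t: "t = ATile K z d" by (cases t)
  obtain p' q' where "(p', q') \<in> set (edges0 K)" "p = z + lrot d p'" "q = z + lrot d q'"
    using assms by (auto simp: aedges_def t)
  then show "norm (ev p - ev (apos t)) \<le> rad (akind t)" "norm (ev q - ev (apos t)) \<le> rad (akind t)"
    using edge_radius[of p' q' K] by (simp_all add: t ev_add)
qed

lemma shares_not_far: "shares s t \<Longrightarrow> \<not> far s t"
proof -
  assume "shares s t"
  then obtain e f where ef: "e \<in> set (aedges s)" "f \<in> set (aedges t)" "e = f \<or> e = prod.swap f"
    unfolding shares_def list_ex_iff by blast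
  obtain p q where e: "e = (p, q)" by (cases e)
  have 1: "norm (ev p - ev (apos s)) \<le> rad (akind s)" using aedge_radius(1)[of p q s] ef(1) e by simp
  have 2: "norm (ev p - ev (apos t)) \<le> rad (akind t)"
    using aedge_radius[of "fst f" "snd f" t] ef(2,3) e by (cases f) auto
  have "norm (ev (apos t - apos s)) \<le> norm (ev p - ev (apos s)) + norm (ev p - ev (apos t))"
    using norm_triangle_ineq4[of "ev p - ev (apos s)" "ev p - ev (apos t)"] by (simp add: ev_diff)
  with 1 2 show ?thesis by (simp add: far_def)
qed

text \<open>Edges are segments, and a segment determines its pair of endpoints, so common edges can be found
  by comparing lattice points.\<close>
lemma adj_conc:
  assumes "a \<noteq> 0"
  shows "edges (conc a b s) \<inter> edges (conc a b t) \<noteq> {} \<longleftrightarrow> shares s t"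
proof -
  have inj: "pt a b p = pt a b q \<longleftrightarrow> p = q" for p q using inj_pt[OF assms] by (auto dest: injD)
  let ?seg = "\<lambda>(p, q). closed_segment (pt a b p) (pt a b q)"
  have seg: "?seg e = ?seg f \<longleftrightarrow> e = f \<or> e = prod.swap f" for e f
    by (cases e; cases f) (simp add: inj doubleton_eq_iff)
  have meet: "h ` A \<inter> h ` B \<noteq> {} \<longleftrightarrow> (\<exists>e\<in>A. \<exists>f\<in>B. h e = h f)"
    for h :: "lat \<times> lat \<Rightarrow> complex set" and A B by blast
  show ?thesis unfolding edges_conc shares_def list_ex_iff meet seg ..
qed

section \<open>Rings in a tiling\<close>

lemma place_00: "normal x \<Longrightarrow> place 0 0 x = x"
  by (cases x) (simp add: normal_def)

lemma place_inverse:
  assumes "normal x"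
  shows "place (lrot (9 * d) (- z)) (9 * d) (place z d x) = x"
proof -
  have "lrot (9 * d) (- z) + lrot (9 * d) z = 0" by (simp add: lrot_0 flip: lrot_add)
  then have "place (lrot (9 * d) (- z)) (9 * d) (place z d x) = place 0 (10 * d) x"
    by (simp add: place_place del: place.simps)
  also have "\<dots> = place 0 ((10 * d) mod 10) x" by (simp only: place_mod10)
  also have "\<dots> = x" using place_00[OF assms] by simp
  finally show ?thesis .
qed

lemma place_inj: "normal x \<Longrightarrow> normal y \<Longrightarrow> place z d x = place z d y \<longleftrightarrow> x = y"
  by (metis place_inverse)

text \<open>Whether two tiles share an edge can be read off any realization, so it is invariant under
  motions of the lattice.\<close>
lemma shares_place: "shares (place z d s) (place z d t) \<longleftrightarrow> shares s t"
proof -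
  have "shares (place z d s) (place z d t) \<longleftrightarrow>
      edges (conc 1 0 (place z d s)) \<inter> edges (conc 1 0 (place z d t)) \<noteq> {}"
    by (rule adj_conc[symmetric]) simp
  also have "\<dots> \<longleftrightarrow> shares s t"
    unfolding conc_place by (rule adj_conc) simp
  finally show ?thesis .
qed

lemma shares_sym: "shares s t \<longleftrightarrow> shares t s"
  using adj_conc[of 1 0 s t] adj_conc[of 1 0 t s] by (simp add: Int_commute)

definition ring :: "atile list" where "ring = ring_pos @ ring_neg"

lemma turns_normal: "u \<in> set (turns t) \<Longrightarrow> normal u" "u \<in> set (turns t) \<Longrightarrow> akind u = akind t"
  by (auto simp: turns_def simp del: place.simps)

lemma ring_members:
  assumes "R \<in> set ring"
  shows "normal R" "akind R = PAlpha"
  using assms turns_normal by (auto simp: ring_def ring_pos_def ring_neg_def)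

lemma surround_normal: "u \<in> set (ring_inner @ ring_outer) \<Longrightarrow> normal u"
  using turns_normal by (auto simp: ring_inner_def ring_outer_def ring_boats_def ring_stars_def)

lemma ring_disjoint:
  shows "set ring \<inter> set (ring_inner @ ring_outer) = {}" "set ring_pos \<inter> set ring_neg = {}"
    "set ring_inner \<inter> set ring_outer = {}" "distinct ring_pos" "distinct ring_neg" "distinct ring_inner"
proof -
  have d: "distinct ring_pos" "distinct ring_neg" "distinct ring_inner"
    "set ring_pos \<inter> (set ring_neg \<union> (set ring_inner \<union> set ring_outer)) = {}"
    "set ring_neg \<inter> (set ring_inner \<union> set ring_outer) = {}" "set ring_inner \<inter> set ring_outer = {}"
    using ring_distinct_check unfolding distinct_append set_append by blast+
  show "set ring \<inter> set (ring_inner @ ring_outer) = {}" unfolding ring_def set_append using d(4,5) by blast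
  show "set ring_pos \<inter> set ring_neg = {}" using d(4) by blast
qed (use ring_distinct_check in \<open>simp_all only: distinct_append set_append\<close>)

lemma ring_reach_check:
  "list_all (\<lambda>u. surely_nonneg (36 - nsqA (apos u)) (- nsqB (apos u))) (ring @ ring_inner @ ring_outer)"
  by code_simp

lemma rho_less_1: "rho < 1"
proof -
  have "(1 / 2)\<^sup>2 < (sin (pi / 5))\<^sup>2" using sin36_sq phi_bounds by (simp add: power2_eq_square)
  then have "1 / 2 < sin (pi / 5)" by (rule power2_less_imp_less) (use sin36_pos in simp)
  then show ?thesis by (simp add: rho_def divide_simps)
qed

text \<open>The window: the part of a tiling that meets a ball is realized inside a coherent set.\<close>
locale window =
  fixes T :: "tile set" and n :: nat and a b :: complex and X :: "atile set"
  assumes cover: "(\<Union>t\<in>T. region t) = UNIV"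
    and norm_a: "norm a = rho"
    and coh: "coherent X"
    and realized: "tiles_upto T n \<subseteq> conc a b ` X"
begin

abbreviation V where "V \<equiv> tiles_upto T n"
abbreviation q where "q \<equiv> conc a b"

lemma a_nonzero: "a \<noteq> 0" using norm_a rho_pos by auto

lemma inj_q: "inj_on q X" by (rule inj_conc[OF coh a_nonzero])

lemma point_covered:
  assumes "norm x \<le> n"
  obtains s where "s \<in> X" "x \<in> region (q s)" "q s \<in> V"
proof -
  obtain t where t: "t \<in> T" "x \<in> region t" using cover by blast
  then have "t \<in> V" using assms by (auto simp: tiles_upto_def)
  then show thesis using realized t(2) that by blast
qed

text \<open>A centre lies in no other tile of the coherent set, so the tile of the tiling that covers it
  is the one it belongs to.\<close>
lemma present:
  assumes "y \<in> X" "norm (pt a b (apos y)) \<le> n"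
  shows "q y \<in> V"
proof -
  obtain s where s: "s \<in> X" "pt a b (apos y) \<in> region (q s)" "q s \<in> V"
    by (rule point_covered[OF assms(2)])
  then have "s = y" using centre_outside[OF coh s(1) assms(1) _ norm_a] by blast
  with s show ?thesis by simp
qed

lemma adj_q:
  assumes "s \<in> X" "t \<in> X"
  shows "adj (q s) (q t) \<longleftrightarrow> s \<noteq> t \<and> shares s t"
  using inj_on_eq_iff[OF inj_q assms] adj_conc[OF a_nonzero] by (simp add: adj_def)

end

text \<open>A window that contains the ring of one pentagon. Everything next to the ring is at distance less
  than 7 from its centre, so that it belongs to the tiling once it belongs to the coherent set.\<close>
locale ring_window = window +
  fixes z :: lat and d :: nat
  assumes ring_in: "\<And>u. u \<in> set (ring @ ring_inner) \<Longrightarrow> place z d u \<in> X"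
    and inside: "norm (pt a b z) + 7 \<le> n"
begin

abbreviation P where "P \<equiv> place z d"

text \<open>In a coherent set two tiles are far from each other or in a listed position.\<close>
lemma no_clash:
  assumes "normal Y" "normal u" "P Y \<in> X" "P u \<in> X"
  shows "\<not> clash Y u"
proof
  assume c: "clash Y u"
  have "P Y \<noteq> P u" using c place_inj[OF assms(1,2)] by (auto simp: clash_def)
  moreover have "\<not> far (P Y) (P u)"
    unfolding far_place using c surely_near_imp by (auto simp: clash_def)
  ultimately have "legal (P Y) (P u)" using coh assms(3,4) by (auto simp: coherent_def)
  from legal_place[OF this, of "lrot (9 * d) (- z)" "9 * d"]
  have "legal Y u" unfolding place_inverse[OF assms(1)] place_inverse[OF assms(2)] .
  then have "legal_at Y u" using c by (intro legal_at_of_legal) (auto simp: clash_def)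
  then show False using c by (simp add: clash_def)
qed

lemma no_clashing:
  assumes "normal u" "P u \<in> X"
  shows "\<not> clashing u"
proof
  assume "clashing u"
  then obtain Y where Y: "Y \<in> set (ring @ ring_inner)" "clash Y u"
    unfolding clashing_def list_ex_iff ring_def by auto
  then have "normal Y" using ring_members(1) surround_normal by auto
  then show False using no_clash[OF _ assms(1) ring_in[OF Y(1)] assms(2)] Y(2) by blast
qed

lemma near_ring_tile:
  assumes R: "R \<in> set ring" and s: "s \<in> X" "s \<noteq> P R" "\<not> far (P R) s"
  obtains x where "x \<in> set (nbrs PAlpha)" "s = P (place (apos R) (adir R) x)"
proof -
  have PR: "P R \<in> X" using ring_in R by simp
  have "legal (P R) s" using coh PR s by (auto simp: coherent_def)
  moreover have k: "akind (P R) = PAlpha" using ring_members(2)[OF R] by simp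
  ultimately have "legal_at (P R) s" by (intro legal_at_of_legal) simp_all
  then obtain x where x: "x \<in> set (nbrs PAlpha)" "place (apos (P R)) (adir (P R)) x = s"
    unfolding legal_at_def list_ex_iff k by blast
  have "s = place (z + lrot d (apos R)) ((adir R + d) mod 10) x"
    using x(2) ring_members(2)[OF R] by (simp add: dir_norm_def del: place.simps)
  also have "\<dots> = P (place (apos R) (adir R) x)" by (simp only: place_mod10 place_place)
  finally show thesis using x(1) that by blast
qed

lemma ring_neighbour:
  assumes R: "R \<in> set ring" and s: "s \<in> X" "s \<noteq> P R" "shares (P R) s"
  obtains u where "u \<in> set (ring_inner @ ring_outer)" "s = P u" "shares R u"
proof -
  obtain x where x: "x \<in> set (nbrs PAlpha)" "s = P (place (apos R) (adir R) x)"
    by (rule near_ring_tile[OF R s(1,2) shares_not_far[OF s(3)]])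
  let ?u = "place (apos R) (adir R) x"
  have sh: "shares R ?u" using s(3) unfolding x(2) shares_place .
  have "\<not> clashing ?u" by (rule no_clashing) (use s(1) x(2) in \<open>simp_all del: place.simps\<close>)
  moreover have "shares R ?u \<longrightarrow> ?u \<in> set (ring_inner @ ring_outer) \<or> clashing ?u"
    using ring_check R x(1) unfolding ring_def list_all_iff Let_def by blast
  ultimately show thesis using that[of ?u] sh x(2) by blast
qed

lemma reach:
  assumes "u \<in> set (ring @ ring_inner @ ring_outer)"
  shows "norm (pt a b (apos (P u))) \<le> norm (pt a b z) + 6"
proof -
  have "surely_nonneg (36 - nsqA (apos u)) (- nsqB (apos u))"
    using ring_reach_check assms unfolding list_all_iff by blast
  from surely_nonneg[OF this] have "(norm (ev (apos u)))\<^sup>2 \<le> 6\<^sup>2" unfolding norm_ev by simp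
  then have "norm (ev (apos u)) \<le> 6" by (rule power2_le_imp_le) simp
  then have "rho * norm (ev (apos u)) \<le> 1 * 6" using rho_less_1 rho_pos by (intro mult_mono) auto
  moreover have "dist (pt a b z) (pt a b (apos (P u))) = rho * norm (ev (apos u))"
    unfolding dist_pt[OF norm_a] by (simp only: place_sel add_diff_cancel_left' norm_ev_rot)
  ultimately show ?thesis using norm_triangle_ineq4[of "pt a b z" "pt a b z - pt a b (apos (P u))"]
    by (simp add: dist_norm)
qed

lemma present_P: "u \<in> set (ring @ ring_inner @ ring_outer) \<Longrightarrow> P u \<in> X \<Longrightarrow> q (P u) \<in> V"
  using reach inside by (intro present) fastforce+

text \<open>The notch beside a tile of the ring is filled: the point just beyond one of its sides is
  covered, and only the two tiles of the outer list can do so.\<close>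
lemma notch_filled:
  assumes R: "R \<in> set ring"
  obtains u where "u \<in> set ring_outer" "shares R u" "P u \<in> X"
proof -
  let ?w = "z + lrot d (beyond R)"
  have k: "akind R = PAlpha" by (rule ring_members(2)[OF R])
  have bw: "beyond R - apos R = - lrot (adir R) lone" by (cases R) (simp add: beyond_def lrot_diff[of _ 0, simplified lrot_0, simplified])
  have "dist (pt a b (apos (P R))) (pt a b ?w) = rho * norm (ev (lrot d (beyond R - apos R)))"
    unfolding dist_pt[OF norm_a] by (simp add: lrot_diff del: norm_ev_rot)
  also have "\<dots> = rho" by (simp only: norm_ev_rot bw ev_minus norm_minus_cancel ev_one) simp
  finally have d: "dist (pt a b (apos (P R))) (pt a b ?w) = rho" .
  have "norm (pt a b ?w) \<le> norm (pt a b (apos (P R))) + dist (pt a b (apos (P R))) (pt a b ?w)"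
    using norm_triangle_ineq4[of "pt a b (apos (P R))" "pt a b (apos (P R)) - pt a b ?w"] by (simp add: dist_norm)
  then have "norm (pt a b ?w) \<le> n" using reach[of R] R inside d rho_less_1 by simp
  then obtain s where s: "s \<in> X" "pt a b ?w \<in> region (q s)" by (rule point_covered)
  have w: "pt a b ?w = pt (a * zeta10 ^ d) (pt a b z) (beyond R)" by (simp add: pt_def ev_add ev_rot algebra_simps)
  have a': "a * zeta10 ^ d \<noteq> 0" using a_nonzero by simp
  have out: "pt a b ?w \<notin> region (q (P u))" if "outside u (beyond R)" for u
    unfolding conc_place w by (rule outside_imp[OF that a'])
  have chk: "outside R (beyond R)" and chk': "\<And>x. x \<in> set (nbrs PAlpha) \<Longrightarrow>
      place (apos R) (adir R) x \<in> set ring_outer \<and> shares R (place (apos R) (adir R) x) \<or>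
      outside (place (apos R) (adir R) x) (beyond R) \<or> clashing (place (apos R) (adir R) x)"
    using ring_check R unfolding ring_def list_all_iff Let_def by blast+
  have sR: "s \<noteq> P R" using s(2) out[OF chk] by auto
  \<comment> \<open>The point is at distance \<open>rho\<close> from the centre of \<open>R\<close>, so the tile that covers it is near \<open>R\<close>.\<close>
  have "dist (pt a b (apos s)) (pt a b ?w) \<le> rho * rad (akind s)"
    using subsetD[OF region_subset_cball[OF norm_a] s(2)] by (simp only: mem_cball)
  then have "dist (pt a b (apos (P R))) (pt a b (apos s)) \<le> rho + rho * rad (akind s)"
    using d dist_triangle2[of "pt a b (apos (P R))" "pt a b (apos s)" "pt a b ?w"] by simp
  then have "rho * norm (ev (apos s - apos (P R))) \<le> rho * (1 + rad (akind s))"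
    unfolding dist_pt[OF norm_a] by (simp add: algebra_simps)
  then have "norm (ev (apos s - apos (P R))) \<le> 1 + rad (akind s)" using rho_pos by simp
  moreover have "rad (akind (P R)) \<ge> 1" using phi_bounds k by (simp add: rad_def)
  ultimately have "\<not> far (P R) s" by (simp add: far_def del: place_sel)
  then obtain x where x: "x \<in> set (nbrs PAlpha)" "s = P (place (apos R) (adir R) x)"
    by (rule near_ring_tile[OF R s(1) sR])
  let ?u = "place (apos R) (adir R) x"
  have "\<not> clashing ?u" by (rule no_clashing) (use s(1) x(2) in \<open>simp_all del: place.simps\<close>)
  moreover have "\<not> outside ?u (beyond R)" using s(2) x(2) out by blast
  ultimately show thesis using chk'[OF x(1)] that[of ?u] s(1) x(2) by blast
qed

definition nb :: "atile \<Rightarrow> atile set" where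
  "nb R = {u \<in> set (ring_inner @ ring_outer). shares R u \<and> P u \<in> X}"

text \<open>Three inner neighbours and exactly one tile in the notch.\<close>
lemma card_nb:
  assumes R: "R \<in> set ring"
  shows "card (nb R) = 4"
proof -
  obtain u where u: "u \<in> set ring_outer" "shares R u" "P u \<in> X" by (rule notch_filled[OF R])
  have deg: "length (filter (shares R) ring_inner) = 3"
    and uniq: "\<And>x y. x \<in> set (filter (shares R) ring_outer) \<Longrightarrow> y \<in> set (filter (shares R) ring_outer) \<Longrightarrow>
       x = y \<or> clash x y \<or> clash y x"
    using ring_degree_check R unfolding ring_def list_all_iff by blast+
  have only: "v = u" if "v \<in> set ring_outer" "shares R v" "P v \<in> X" for v
  proof -
    have "normal u" "normal v" using surround_normal u(1) that(1) by auto
    then show ?thesis using uniq[of u v] no_clash[of u v] no_clash[of v u] u that by auto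
  qed
  have inner: "P v \<in> X" if "v \<in> set ring_inner" for v using ring_in that by simp
  have "nb R = insert u (set (filter (shares R) ring_inner))" (is "?l = ?r")
  proof
    show "?l \<subseteq> ?r"
    proof
      fix v assume "v \<in> ?l"
      then have v: "v \<in> set ring_inner \<or> v \<in> set ring_outer" "shares R v" "P v \<in> X" by (simp_all add: nb_def)
      then show "v \<in> ?r" using only[of v] by (cases "v \<in> set ring_inner") simp_all
    qed
    show "?r \<subseteq> ?l"
    proof
      fix v assume "v \<in> ?r"
      then have "v = u \<or> v \<in> set ring_inner \<and> shares R v" by simp
      then show "v \<in> ?l" using u inner[of v] by (elim disjE) (simp_all add: nb_def)
    qed
  qed
  moreover have "u \<notin> set (filter (shares R) ring_inner)" using ring_disjoint(3) u(1) by (simp only: set_filter) blast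
  moreover have "card (set (filter (shares R) ring_inner)) = 3"
    using deg ring_disjoint(6) by (simp only: distinct_card distinct_filter)
  ultimately show ?thesis by simp
qed

definition A where "A = (\<lambda>R. q (P R)) ` set ring_pos"
definition B where "B = (\<lambda>R. q (P R)) ` set ring_neg"
definition f :: "tile \<Rightarrow> real" where "f t = indicator A t - indicator B t"

lemma inj_qP: "inj_on (\<lambda>u. q (P u)) {u. normal u \<and> P u \<in> X}"
proof (rule inj_onI)
  fix u v assume u: "u \<in> {u. normal u \<and> P u \<in> X}" and v: "v \<in> {u. normal u \<and> P u \<in> X}" and eq: "q (P u) = q (P v)"
  have "P u = P v" using inj_onD[OF inj_q eq] u v by blast
  then show "u = v" using place_inj[of u v z d] u v by blast
qed

lemma ring_X: "R \<in> set ring \<Longrightarrow> P R \<in> X"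
  using ring_in by simp

lemma ring_sub: "set ring \<subseteq> {u. normal u \<and> P u \<in> X}"
  using ring_members(1) ring_X by blast

lemma ring_V: "R \<in> set ring \<Longrightarrow> q (P R) \<in> V"
  by (rule present_P) (simp_all only: ring_X set_append, blast)

lemma mem_ring_image:
  assumes R: "R \<in> set ring" and "S \<subseteq> set ring"
  shows "q (P R) \<in> (\<lambda>R. q (P R)) ` S \<longleftrightarrow> R \<in> S"
  by (rule inj_on_image_mem_iff[OF inj_qP]) (use R assms(2) ring_sub in blast)+

lemma f_ring:
  assumes R: "R \<in> set ring"
  shows "f (q (P R)) = (if R \<in> set ring_pos then 1 else - 1)"
proof -
  have "q (P R) \<in> A \<longleftrightarrow> R \<in> set ring_pos" "q (P R) \<in> B \<longleftrightarrow> R \<in> set ring_neg"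
    unfolding A_def B_def by (rule mem_ring_image[OF R]; simp only: ring_def set_append; blast)+
  moreover have "R \<in> set ring_pos \<and> R \<notin> set ring_neg \<or> R \<notin> set ring_pos \<and> R \<in> set ring_neg"
    using R ring_disjoint(2) unfolding ring_def set_append by blast
  ultimately show ?thesis unfolding f_def indicator_def by (elim disjE) simp_all
qed

lemma f_support: "f t \<noteq> 0 \<Longrightarrow> \<exists>R\<in>set ring. t = q (P R)"
proof -
  assume "f t \<noteq> 0"
  then have "t \<in> A \<or> t \<in> B" by (cases "t \<in> A"; cases "t \<in> B") (simp_all add: f_def)
  then show ?thesis unfolding A_def B_def ring_def set_append by blast
qed

lemma sum_f:
  assumes "finite N"
  shows "(\<Sum>u\<in>N. f u) = real (card (N \<inter> A)) - real (card (N \<inter> B))"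
proof -
  have "(\<Sum>u\<in>N. indicat_real S u) = (\<Sum>u\<in>N. if u \<in> S then 1 else 0)" for S
    by (intro sum.cong) (simp_all add: indicator_def)
  then have "(\<Sum>u\<in>N. indicat_real S u) = real (card (N \<inter> S))" for S
    using assms by (simp add: sum.inter_restrict[symmetric])
  then show ?thesis unfolding f_def sum_subtractf by simp
qed

lemma card_A_B:
  assumes u: "\<And>R. R \<in> set ring \<Longrightarrow> q (P R) \<in> N \<longleftrightarrow> shares R u"
  shows "card (N \<inter> A) = length (filter (\<lambda>R. shares R u) ring_pos)"
    "card (N \<inter> B) = length (filter (\<lambda>R. shares R u) ring_neg)"
proof -
  have *: "card (N \<inter> (\<lambda>R. q (P R)) ` set xs) = length (filter (\<lambda>R. shares R u) xs)"
    if xs: "set xs \<subseteq> set ring" "distinct xs" for xs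
  proof -
    have "N \<inter> (\<lambda>R. q (P R)) ` set xs = (\<lambda>R. q (P R)) ` set (filter (\<lambda>R. shares R u) xs)"
      using u xs(1) unfolding set_filter by blast
    moreover have "inj_on (\<lambda>R. q (P R)) (set (filter (\<lambda>R. shares R u) xs))"
      by (rule inj_on_subset[OF inj_qP]) (use xs(1) ring_sub in \<open>unfold set_filter, blast\<close>)
    moreover have "card (set (filter (\<lambda>R. shares R u) xs)) = length (filter (\<lambda>R. shares R u) xs)"
      by (rule distinct_card) (simp add: xs(2))
    ultimately show ?thesis by (simp only: card_image)
  qed
  show "card (N \<inter> A) = length (filter (\<lambda>R. shares R u) ring_pos)"
    "card (N \<inter> B) = length (filter (\<lambda>R. shares R u) ring_neg)"
    unfolding A_def B_def by (rule *; use ring_disjoint in \<open>simp add: ring_def\<close>)+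
qed

text \<open>On the ring the sum over the neighbours vanishes, since no two tiles of the ring are adjacent, and
  the degree is four. Off the ring a tile that touches the ring is one of the listed ones and sees as
  many positive as negative pentagons.\<close>
theorem ring_eigenfunction:
  assumes finV: "finite V"
  shows "f \<in> eigenspace V (laplacian V adj) 4"
  unfolding eigenspace_def functions_on_def mem_Collect_eq
proof (intro conjI allI impI ballI)
  fix t assume "t \<notin> V"
  then show "f t = 0" using f_support ring_V by blast
next
  fix t assume t: "t \<in> V"
  let ?N = "{u \<in> V. adj u t}"
  have finN: "finite ?N" using finV by simp
  have lap: "laplacian V adj f t = real (card ?N) * f t - (\<Sum>u\<in>?N. f u)"
    using t by (simp add: laplacian_def sum_subtractf)
  have "t \<in> q ` X" using realized t by (rule subsetD)
  then obtain s where s: "s \<in> X" "t = q s" by (elim imageE) (rule that)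
  show "laplacian V adj f t = 4 * f t"
  proof (cases "\<exists>R\<in>set ring. s = P R")
    case True
    then obtain R where R: "R \<in> set ring" "s = P R" by blast
    have PR: "P R \<in> X" using ring_in R(1) by simp
    have N: "?N = (\<lambda>u. q (P u)) ` nb R"
    proof (intro set_eqI iffI)
      fix x assume "x \<in> ?N"
      then have x: "x \<in> V" "adj x (q (P R))" unfolding s(2) R(2) by simp_all
      have "x \<in> q ` X" using realized x(1) by (rule subsetD)
      then obtain y where y: "y \<in> X" "x = q y" by (elim imageE) (rule that)
      have "adj (q y) (q (P R))" using x(2) unfolding y(2) .
      then have "y \<noteq> P R" "shares y (P R)" using adj_q[OF y(1) PR] by blast+
      moreover from this have "shares (P R) y" using shares_sym by blast
      ultimately obtain u where u: "u \<in> set (ring_inner @ ring_outer)" "y = P u" "shares R u"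
        by (rule_tac ring_neighbour[OF R(1) y(1)])
      then have "u \<in> nb R" using y(1) by (simp add: nb_def)
      then show "x \<in> (\<lambda>u. q (P u)) ` nb R" unfolding y(2) u(2) by (rule imageI)
    next
      fix x assume "x \<in> (\<lambda>u. q (P u)) ` nb R"
      then obtain u where u: "u \<in> set (ring_inner @ ring_outer)" "shares R u" "P u \<in> X" "x = q (P u)"
        by (auto simp: nb_def)
      have "u \<noteq> R" using u(1) R(1) ring_disjoint(1) by blast
      then have "P R \<noteq> P u" using place_inj[OF ring_members(1)[OF R(1)] surround_normal[OF u(1)]] by blast
      moreover have "shares (P R) (P u)" using u(2) by (simp only: shares_place)
      then have "shares (P u) (P R)" using shares_sym by blast
      ultimately have "adj (q (P u)) (q (P R))" using adj_q[OF u(3) PR] by simp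
      moreover have "q (P u) \<in> V" using u by (intro present_P) auto
      ultimately show "x \<in> ?N" using u(4) R(2) s(2) by simp
    qed
    have sub: "nb R \<subseteq> {u. normal u \<and> P u \<in> X}" using surround_normal unfolding nb_def by blast
    have "card ?N = 4" unfolding N using card_image[OF inj_on_subset[OF inj_qP sub]] card_nb[OF R(1)] by simp
    moreover have "(\<Sum>u\<in>?N. f u) = 0"
    proof (rule sum.neutral, rule ballI, rule ccontr)
      fix x assume x: "x \<in> ?N" "f x \<noteq> 0"
      from x(1) obtain u where u: "u \<in> nb R" "x = q (P u)" unfolding N by (elim imageE) (rule that)
      obtain R' where R': "R' \<in> set ring" "x = q (P R')" using f_support[OF x(2)] by (elim bexE) (rule that)
      have "q (P u) = q (P R')" using u(2) R'(2) by simp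
      then have "u = R'" by (rule inj_onD[OF inj_qP]) (use sub ring_sub u(1) R'(1) in blast)+
      then show False using u(1) R'(1) ring_disjoint(1) unfolding nb_def by blast
    qed
    ultimately show ?thesis unfolding lap by simp
  next
    case False
    have "f t = 0"
    proof (rule ccontr)
      assume nz: "f t \<noteq> 0"
      obtain R where R: "R \<in> set ring" "q s = q (P R)"
        using f_support[OF nz] unfolding s(2) by (elim bexE) (rule that)
      have "s = P R" by (rule inj_onD[OF inj_q R(2) s(1) ring_X[OF R(1)]])
      with False R show False by blast
    qed
    moreover have "(\<Sum>u\<in>?N. f u) = 0"
    proof (cases "\<exists>R\<in>set ring. shares (P R) s")
      case True
      then obtain R where R: "R \<in> set ring" "shares (P R) s" by blast
      have "s \<noteq> P R" using False R(1) by blast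
      then obtain u where u: "u \<in> set (ring_inner @ ring_outer)" "s = P u"
        by (rule ring_neighbour[OF R(1) s(1) _ R(2)])
      have mem: "q (P R) \<in> ?N \<longleftrightarrow> shares R u" if R: "R \<in> set ring" for R
      proof -
        have "P R \<noteq> s" using False R by blast
        then have "adj (q (P R)) (q s) \<longleftrightarrow> shares (P R) s" using adj_q[OF ring_X[OF R] s(1)] by blast
        then show ?thesis using ring_V[OF R] unfolding s(2) u(2) shares_place by simp
      qed
      have "card (?N \<inter> A) = length (filter (\<lambda>R. shares R u) ring_pos)"
        "card (?N \<inter> B) = length (filter (\<lambda>R. shares R u) ring_neg)"
        by (rule card_A_B, rule mem, assumption)+
      moreover have "length (filter (\<lambda>R. shares R u) ring_pos) = length (filter (\<lambda>R. shares R u) ring_neg)"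
        using ring_balance_check u(1) unfolding list_all_iff by blast
      ultimately have "card (?N \<inter> A) = card (?N \<inter> B)" by (simp only:)
      then show ?thesis unfolding sum_f[OF finN] by (simp only: diff_self)
    next
      case no: False
      show ?thesis
      proof (rule sum.neutral, rule ballI, rule ccontr)
        fix x assume x: "x \<in> ?N" "f x \<noteq> 0"
        obtain R where R: "R \<in> set ring" "x = q (P R)" using f_support[OF x(2)] by (elim bexE) (rule that)
        then have "adj (q (P R)) (q s)" using x(1) s(2) by simp
        then have "shares (P R) s" using adj_q[OF ring_X[OF R(1)] s(1)] by blast
        with no R show False by blast
      qed
    qed
    ultimately show ?thesis unfolding lap by simp
  qed
qed

lemma f_nonzero: "\<exists>t\<in>V. f t \<noteq> 0"
proof -
  have "hd ring \<in> set ring" by (rule hd_in_set) (simp add: ring_def ring_pos_def turns_def)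
  then show ?thesis using f_ring[of "hd ring"] ring_V by (intro bexI[of _ "q (P (hd ring))"]) auto
qed

end

section \<open>Frequencies\<close>

text \<open>The sum of \<open>g\<close> over the children of a tile of kind \<open>K\<close>; on weights of patches it is dual to the
  substitution.\<close>
definition transfer :: "(tile_kind \<Rightarrow> real) \<Rightarrow> tile_kind \<Rightarrow> real" where
  "transfer g K = (\<Sum>x\<leftarrow>kids0 K. g (akind x))"

lemma transfer_kinds:
  "transfer g Star = g Star + 5 * g Boat + 5 * g PAlpha"
  "transfer g Boat = g Star + 3 * g Boat + 3 * g PAlpha"
  "transfer g Diamond = g Star + g Boat + g PAlpha"
  "transfer g PGamma = g PGamma + 5 * g PBeta"
  "transfer g PBeta = g PGamma + g Diamond + 2 * g PAlpha + 3 * g PBeta"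
  "transfer g PAlpha = g PGamma + 2 * g Diamond + 4 * g PAlpha + g PBeta"
  by (simp_all add: transfer_def atip_def acorner_def aedge_diamond_def)

lemma kids_distinct_check: "list_all (\<lambda>K. distinct (map (place 0 0) (kids0 K))) all_kinds" by code_simp

lemma kids_distinct: "distinct (kids x)"
proof (cases x)
  case (ATile K z d)
  have "distinct (map (place 0 0) (kids0 K))"
    using kids_distinct_check all_kinds[of K] unfolding list_all_iff by blast
  moreover have "inj_on (place (lphi (lphi z)) d) (set (map (place 0 0) (kids0 K)))"
    by (rule inj_onI) (metis place_inj set_map imageE normal_place)
  ultimately have "distinct (map (place (lphi (lphi z)) d) (map (place 0 0) (kids0 K)))"
    by (simp only: distinct_map)
  moreover have "map (place (lphi (lphi z)) d) (map (place 0 0) (kids0 K)) = kids x"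
    by (simp add: ATile place_place lrot_0)
  ultimately show ?thesis by simp
qed

lemma sum_kids: "(\<Sum>y\<in>set (kids x). g (akind y)) = transfer g (akind x)"
proof -
  have "(\<Sum>y\<in>set (kids x). g (akind y)) = (\<Sum>y\<leftarrow>kids x. g (akind y))"
    using kids_distinct by (simp add: sum_list_distinct_conv_sum_set)
  also have "\<dots> = transfer g (akind x)"
    by (cases x) (simp add: transfer_def comp_def)
  finally show ?thesis .
qed

definition weight :: "(tile_kind \<Rightarrow> real) \<Rightarrow> atile set \<Rightarrow> real" where
  "weight g Z = (\<Sum>x\<in>Z. g (akind x))"

lemma finite_kidset: "finite Z \<Longrightarrow> finite (kidset Z)" by (simp add: kidset_def)

lemma weight_kidset:
  assumes "coherent Z" "finite Z"
  shows "weight g (kidset Z) = weight (transfer g) Z"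
proof -
  have "weight g (kidset Z) = (\<Sum>x\<in>Z. \<Sum>y\<in>set (kids x). g (akind y))"
    unfolding weight_def kidset_def
    by (rule sum.UNION_disjoint) (use assms disjoint_kids[OF assms(1)] in auto)
  then show ?thesis by (simp add: sum_kids weight_def)
qed

lemma coherent_iterate: "coherent Z \<Longrightarrow> coherent ((kidset ^^ i) Z)"
  by (induction i) (simp_all add: coherent_kidset)

lemma finite_iterate: "finite Z \<Longrightarrow> finite ((kidset ^^ i) Z)"
  by (induction i) (simp_all add: finite_kidset)

lemma weight_eigen:
  assumes "coherent Z" "finite Z" "\<And>K. transfer g K = \<mu> * g K"
  shows "weight g ((kidset ^^ i) Z) = \<mu> ^ i * weight g Z"
proof (induction i)
  case (Suc i)
  have "weight g ((kidset ^^ Suc i) Z) = weight (transfer g) ((kidset ^^ i) Z)"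
    using weight_kidset[OF coherent_iterate[OF assms(1)] finite_iterate[OF assms(2)]] by simp
  also have "transfer g = (\<lambda>K. \<mu> * g K)" using assms(3) by auto
  also have "weight (\<lambda>K. \<mu> * g K) ((kidset ^^ i) Z) = \<mu> * weight g ((kidset ^^ i) Z)"
    by (simp add: weight_def sum_distrib_left)
  finally show ?case using Suc by simp
qed simp

text \<open>Weights that are affine in the number of diamonds produced by a pentagon (\<gamma>: 0, \<beta>: 1, \<alpha>: 2) and
  in the number of tips of the other tiles (star: 5, boat: 3, diamond: 1). This space is invariant under
  \<open>transfer\<close>.\<close>
fun kind_weight :: "real \<Rightarrow> real \<Rightarrow> real \<Rightarrow> real \<Rightarrow> tile_kind \<Rightarrow> real" where
  "kind_weight p q w y PGamma = p" | "kind_weight p q w y PBeta = p + y" | "kind_weight p q w y PAlpha = p + 2 * y"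
| "kind_weight p q w y Star = q + 5 * w" | "kind_weight p q w y Boat = q + 3 * w" | "kind_weight p q w y Diamond = q + w"

lemma transfer_kind_weight:
  "transfer (kind_weight p q w y) K = kind_weight (6 * p + 5 * y) (q + 5 * w) (p + q + 3 * w + 2 * y) (q + w + 2 * y) K"
  by (cases K) (simp_all add: transfer_kinds algebra_simps)

lemma kind_weight_scale: "\<mu> * kind_weight p q w y K = kind_weight (\<mu> * p) (\<mu> * q) (\<mu> * w) (\<mu> * y) K"
  by (cases K) (simp_all add: algebra_simps)

text \<open>The roots of the quadratic equation are \<open>phi ^ 4 = 3 * phi + 2\<close> and \<open>phi ^ (-4) = 5 - 3 * phi\<close>.\<close>
lemma kind_weight_quadratic:
  assumes "\<mu> * \<mu> = 7 * \<mu> - 1"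
  shows "transfer (kind_weight (\<mu> + 4) (11 - \<mu>) (\<mu> - 2) (\<mu> - 5)) K = \<mu> * kind_weight (\<mu> + 4) (11 - \<mu>) (\<mu> - 2) (\<mu> - 5) K"
  unfolding transfer_kind_weight kind_weight_scale by (simp add: assms algebra_simps)

lemma kind_weight_1: "transfer (kind_weight 1 1 0 (-1)) K = 1 * kind_weight 1 1 0 (-1) K"
  unfolding transfer_kind_weight kind_weight_scale by simp

lemma kind_weight_4: "transfer (kind_weight (-10) 5 3 4) K = 4 * kind_weight (-10) 5 3 4 K"
  unfolding transfer_kind_weight kind_weight_scale by simp

definition ring_freq :: real where "ring_freq = (65 - 29 * sqrt 5) / 10"

lemma ring_freq_phi: "ring_freq = (47 - 29 * phi) / 5"
  by (simp add: ring_freq_def phi_def field_simps)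

text \<open>The weight \<open>kind_weight 1 0 0 0\<close> counts pentagons and \<open>kind_weight 41 11 15 5\<close> counts grandchildren.
  The number \<open>ring_freq\<close> is the one for which their combination has no component along the eigenvector
  of \<open>phi ^ 4\<close>.\<close>
lemma pent_excess:
  fixes K
  defines "x' \<equiv> 29 * (112 * phi - 181) / 165"
  defines "x4 \<equiv> - 5 * ring_freq - (1 - phi) * x'"
  defines "x1 \<equiv> 4 * x4 - 3 * phi * x' + 5 * ring_freq"
  shows "kind_weight 1 0 0 0 K - ring_freq * kind_weight 41 11 15 5 K =
    x1 * kind_weight 1 1 0 (-1) K + x4 * kind_weight (-10) 5 3 4 K + x' * kind_weight (9 - 3 * phi) (6 + 3 * phi) (3 - 3 * phi) (- 3 * phi) K"
proof -
  have add: "kind_weight p q w y K + kind_weight p2 q2 w2 y2 K = kind_weight (p + p2) (q + q2) (w + w2) (y + y2) K" for p q w y p2 q2 w2 y2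
    by (cases K) (simp_all add: algebra_simps)
  have diff: "kind_weight p q w y K - kind_weight p2 q2 w2 y2 K = kind_weight (p - p2) (q - q2) (w - w2) (y - y2) K" for p q w y p2 q2 w2 y2
    by (cases K) (simp_all add: algebra_simps)
  define c where "c = ring_freq"
  have c: "5 * c = 47 - 29 * phi" by (simp add: c_def ring_freq_phi)
  have x': "165 * x' = 29 * (112 * phi - 181)" by (simp add: x'_def)
  have k: "9 * (phi * x') = 3 * x' + 29 * c"
  proof -
    have "165 * (9 * (phi * x')) = 9 * phi * (165 * x')" by simp
    also have "\<dots> = 9 * 29 * (112 * (phi * phi) - 181 * phi)" unfolding x' by (simp add: algebra_simps)
    also have "\<dots> = 165 * (3 * x' + 29 * c)" using c x' unfolding phi_sq by (simp add: algebra_simps)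
    finally show ?thesis by simp
  qed
  have x4: "x4 = - 5 * c - x' + phi * x'" by (simp add: x4_def c_def algebra_simps)
  have x1: "x1 = 4 * x4 - 3 * (phi * x') + 5 * c" by (simp add: x1_def c_def algebra_simps)
  \<comment> \<open>The four parameters of \<open>kind_weight\<close> give four linear equations for three coefficients; they are
    consistent for this value of \<open>c\<close>.\<close>
  have e1: "1 - 41 * c = x1 - 10 * x4 + (9 * x' - 3 * (phi * x'))"
    and e2: "- 11 * c = x1 + 5 * x4 + (6 * x' + 3 * (phi * x'))"
    and e3: "- 15 * c = 3 * x4 + (3 * x' - 3 * (phi * x'))"
    and e4: "- 5 * c = - x1 + 4 * x4 - 3 * (phi * x')"
    using k c x' unfolding x1 x4 by argo+
  have "kind_weight 1 0 0 0 K - c * kind_weight 41 11 15 5 K = kind_weight (1 - 41 * c) (- 11 * c) (- 15 * c) (- 5 * c) K"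
    unfolding kind_weight_scale diff by (simp add: algebra_simps)
  also have "1 - 41 * c = x1 * 1 + x4 * (-10) + x' * (9 - 3 * phi)"
    unfolding e1 by (simp add: algebra_simps)
  also have "- 11 * c = x1 * 1 + x4 * 5 + x' * (6 + 3 * phi)"
    unfolding e2 by (simp add: algebra_simps)
  also have "- 15 * c = x1 * 0 + x4 * 3 + x' * (3 - 3 * phi)"
    unfolding e3 by (simp add: algebra_simps)
  also have "- 5 * c = x1 * (-1) + x4 * 4 + x' * (- 3 * phi)"
    unfolding e4 by (simp add: algebra_simps)
  also have "kind_weight (x1 * 1 + x4 * (-10) + x' * (9 - 3 * phi)) (x1 * 1 + x4 * 5 + x' * (6 + 3 * phi))
      (x1 * 0 + x4 * 3 + x' * (3 - 3 * phi)) (x1 * (-1) + x4 * 4 + x' * (- 3 * phi)) K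
    = x1 * kind_weight 1 1 0 (-1) K + x4 * kind_weight (-10) 5 3 4 K + x' * kind_weight (9 - 3 * phi) (6 + 3 * phi) (3 - 3 * phi) (- 3 * phi) K"
    unfolding kind_weight_scale add ..
  finally show ?thesis unfolding c_def .
qed

lemma weight_add: "weight (\<lambda>K. g K + h K) Z = weight g Z + weight h Z"
  by (simp add: weight_def sum.distrib)

lemma weight_cmult: "weight (\<lambda>K. c * g K) Z = c * weight g Z"
  by (simp add: weight_def sum_distrib_left)

lemma weight_diff: "weight (\<lambda>K. g K - h K) Z = weight g Z - weight h Z"
  by (simp add: weight_def sum_subtractf)

lemma weight_bound:
  assumes "\<And>K. \<bar>g K\<bar> \<le> G"
  shows "\<bar>weight g Z\<bar> \<le> G * card Z"
proof -
  have "\<bar>weight g Z\<bar> \<le> (\<Sum>x\<in>Z. \<bar>g (akind x)\<bar>)" unfolding weight_def by (rule sum_abs)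
  also have "\<dots> \<le> (\<Sum>x\<in>Z. G)" by (intro sum_mono assms)
  finally show ?thesis by (simp add: mult.commute)
qed

lemma weight_one: "weight (kind_weight 1 1 0 0) Z = card Z"
proof -
  have "kind_weight 1 1 0 0 K = 1" for K by (cases K) simp_all
  then show ?thesis by (simp add: weight_def)
qed

lemma kinds_bounded: "\<exists>G\<ge>0. \<forall>K. \<bar>g K\<bar> \<le> (G :: real)" for g :: "tile_kind \<Rightarrow> real"
proof (intro exI conjI allI)
  show "0 \<le> (\<Sum>L\<in>set all_kinds. \<bar>g L\<bar>)" by (intro sum_nonneg) simp
  show "\<bar>g K\<bar> \<le> (\<Sum>L\<in>set all_kinds. \<bar>g L\<bar>)" for K
    by (rule member_le_sum) (auto simp: all_kinds)
qed

lemma card_two_levels: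
  assumes "coherent Z" "finite Z"
  shows "real (card ((kidset ^^ (i + 2)) Z)) = weight (kind_weight 41 11 15 5) ((kidset ^^ i) Z)"
proof -
  let ?Y = "(kidset ^^ i) Z"
  have Y: "coherent ?Y" "finite ?Y" by (simp_all add: coherent_iterate finite_iterate assms)
  have "real (card (kidset (kidset ?Y))) = weight (kind_weight 1 1 0 0) (kidset (kidset ?Y))" by (simp only: weight_one)
  also have "\<dots> = weight (transfer (transfer (kind_weight 1 1 0 0))) ?Y"
    using weight_kidset[OF coherent_kidset[OF Y(1)] finite_kidset[OF Y(2)]] weight_kidset[OF Y] by simp
  also have "transfer (transfer (kind_weight 1 1 0 0)) = kind_weight 41 11 15 5"
  proof -
    have "transfer (kind_weight 1 1 0 0) = kind_weight 6 1 2 1" by (rule ext) (simp add: transfer_kind_weight)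
    then show ?thesis by (auto simp: transfer_kind_weight)
  qed
  finally show ?thesis by simp
qed

lemma pent_count:
  "\<exists>C::real. C \<ge> 0 \<and> (\<forall>Z i. coherent Z \<longrightarrow> finite Z \<longrightarrow>
    ring_freq * card ((kidset ^^ (i + 2)) Z) - C * 4 ^ i * card Z \<le> weight (kind_weight 1 0 0 0) ((kidset ^^ i) Z))"
proof -
  \<comment> \<open>The coefficients of the expansion in \<open>pent_excess\<close>.\<close>
  define x' where "x' = 29 * (112 * phi - 181) / 165"
  define x4 where "x4 = - 5 * ring_freq - (1 - phi) * x'"
  define x1 where "x1 = 4 * x4 - 3 * phi * x' + 5 * ring_freq"
  define g1 g4 g' where "g1 = kind_weight 1 1 0 (-1)" "g4 = kind_weight (-10) 5 3 4"
    "g' = kind_weight (9 - 3 * phi) (6 + 3 * phi) (3 - 3 * phi) (- 3 * phi)"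
  define \<mu> where "\<mu> = 5 - 3 * phi"
  have \<mu>: "0 \<le> \<mu>" "\<mu> \<le> 1" using phi_bounds by (simp_all add: \<mu>_def)
  have eig: "transfer g1 K = 1 * g1 K" "transfer g4 K = 4 * g4 K" "transfer g' K = \<mu> * g' K" for K
  proof -
    show "transfer g1 K = 1 * g1 K" unfolding g1_g4_g'_def by (rule kind_weight_1)
    show "transfer g4 K = 4 * g4 K" unfolding g1_g4_g'_def by (rule kind_weight_4)
    have "\<mu> * \<mu> = 7 * \<mu> - 1" using phi_sq unfolding \<mu>_def by (simp add: algebra_simps)
    from kind_weight_quadratic[OF this, of K] show "transfer g' K = \<mu> * g' K"
      by (simp add: g1_g4_g'_def(3) \<mu>_def)
  qed
  obtain G1 where G1: "G1 \<ge> 0" "\<And>K. \<bar>g1 K\<bar> \<le> G1" using kinds_bounded by blast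
  obtain G4 where G4: "G4 \<ge> 0" "\<And>K. \<bar>g4 K\<bar> \<le> G4" using kinds_bounded by blast
  obtain G' where G': "G' \<ge> 0" "\<And>K. \<bar>g' K\<bar> \<le> G'" using kinds_bounded by blast
  define C where "C = \<bar>x1\<bar> * G1 + \<bar>x4\<bar> * G4 + \<bar>x'\<bar> * G'"
  have "C \<ge> 0" using G1 G4 G' by (simp add: C_def)
  moreover have "ring_freq * card ((kidset ^^ (i + 2)) Z) - C * 4 ^ i * card Z \<le> weight (kind_weight 1 0 0 0) ((kidset ^^ i) Z)"
    if Z: "coherent Z" "finite Z" for Z i
  proof -
    let ?Y = "(kidset ^^ i) Z"
    have "weight (kind_weight 1 0 0 0) ?Y - ring_freq * weight (kind_weight 41 11 15 5) ?Y
        = weight (\<lambda>K. kind_weight 1 0 0 0 K - ring_freq * kind_weight 41 11 15 5 K) ?Y"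
      by (simp only: weight_diff weight_cmult)
    also have "\<dots> = weight (\<lambda>K. x1 * g1 K + x4 * g4 K + x' * g' K) ?Y"
      unfolding g1_g4_g'_def x1_def x4_def x'_def by (simp only: pent_excess)
    also have "\<dots> = x1 * weight g1 ?Y + x4 * weight g4 ?Y + x' * weight g' ?Y"
      by (simp only: weight_add weight_cmult)
    also have "\<dots> = x1 * weight g1 Z + x4 * (4 ^ i * weight g4 Z) + x' * (\<mu> ^ i * weight g' Z)"
      using weight_eigen[OF Z eig(1)] weight_eigen[OF Z eig(2)] weight_eigen[OF Z eig(3)] by simp
    finally have eq: "weight (kind_weight 1 0 0 0) ?Y - ring_freq * weight (kind_weight 41 11 15 5) ?Y
       = x1 * weight g1 Z + x4 * (4 ^ i * weight g4 Z) + x' * (\<mu> ^ i * weight g' Z)" .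
    have b: "\<bar>x * (t * w)\<bar> \<le> \<bar>x\<bar> * G * 4 ^ i * card Z" if "0 \<le> t" "t \<le> 4 ^ i" "\<bar>w\<bar> \<le> G * card Z" for x t w G :: real
    proof -
      have "t * \<bar>w\<bar> \<le> 4 ^ i * (G * card Z)" using that by (intro mult_mono) auto
      then have "\<bar>x\<bar> * (t * \<bar>w\<bar>) \<le> \<bar>x\<bar> * (4 ^ i * (G * card Z))" by (intro mult_left_mono) auto
      then show ?thesis using that(1) by (simp add: abs_mult mult_ac)
    qed
    have one: "(1::real) \<le> 4 ^ i" by simp
    have "\<mu> ^ i \<le> 1" using \<mu> by (simp add: power_le_one)
    then have m: "\<mu> ^ i \<le> 4 ^ i" using one by linarith
    have "\<bar>x1 * (1 * weight g1 Z)\<bar> \<le> \<bar>x1\<bar> * G1 * 4 ^ i * card Z"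
      by (rule b) (use one weight_bound[OF G1(2)] in auto)
    moreover have "\<bar>x4 * (4 ^ i * weight g4 Z)\<bar> \<le> \<bar>x4\<bar> * G4 * 4 ^ i * card Z"
      by (rule b) (use weight_bound[OF G4(2)] in auto)
    moreover have "\<bar>x' * (\<mu> ^ i * weight g' Z)\<bar> \<le> \<bar>x'\<bar> * G' * 4 ^ i * card Z"
      by (rule b) (use m \<mu> weight_bound[OF G'(2)] in auto)
    moreover have "C * 4 ^ i * card Z = \<bar>x1\<bar> * G1 * 4 ^ i * card Z + \<bar>x4\<bar> * G4 * 4 ^ i * card Z + \<bar>x'\<bar> * G' * 4 ^ i * card Z"
      by (simp add: C_def algebra_simps)
    ultimately have "- (C * 4 ^ i * card Z) \<le> weight (kind_weight 1 0 0 0) ?Y - ring_freq * weight (kind_weight 41 11 15 5) ?Y"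
      unfolding eq mult_1_left by linarith
    then show ?thesis unfolding card_two_levels[OF Z] by simp
  qed
  ultimately show ?thesis by (intro exI[of _ C]) simp
qed

text \<open>The eigenvector of \<open>phi ^ 4 > 6\<close> is bounded between 7 and 30, so the number of tiles grows at
  least like \<open>6 ^ j\<close>, faster than the components along the other eigenvectors.\<close>
lemma growth:
  assumes "coherent Z" "finite Z"
  shows "7 * 6 ^ j * card Z \<le> 30 * real (card ((kidset ^^ j) Z))"
proof -
  define \<mu> where "\<mu> = 3 * phi + 2"
  define h where "h = kind_weight (\<mu> + 4) (11 - \<mu>) (\<mu> - 2) (\<mu> - 5)"
  have "\<mu> * \<mu> = 7 * \<mu> - 1" using phi_sq unfolding \<mu>_def by (simp add: algebra_simps)
  from kind_weight_quadratic[OF this] have eig: "transfer h K = \<mu> * h K" for K unfolding h_def .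
  have h: "7 \<le> h K" "h K \<le> 30" for K using phi_bounds unfolding h_def \<mu>_def by (cases K; simp)+
  have wl: "7 * card Y \<le> weight h Y" "weight h Y \<le> 30 * card Y" for Y
    using sum_mono[of Y "\<lambda>_. 7" "\<lambda>x. h (akind x)"] sum_mono[of Y "\<lambda>x. h (akind x)" "\<lambda>_. 30"] h
    by (simp_all add: weight_def mult.commute)
  have "6 ^ j \<le> \<mu> ^ j" using phi_bounds by (intro power_mono) (simp_all add: \<mu>_def)
  then have "6 ^ j * (7 * real (card Z)) \<le> \<mu> ^ j * weight h Z" using wl(1) phi_bounds
    by (intro mult_mono) (simp_all add: \<mu>_def)
  also have "\<dots> = weight h ((kidset ^^ j) Z)" by (rule weight_eigen[OF assms eig, symmetric])
  also have "\<dots> \<le> 30 * card ((kidset ^^ j) Z)" by (rule wl(2))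
  finally show ?thesis by (simp add: mult_ac)
qed

lemma pent_density:
  assumes "\<epsilon> > 0"
  shows "\<exists>i. \<forall>Z. coherent Z \<longrightarrow> finite Z \<longrightarrow>
    (ring_freq - \<epsilon>) * card ((kidset ^^ (i + 2)) Z) \<le> weight (kind_weight 1 0 0 0) ((kidset ^^ i) Z)"
proof -
  obtain C :: real where C: "C \<ge> 0" "\<forall>Z i. coherent Z \<longrightarrow> finite Z \<longrightarrow>
    ring_freq * card ((kidset ^^ (i + 2)) Z) - C * 4 ^ i * card Z \<le> weight (kind_weight 1 0 0 0) ((kidset ^^ i) Z)"
    using pent_count by (elim exE conjE) (rule that)
  have "(\<lambda>i. C * (4 / 6) ^ i) \<longlonglongrightarrow> C * 0" by (intro tendsto_mult tendsto_const LIMSEQ_power_zero) simp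
  then have "\<forall>\<^sub>F i in sequentially. C * (4 / 6) ^ i < \<epsilon>" using assms by (auto dest: order_tendstoD)
  then obtain i where i: "C * (4 / 6) ^ i < \<epsilon>" by (auto simp: eventually_sequentially)
  have "(ring_freq - \<epsilon>) * card ((kidset ^^ (i + 2)) Z) \<le> weight (kind_weight 1 0 0 0) ((kidset ^^ i) Z)"
    if Z: "coherent Z" "finite Z" for Z
  proof -
    have "6 ^ i * real (card Z) \<le> 7 * 6 ^ (i + 2) / 30 * card Z" by simp
    also have "\<dots> \<le> card ((kidset ^^ (i + 2)) Z)" using growth[OF Z, of "i + 2"] by (simp add: mult_ac)
    finally have g: "6 ^ i * real (card Z) \<le> card ((kidset ^^ (i + 2)) Z)" .
    have "C * 4 ^ i * card Z = C * (4 / 6) ^ i * (6 ^ i * real (card Z))"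
    proof -
      have "(4::real) ^ i = (4 / 6) ^ i * 6 ^ i" by (simp flip: power_mult_distrib)
      then show ?thesis by (simp only: mult.assoc)
    qed
    also have "\<dots> \<le> \<epsilon> * card ((kidset ^^ (i + 2)) Z)"
      using i g C(1) assms by (intro mult_mono) auto
    finally show ?thesis using C(2)[rule_format, OF Z, of i] by (simp add: algebra_simps)
  qed
  then show ?thesis by (intro exI[of _ i]) simp
qed

section \<open>Counting tiles by area\<close>

text \<open>Different tiles of a coherent set have positions at distance at least \<open>rho\<close>, so the discs of
  radius \<open>rho / 2\<close> around them are disjoint.\<close>
lemma packing_bound:
  fixes D :: "complex set"
  assumes "coherent X" "norm a = rho" "Y \<subseteq> X" "finite Y" "D \<in> lmeasurable"
    "\<And>y. y \<in> Y \<Longrightarrow> ball (pt a b (apos y)) (rho / 2) \<subseteq> D"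
  shows "card Y * (unit_ball_vol 2 * (rho / 2)\<^sup>2) \<le> measure lebesgue D"
proof -
  let ?B = "\<lambda>y. ball (pt a b (apos y)) (rho / 2)"
  have disj: "disjoint_family_on ?B Y"
    unfolding disjoint_family_on_def
  proof (intro ballI impI)
    fix s t assume "s \<in> Y" "t \<in> Y" "s \<noteq> t"
    then have "1 \<le> norm (ev (apos t - apos s))" using coherent_spaced[OF assms(1)] assms(3) by blast
    then have "rho \<le> dist (pt a b (apos s)) (pt a b (apos t))" unfolding dist_pt[OF assms(2)] using rho_pos by simp
    then show "?B s \<inter> ?B t = {}" by (intro disjoint_ballI) simp
  qed
  have vol: "measure lebesgue (?B y) = unit_ball_vol 2 * (rho / 2)\<^sup>2" for y
    using content_ball[of "rho / 2" "pt a b (apos y)"] rho_pos by simp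
  have "measure lebesgue (\<Union>y\<in>Y. ?B y) = (\<Sum>y\<in>Y. measure lebesgue (?B y))"
  proof (rule measure_finite_Union[OF assms(4) _ disj])
    show "emeasure lebesgue (?B y) \<noteq> \<infinity>" for y
      using fmeasurableD2[OF lmeasurable_ball, of "pt a b (apos y)" "rho / 2"] by simp
  qed auto
  then have "card Y * (unit_ball_vol 2 * (rho / 2)\<^sup>2) = measure lebesgue (\<Union>y\<in>Y. ?B y)" by (simp add: vol)
  also have "\<dots> \<le> measure lebesgue D"
    using assms(4-6) by (intro measure_mono_fmeasurable) auto
  finally show ?thesis .
qed

lemma disc_count:
  assumes "coherent X" "norm a = rho" "Y \<subseteq> X" "finite Y" "r \<ge> 0" "\<And>y. y \<in> Y \<Longrightarrow> norm (pt a b (apos y)) \<le> r"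
  shows "card Y * (rho / 2)\<^sup>2 \<le> (r + 1)\<^sup>2"
proof -
  have "card Y * (unit_ball_vol 2 * (rho / 2)\<^sup>2) \<le> measure lebesgue (ball (0::complex) (r + 1))"
  proof (rule packing_bound[OF assms(1-4)])
    fix y assume "y \<in> Y"
    show "ball (pt a b (apos y)) (rho / 2) \<subseteq> ball 0 (r + 1)"
      using assms(6)[OF \<open>y \<in> Y\<close>] rho_less_1 by (simp add: ball_subset_ball_iff)
  qed simp
  also have "\<dots> = unit_ball_vol 2 * (r + 1)\<^sup>2" using content_ball[of "r + 1" "0::complex"] assms(5) by simp
  finally have "unit_ball_vol 2 * (card Y * (rho / 2)\<^sup>2) \<le> unit_ball_vol 2 * (r + 1)\<^sup>2" by (simp only: mult.left_commute)
  moreover have "unit_ball_vol (2::real) > 0" by simp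
  ultimately show ?thesis by (simp only: mult_le_cancel_left_pos)
qed

lemma annulus_count:
  assumes "coherent X" "norm a = rho" "Y \<subseteq> X" "finite Y" "1 \<le> r" "r \<le> r'"
    "\<And>y. y \<in> Y \<Longrightarrow> r < norm (pt a b (apos y))" "\<And>y. y \<in> Y \<Longrightarrow> norm (pt a b (apos y)) \<le> r'"
  shows "card Y * (rho / 2)\<^sup>2 \<le> (r' + 1)\<^sup>2 - (r - 1)\<^sup>2"
proof -
  let ?D = "ball (0::complex) (r' + 1) - cball 0 (r - 1)"
  have "card Y * (unit_ball_vol 2 * (rho / 2)\<^sup>2) \<le> measure lebesgue ?D"
  proof (rule packing_bound[OF assms(1-4)])
    fix y assume y: "y \<in> Y"
    have 1: "ball (pt a b (apos y)) (rho / 2) \<subseteq> ball 0 (r' + 1)"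
      using assms(8)[OF y] rho_less_1 by (simp add: ball_subset_ball_iff)
    have "r - 1 < norm x" if "x \<in> ball (pt a b (apos y)) (rho / 2)" for x
    proof -
      have "norm (pt a b (apos y)) \<le> norm x + dist (pt a b (apos y)) x"
        using norm_triangle_ineq[of x "pt a b (apos y) - x"] by (simp add: dist_norm)
      then show ?thesis using that assms(7)[OF y] rho_less_1 by simp
    qed
    with 1 show "ball (pt a b (apos y)) (rho / 2) \<subseteq> ?D" by force
  qed (intro fmeasurable.Diff, simp_all)
  also have "\<dots> = measure lebesgue (ball (0::complex) (r' + 1)) - measure lebesgue (cball (0::complex) (r - 1))"
    using assms(5,6) by (intro measurable_measure_Diff) (auto simp: subset_iff)
  also have "\<dots> = unit_ball_vol 2 * (r' + 1)\<^sup>2 - unit_ball_vol 2 * (r - 1)\<^sup>2"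
    using content_ball[of "r' + 1" "0::complex"] content_cball[of "r - 1" "0::complex"] assms(5,6) by simp
  finally have "unit_ball_vol 2 * (card Y * (rho / 2)\<^sup>2) \<le> unit_ball_vol 2 * ((r' + 1)\<^sup>2 - (r - 1)\<^sup>2)"
    by (simp only: mult.left_commute right_diff_distrib)
  moreover have "unit_ball_vol (2::real) > 0" by simp
  ultimately show ?thesis by (simp only: mult_le_cancel_left_pos)
qed

lemma reach_of_tile: "rho * rad K \<le> 2"
proof -
  have "rho * rad K \<le> 1 * phi" using rho_less_1 rho_pos rad_le rad_pos[of K] by (intro mult_mono) auto
  then show ?thesis using phi_bounds by simp
qed

text \<open>The tiles that meet the ball cover it, and each fits into a disc of radius 2.\<close>
lemma (in window) window_area:
  assumes "finite V"
  shows "(real n)\<^sup>2 \<le> 4 * card V"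
proof -
  have "\<forall>t\<in>V. \<exists>c. region t \<subseteq> cball c 2"
  proof
    fix t assume "t \<in> V"
    then obtain s where "s \<in> X" "t = q s" using realized by blast
    moreover have "cball (pt a b (apos s)) (rho * rad (akind s)) \<subseteq> cball (pt a b (apos s)) 2"
      by (rule subset_cball[OF reach_of_tile])
    ultimately show "\<exists>c. region t \<subseteq> cball c 2" using region_subset_cball[OF norm_a, of b s] by blast
  qed
  then obtain c where c: "\<And>t. t \<in> V \<Longrightarrow> region t \<subseteq> cball (c t) 2" by metis
  have "cball 0 (real n) \<subseteq> (\<Union>t\<in>V. cball (c t) 2)"
  proof
    fix x :: complex assume "x \<in> cball 0 (real n)"
    then have "norm x \<le> n" by simp
    then obtain s where "x \<in> region (q s)" "q s \<in> V" by (rule point_covered)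
    then show "x \<in> (\<Union>t\<in>V. cball (c t) 2)" using c by blast
  qed
  then have "measure lebesgue (cball (0::complex) n) \<le> measure lebesgue (\<Union>t\<in>V. cball (c t) 2)"
    using assms by (intro measure_mono_fmeasurable) auto
  also have "\<dots> \<le> (\<Sum>t\<in>V. measure lebesgue (cball (c t) 2))"
    using assms by (intro measure_UNION_le) auto
  finally have "unit_ball_vol 2 * (real n)\<^sup>2 \<le> unit_ball_vol 2 * (4 * card V)"
    using content_cball[of "real n" "0::complex"] content_cball[of 2 "_::complex"] by (simp add: mult_ac)
  moreover have "unit_ball_vol (2::real) > 0" by simp
  ultimately show ?thesis by (simp only: mult_le_cancel_left_pos)
qed

section \<open>Patches of a tiling are realized by supertiles\<close>

lemma affine_hull_image: "(\<lambda>z. \<alpha> * z + \<beta>) ` (convex hull S) = convex hull ((\<lambda>z. \<alpha> * z + \<beta>) ` S)"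
  for \<alpha> \<beta> :: complex
proof -
  have lin: "linear (\<lambda>z. \<alpha> * z)" by (rule bounded_linear.linear[OF bounded_linear_mult_right])
  have "(\<lambda>z. \<alpha> * z + \<beta>) ` A = (\<lambda>x. \<beta> + x) ` (\<lambda>z. \<alpha> * z) ` A" for A
    by (simp add: image_image add.commute)
  then show ?thesis by (simp only: convex_hull_linear_image[OF lin] convex_hull_translation)
qed

lemma affine_segment_image:
  "(\<lambda>z. \<alpha> * z + \<beta>) ` closed_segment x y = closed_segment (\<alpha> * x + \<beta>) (\<alpha> * y + \<beta>)" for \<alpha> \<beta> x y :: complex
  unfolding segment_convex_hull affine_hull_image by simp

lemma mark_conc_base:
  "mark (conc a b (base K)) = (if K = PAlpha \<or> K = PBeta then closed_segment (pt a b lone) (pt a b (lrot 2 lone))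
     else if K = Diamond then {pt a b (- lone)} else {})"
  by (cases K) (simp_all add: conc_base_simps star_def boat_def diamond_def pent_def side_ev pt_def ev_minus ev_one
      numeral_2_eq_2[symmetric])

lemma move_conc: "move \<alpha> \<beta> (conc a b x) = conc (\<alpha> * a) (\<alpha> * b + \<beta>) x"
proof -
  have base: "move \<alpha> \<beta> (conc a b (base K)) = conc (\<alpha> * a) (\<alpha> * b + \<beta>) (base K)" for a b K
  proof -
    have p: "\<alpha> * pt a b v + \<beta> = pt (\<alpha> * a) (\<alpha> * b + \<beta>) v" for v by (simp add: pt_def algebra_simps)
    let ?t = "conc a b (base K)" and ?t' = "conc (\<alpha> * a) (\<alpha> * b + \<beta>) (base K)" and ?g = "\<lambda>z. \<alpha> * z + \<beta>"
    have "?g ` region ?t = region ?t'"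
      unfolding region_conc_base image_UN affine_hull_image image_image p ..
    moreover have "(`) ?g ` edges ?t = edges ?t'"
      unfolding edges_conc_base image_image case_prod_unfold affine_segment_image p ..
    moreover have "?g ` mark ?t = mark ?t'"
      unfolding mark_conc_base by (simp add: affine_segment_image p)
    ultimately show ?thesis unfolding move_def Let_def by (intro tile.expand) simp
  qed
  show ?thesis
  proof (cases x)
    case (ATile K z d)
    have "\<alpha> * pt a b z + \<beta> = pt (\<alpha> * a) (\<alpha> * b + \<beta>) z" by (simp add: pt_def algebra_simps)
    then show ?thesis unfolding ATile conc_base[of a b K z d] conc_base[of "\<alpha> * a" _ K z d] base by (simp add: mult.assoc)
  qed
qed

lemma move_inj:
  assumes "move \<alpha> \<beta> s = move \<alpha> \<beta> t" "\<alpha> \<noteq> 0"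
  shows "s = t"
proof -
  have inj: "inj (\<lambda>z. \<alpha> * z + \<beta>)" using assms(2) by (auto intro!: injI)
  then have inj2: "inj ((`) (\<lambda>z. \<alpha> * z + \<beta>))" by (intro injI) (simp only: inj_image_eq_iff[OF inj])
  have "kind s = kind t" "region s = region t" "edges s = edges t" "mark s = mark t"
    using assms(1) inj_image_eq_iff[OF inj] inj_image_eq_iff[OF inj2] by (simp_all add: move_def Let_def)
  then show ?thesis by (intro tile.expand) simp
qed

lemma is_tile_conc: "is_tile t \<Longrightarrow> \<exists>a b K. norm a = rho \<and> t = conc a b (base K)"
proof (induction rule: is_tile.induct)
  case (1 r c)
  then show ?case using phi_pos by (intro exI[of _ "phi * r"] exI[of _ c] exI[of _ Star]) (simp add: conc_base_simps norm_mult)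
next
  case (2 r c)
  then show ?case using phi_pos by (intro exI[of _ "phi * r"] exI[of _ c] exI[of _ Boat]) (simp add: conc_base_simps norm_mult)
next
  case (3 u m)
  then show ?case using rho_pos
    by (intro exI[of _ "rho * u"] exI[of _ "m + rho * u"] exI[of _ Diamond]) (simp add: conc_base_simps norm_mult)
next
  case (4 r c)
  then show ?case by (intro exI[of _ r] exI[of _ c] exI[of _ PAlpha]) (simp add: conc_base_simps)
next
  case (5 r c)
  then show ?case by (intro exI[of _ r] exI[of _ c] exI[of _ PBeta]) (simp add: conc_base_simps)
next
  case (6 r c)
  then show ?case by (intro exI[of _ r] exI[of _ c] exI[of _ PGamma]) (simp add: conc_base_simps)
qed

lemma subst_iterate_conc:
  assumes "norm a = rho"
  shows "\<exists>b'. (subst ^^ N) {conc a b x} \<subseteq> conc a b' ` ((kidset ^^ N) {x})"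
proof (induction N)
  case 0
  then show ?case by auto
next
  case (Suc N)
  then obtain b' where b': "(subst ^^ N) {conc a b x} \<subseteq> conc a b' ` ((kidset ^^ N) {x})" by blast
  have "(subst ^^ Suc N) {conc a b x} \<subseteq> conc a (enl b') ` ((kidset ^^ Suc N) {x})"
  proof
    fix t' assume "t' \<in> (subst ^^ Suc N) {conc a b x}"
    then obtain t where "t \<in> (subst ^^ N) {conc a b x}" "piece t t'" by (auto simp: subst_def)
    then obtain y where y: "y \<in> (kidset ^^ N) {x}" "piece (conc a b' y) t'" using b' by blast
    obtain w where "w \<in> set (kids y)" "t' = conc a (enl b') w" using piece_conc[OF y(2) assms] by blast
    then show "t' \<in> conc a (enl b') ` ((kidset ^^ Suc N) {x})" using y(1) by (auto simp: kidset_def)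
  qed
  then show ?case by blast
qed

text \<open>Apply the inverse of the motion in the definition of the tiling to the coordinates of the supertile.\<close>
lemma patch_realized:
  assumes "boat_star_tiling T" "finite F" "F \<subseteq> T"
  shows "\<exists>a b K N. norm a = rho \<and> F \<subseteq> conc a b ` ((kidset ^^ N) {base K})"
proof -
  obtain Q N \<alpha> \<beta> where Q: "is_tile Q" "norm \<alpha> = 1" "move \<alpha> \<beta> ` F \<subseteq> (subst ^^ N) {Q}"
    using assms(1)[unfolded boat_star_tiling_def, THEN conjunct2, rule_format, OF conjI, OF assms(2,3)] by (elim exE conjE) (rule that)
  obtain a b K where a: "norm a = rho" "Q = conc a b (base K)" using is_tile_conc[OF Q(1)] by blast
  obtain b' where b': "(subst ^^ N) {Q} \<subseteq> conc a b' ` ((kidset ^^ N) {base K})"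
    using subst_iterate_conc[OF a(1)] a(2) by blast
  have \<alpha>: "\<alpha> \<noteq> 0" using Q(2) by auto
  have "F \<subseteq> conc (a / \<alpha>) ((b' - \<beta>) / \<alpha>) ` ((kidset ^^ N) {base K})"
  proof
    fix t assume "t \<in> F"
    then have "move \<alpha> \<beta> t \<in> conc a b' ` ((kidset ^^ N) {base K})" using Q(3) b' by blast
    then obtain y where y: "y \<in> (kidset ^^ N) {base K}" "move \<alpha> \<beta> t = conc a b' y" by blast
    have "move \<alpha> \<beta> (conc (a / \<alpha>) ((b' - \<beta>) / \<alpha>) y) = conc a b' y" using \<alpha> by (simp add: move_conc)
    then have "move \<alpha> \<beta> t = move \<alpha> \<beta> (conc (a / \<alpha>) ((b' - \<beta>) / \<alpha>) y)" by (simp only: y(2))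
    then have "t = conc (a / \<alpha>) ((b' - \<beta>) / \<alpha>) y" using \<alpha> by (rule move_inj)
    then show "t \<in> conc (a / \<alpha>) ((b' - \<beta>) / \<alpha>) ` ((kidset ^^ N) {base K})" using y(1) by blast
  qed
  moreover have "norm (a / \<alpha>) = rho" using a(1) Q(2) by (simp add: norm_divide)
  ultimately show ?thesis by blast
qed

lemma coherent_base: "coherent {base K}"
  by (simp add: coherent_def normal_def base_def dir_norm_def)

lemma coherent_supertile: "coherent ((kidset ^^ N) {base K})"
  by (rule coherent_iterate[OF coherent_base])

lemma finite_supertile: "finite ((kidset ^^ N) {base K})"
  by (rule finite_iterate) simp

lemma conc_touching:
  assumes "norm a = rho" "region (conc a b y) \<inter> cball 0 (real n) \<noteq> {}"
  shows "norm (pt a b (apos y)) \<le> real n + 2"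
proof -
  obtain x where x: "x \<in> region (conc a b y)" "norm x \<le> n" using assms(2) by auto
  have "dist (pt a b (apos y)) x \<le> 2"
    using subsetD[OF region_subset_cball[OF assms(1)] x(1)] reach_of_tile[of "akind y"] by simp
  then show ?thesis using x(2) norm_triangle_ineq[of x "pt a b (apos y) - x"] by (simp add: dist_norm)
qed

text \<open>Every finite part is realized in a coherent set, where the packing bound limits its size uniformly.\<close>
lemma finite_tiles_upto:
  assumes "boat_star_tiling T"
  shows "finite (tiles_upto T n)"
proof -
  have "card G \<le> nat \<lceil>(real n + 3)\<^sup>2 / (rho / 2)\<^sup>2\<rceil>" if G: "G \<subseteq> tiles_upto T n" "finite G" for G
  proof -
    have "G \<subseteq> T" using G(1) by (auto simp: tiles_upto_def)
    then obtain a b K N where a: "norm a = rho" "G \<subseteq> conc a b ` ((kidset ^^ N) {base K})"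
      using patch_realized[OF assms G(2)] by blast
    define X Y where "X = (kidset ^^ N) {base K}" "Y = {y \<in> X. conc a b y \<in> G}"
    have X: "coherent X" "finite X" by (simp_all add: X_Y_def coherent_supertile finite_supertile)
    have Y: "Y \<subseteq> X" "finite Y" using X(2) by (simp_all add: X_Y_def(2))
    have "G \<subseteq> conc a b ` Y" using a(2) by (auto simp: X_Y_def)
    then have "card G \<le> card Y" by (rule surj_card_le[OF Y(2)])
    have "norm (pt a b (apos y)) \<le> real n + 2" if "y \<in> Y" for y
      by (rule conc_touching[OF a(1)]) (use that G(1) in \<open>auto simp: X_Y_def(2) tiles_upto_def\<close>)
    then have "card Y * (rho / 2)\<^sup>2 \<le> (real n + 2 + 1)\<^sup>2" by (intro disc_count[OF X(1) a(1) Y]) auto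
    then have "card Y * (rho / 2)\<^sup>2 \<le> (real n + 3)\<^sup>2" by (simp add: add.commute)
    then have "real (card Y) \<le> (real n + 3)\<^sup>2 / (rho / 2)\<^sup>2" using rho_pos by (subst pos_le_divide_eq) simp_all
    then show ?thesis using \<open>card G \<le> card Y\<close> by linarith
  qed
  then show ?thesis by (rule finite_if_finite_subsets_card_bdd[THEN conjunct1])
qed

section \<open>Supertiles\<close>

lemma iterate_UN: "(kidset ^^ i) Z = (\<Union>x\<in>Z. (kidset ^^ i) {x})"
  by (induction i) (auto simp: kidset_def)

lemma iterate_mono: "Z \<subseteq> Z' \<Longrightarrow> (kidset ^^ i) Z \<subseteq> (kidset ^^ i) Z'"
  unfolding iterate_UN[of i Z] iterate_UN[of i Z'] by (rule UN_mono) simp_all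

lemma norm_sum_split: "z = x + y \<Longrightarrow> norm z \<le> norm x + norm y" for x y z :: complex
  by (simp add: norm_triangle_ineq)

text \<open>The invariant of the radii, summed along the generations: a supertile of level \<open>i\<close> stays in the
  disc of its ancestor enlarged \<open>i\<close> times.\<close>
lemma iterate_displacement:
  "y \<in> (kidset ^^ i) {x} \<Longrightarrow>
    norm (ev (apos y) - (complex_of_real phi * phi) ^ i * ev (apos x)) \<le> (phi * phi) ^ i * rad (akind x) - rad (akind y)"
proof (induction i arbitrary: y)
  case (Suc i)
  then have "y \<in> kidset ((kidset ^^ i) {x})" by simp
  then obtain w where w: "w \<in> (kidset ^^ i) {x}" "y \<in> set (kids w)" unfolding kidset_def[of "(kidset ^^ i) {x}"] by blast
  let ?p = "complex_of_real phi * phi"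
  have "ev (apos y) - ?p ^ Suc i * ev (apos x)
      = (ev (apos y) - ?p * ev (apos w)) + ?p * (ev (apos w) - ?p ^ i * ev (apos x))"
    by (simp add: algebra_simps)
  then have "norm (ev (apos y) - ?p ^ Suc i * ev (apos x))
      \<le> norm (ev (apos y) - ?p * ev (apos w)) + norm (?p * (ev (apos w) - ?p ^ i * ev (apos x)))"
    by (rule norm_sum_split)
  also have "norm (?p * (ev (apos w) - ?p ^ i * ev (apos x))) = phi * phi * norm (ev (apos w) - ?p ^ i * ev (apos x))"
    using phi_pos by (simp add: norm_mult)
  also have "\<dots> \<le> phi * phi * ((phi * phi) ^ i * rad (akind x) - rad (akind w))"
    using Suc.IH[OF w(1)] phi_pos by (intro mult_left_mono) auto
  finally show ?case using kid_displacement[OF w(2)] by (simp add: algebra_simps)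
qed simp

lemma set_grandkids: "set (grandkids t) = (\<Union>s\<in>set (kids t). set (kids s))"
  by (simp add: grandkids_def)

lemma grandkids_place:
  "set (grandkids (place z d x)) = place (lphi (lphi (lphi (lphi z)))) d ` set (grandkids x)"
  unfolding set_grandkids kids_place by (simp add: kids_place image_UN)

section \<open>The mass of the eigenvalue 4\<close>

lemma adj_sym: "adj u v \<longleftrightarrow> adj v u" by (auto simp: adj_def)

lemma pent_kinds: "kind_weight 1 0 0 0 K = (if K \<in> {PAlpha, PBeta, PGamma} then 1 else 0)"
  by (cases K) simp_all

lemma pent_ring_window:
  assumes w: "window T n a b X" and p: "normal p" "akind p \<in> {PAlpha, PBeta, PGamma}" "set (grandkids p) \<subseteq> X"
    and inside: "norm (pt a b (lphi (lphi (lphi (lphi (apos p)))))) + 7 \<le> real n"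
  shows "ring_window T n a b X (lphi (lphi (lphi (lphi (apos p))))) (adir p)"
    and "u \<in> set ring \<Longrightarrow> place (lphi (lphi (lphi (lphi (apos p))))) (adir p) u \<in> set (grandkids p)"
proof -
  have mem: "place (lphi (lphi (lphi (lphi (apos p))))) (adir p) u \<in> set (grandkids p)" if "u \<in> set (ring @ ring_inner)" for u
  proof -
    have "akind p \<in> set [PAlpha, PBeta, PGamma]" using p(2) by simp
    then have "u \<in> set (grandkids (base (akind p)))"
      using ring_in_grandkids that unfolding list_all_iff ring_def by (simp only: append_assoc)
    then have "place (lphi (lphi (lphi (lphi (apos p))))) (adir p) u
        \<in> set (grandkids (place (apos p) (adir p) (base (akind p))))"
      unfolding grandkids_place by (rule imageI)
    then show ?thesis using place_self[OF p(1)] by simp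
  qed
  interpret window T n a b X by (rule w)
  show "ring_window T n a b X (lphi (lphi (lphi (lphi (apos p))))) (adir p)"
    by unfold_locales (use mem p(3) inside in blast)+
  assume "u \<in> set ring"
  then show "place (lphi (lphi (lphi (lphi (apos p))))) (adir p) u \<in> set (grandkids p)" by (intro mem) simp
qed

text \<open>The rings of the pentagons of one level are disjoint, so their number bounds the mass of the
  eigenvalue from below.\<close>
lemma atom_ge_pents:
  assumes w: "window T n a b X" and fin: "finite (tiles_upto T n)" "tiles_upto T n \<noteq> {}"
    and Y: "coherent Y" "finite Y" "kidset (kidset Y) \<subseteq> X"
    and inside: "\<And>p. p \<in> Y \<Longrightarrow> norm (pt a b (lphi (lphi (lphi (lphi (apos p)))))) + 7 \<le> real n"
  shows "finite_measure (spectral_measure (tiles_upto T n) adj)"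
    and "weight (kind_weight 1 0 0 0) Y / card (tiles_upto T n) \<le> measure (spectral_measure (tiles_upto T n) adj) {4}"
proof -
  interpret window T n a b X by (rule w)
  define J where "J = {p \<in> Y. akind p \<in> {PAlpha, PBeta, PGamma}}"
  define Z where "Z p = lphi (lphi (lphi (lphi (apos p))))" for p
  define F where "F p = ring_window.f a b (Z p) (adir p)" for p
  have gk: "set (grandkids p) \<subseteq> X" if "p \<in> Y" for p
    using Y(3) that unfolding set_grandkids kidset_def by blast
  have rw: "ring_window T n a b X (Z p) (adir p)" "u \<in> set ring \<Longrightarrow> place (Z p) (adir p) u \<in> set (grandkids p)"
    if "p \<in> J" for p u
  proof -
    have "p \<in> Y" "akind p \<in> {PAlpha, PBeta, PGamma}" using that by (simp_all add: J_def)
    moreover have "normal p" using Y(1) \<open>p \<in> Y\<close> by (simp add: coherent_def)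
    ultimately show "ring_window T n a b X (Z p) (adir p)" "u \<in> set ring \<Longrightarrow> place (Z p) (adir p) u \<in> set (grandkids p)"
      using pent_ring_window[OF w, of p] gk inside unfolding Z_def by blast+
  qed
  have J: "finite J" using Y(2) by (simp add: J_def)
  have e: "F p \<in> eigenspace V (laplacian V adj) 4" if "p \<in> J" for p
    unfolding F_def by (rule ring_window.ring_eigenfunction[OF rw(1)[OF that] fin(1)])
  have nz: "\<exists>v\<in>V. F p v \<noteq> 0" if "p \<in> J" for p
    unfolding F_def by (rule ring_window.f_nonzero[OF rw(1)[OF that]])
  have supp: "\<exists>y\<in>set (grandkids p). t = q y" if "p \<in> J" "F p t \<noteq> 0" for p t
    using ring_window.f_support[OF rw(1)[OF that(1)], of t] that(2) rw(2)[OF that(1)] unfolding F_def by blast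
  have disj: "F p t = 0 \<or> F p' t = 0" if pp: "p \<in> J" "p' \<in> J" "p \<noteq> p'" for p p' t
  proof (rule ccontr)
    assume "\<not> (F p t = 0 \<or> F p' t = 0)"
    then obtain y y' where y: "y \<in> set (grandkids p)" "t = q y" "y' \<in> set (grandkids p')" "t = q y'"
      using supp pp by metis
    have YY: "p \<in> Y" "p' \<in> Y" using pp by (simp_all add: J_def)
    have "y = y'" using inj_onD[OF inj_q, of y y'] y gk[OF YY(1)] gk[OF YY(2)] by auto
    then obtain s s' where s: "s \<in> set (kids p)" "y \<in> set (kids s)" "s' \<in> set (kids p')" "y \<in> set (kids s')"
      using y unfolding set_grandkids by blast
    then have "s \<in> kidset Y" "s' \<in> kidset Y" using YY by (auto simp: kidset_def)
    then have "s = s'" using disjoint_kids[OF coherent_kidset[OF Y(1)]] s by blast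
    then show False using disjoint_kids[OF Y(1) YY pp(3)] s by blast
  qed
  note sm = spectral_measure_atom_ge[of V adj J F 4, OF fin adj_sym J e nz disj]
  show "finite_measure (spectral_measure V adj)" by (rule sm(1)) 
  have "weight (kind_weight 1 0 0 0) Y = (\<Sum>x\<in>Y. if akind x \<in> {PAlpha, PBeta, PGamma} then 1 else 0)"
    by (simp only: weight_def pent_kinds)
  also have "\<dots> = real (card J)" using Y(2) by (simp add: J_def sum.If_cases Int_def)
  finally show "weight (kind_weight 1 0 0 0) Y / card V \<le> measure (spectral_measure V adj) {4}"
    using sm(2) by simp
qed

text \<open>Cut the supertile that realizes the window into supertiles of level \<open>i + 2\<close> and keep those whose
  centres are well inside the ball. All rings of pentagons at level 2 of these lie inside the window. A
  tile of the window outside the kept supertiles is within \<open>2 * D + 7\<close> of the boundary of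
  the ball.\<close>
lemma supertile_stage:
  fixes \<kappa> :: real
  assumes T: "boat_star_tiling T" and dens: "\<And>Z. coherent Z \<Longrightarrow> finite Z \<Longrightarrow>
      \<kappa> * card ((kidset ^^ (i + 2)) Z) \<le> weight (kind_weight 1 0 0 0) ((kidset ^^ i) Z)"
    and \<kappa>: "0 \<le> \<kappa>"
  defines "D \<equiv> (phi * phi) ^ (i + 2) * phi"
  assumes n: "2 * D + 8 \<le> real n" "4 * 11 ^ (i + 2) < (real n)\<^sup>2"
  shows "finite_measure (spectral_measure (tiles_upto T n) adj)"
    and "\<kappa> * (card (tiles_upto T n) - (2 * D + 11) * (2 * real n + 2) / (rho / 2)\<^sup>2) / card (tiles_upto T n)
      \<le> measure (spectral_measure (tiles_upto T n) adj) {4}"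
    and "(real n)\<^sup>2 \<le> 4 * card (tiles_upto T n)"
proof -
  define V where "V = tiles_upto T n"
  have cover: "(\<Union>t\<in>T. region t) = UNIV" using T by (simp add: boat_star_tiling_def is_tiling_def)
  have finV: "finite V" unfolding V_def by (rule finite_tiles_upto[OF T])
  have "V \<subseteq> T" by (auto simp: V_def tiles_upto_def)
  then obtain a b K N where a: "norm a = rho" and real: "V \<subseteq> conc a b ` ((kidset ^^ N) {base K})"
    using patch_realized[OF T finV] by blast
  define X where "X = (kidset ^^ N) {base K}"
  have X: "coherent X" "finite X" by (simp_all add: X_def coherent_supertile finite_supertile)
  interpret window T n a b X
    by unfold_locales (use cover a X real in \<open>simp_all add: X_def V_def\<close>)
  show area: "(real n)\<^sup>2 \<le> 4 * card (tiles_upto T n)" by (rule window_area) (use finV in \<open>simp add: V_def\<close>)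
  have cardX: "card ((kidset ^^ m) {x}) \<le> 11 ^ m" for m x
  proof (induction m)
    case (Suc m)
    have "card (kidset ((kidset ^^ m) {x})) \<le> (\<Sum>y\<in>(kidset ^^ m) {x}. card (set (kids y)))"
      unfolding kidset_def[of "(kidset ^^ m) {x}"] by (rule card_UN_le) (simp add: finite_iterate)
    also have "\<dots> \<le> (\<Sum>y\<in>(kidset ^^ m) {x}. 11)"
    proof (rule sum_mono)
      fix y
      have "length (kids0 L) \<le> 11" for L by (cases L) (simp_all add: atip_def)
      then have "length (kids y) \<le> 11" by (cases y) simp
      then show "card (set (kids y)) \<le> 11" using card_length[of "kids y"] by linarith
    qed
    also have "\<dots> \<le> 11 ^ Suc m" using Suc by simp
    finally show ?case by simp
  qed simp
  \<comment> \<open>Otherwise the supertile has fewer tiles than the window.\<close>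
  have "i + 2 \<le> N"
  proof (rule ccontr)
    assume "\<not> i + 2 \<le> N"
    then have "(11::nat) ^ N \<le> 11 ^ (i + 2)" by (intro power_increasing) auto
    moreover have "card V \<le> card X" by (rule surj_card_le[OF X(2)]) (use real in \<open>simp add: X_def\<close>)
    ultimately have "card V \<le> 11 ^ (i + 2)" using cardX[of N "base K"] unfolding X_def by linarith
    then have "real (card V) \<le> 11 ^ (i + 2)" by (metis of_nat_le_iff of_nat_numeral of_nat_power)
    then show False using area n(2) unfolding V_def by simp
  qed
  then obtain M where N: "N = (i + 2) + M" using le_Suc_ex by blast
  define U where "U = (kidset ^^ M) {base K}"
  have U: "coherent U" "finite U" by (simp_all add: U_def coherent_supertile finite_supertile)
  have XU: "X = (kidset ^^ (i + 2)) U" by (simp only: X_def U_def N funpow_add o_apply)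
  define \<sigma> :: real where "\<sigma> = (phi * phi) ^ (i + 2)"
  \<comment> \<open>The number 7 is the margin of \<open>ring_window\<close>, and \<open>D\<close> bounds the radius of a supertile of level \<open>i + 2\<close>.\<close>
  define Zs where "Zs = {x \<in> U. norm (b + a * (\<sigma> * ev (apos x))) \<le> real n - D - 7}"
  have Zs: "coherent Zs" "finite Zs" "Zs \<subseteq> U" using U by (auto simp: Zs_def coherent_def)
  define Y where "Y = (kidset ^^ i) Zs"
  have Y: "coherent Y" "finite Y" by (simp_all add: Y_def coherent_iterate finite_iterate Zs)
  have YY: "kidset (kidset Y) = (kidset ^^ (i + 2)) Zs" by (simp add: Y_def)
  have sub: "kidset (kidset Y) \<subseteq> X" unfolding YY XU by (rule iterate_mono[OF Zs(3)])
  have lam: "\<sigma> \<ge> 0" using phi_pos by (simp add: \<sigma>_def)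
  have D: "rho * (\<sigma> * rad L) \<le> D" for L
  proof -
    have "rho * (\<sigma> * rad L) \<le> 1 * (\<sigma> * phi)"
      using rho_less_1 rad_le[of L] rad_pos[of L] lam rho_pos by (intro mult_mono mult_nonneg_nonneg) auto
    then show ?thesis by (simp add: D_def \<sigma>_def)
  qed
  have inside: "norm (pt a b (lphi (lphi (lphi (lphi (apos p)))))) + 7 \<le> real n" if "p \<in> Y" for p
  proof -
    obtain x where x: "x \<in> Zs" "p \<in> (kidset ^^ i) {x}" using \<open>p \<in> Y\<close> unfolding Y_def iterate_UN[of i Zs] by blast
    let ?P = "complex_of_real phi * phi"
    have "norm (ev (apos p) - ?P ^ i * ev (apos x)) \<le> (phi * phi) ^ i * rad (akind x) - rad (akind p)"
      by (rule iterate_displacement[OF x(2)])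
    then have "norm (ev (apos p) - ?P ^ i * ev (apos x)) \<le> (phi * phi) ^ i * rad (akind x)"
      using rad_pos[of "akind p"] by linarith
    then have "(phi * phi) ^ 2 * norm (ev (apos p) - ?P ^ i * ev (apos x)) \<le> (phi * phi) ^ 2 * ((phi * phi) ^ i * rad (akind x))"
      by (intro mult_left_mono) auto
    also have "\<dots> = \<sigma> * rad (akind x)" by (simp add: \<sigma>_def power_add power2_eq_square mult_ac)
    also have "(phi * phi) ^ 2 * norm (ev (apos p) - ?P ^ i * ev (apos x)) = norm (?P ^ 2 * ev (apos p) - \<sigma> * ev (apos x))"
    proof -
      have "?P ^ 2 * ev (apos p) - \<sigma> * ev (apos x) = ?P ^ 2 * (ev (apos p) - ?P ^ i * ev (apos x))"
        by (simp add: \<sigma>_def power_add power2_eq_square right_diff_distrib mult_ac)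
      then show ?thesis using phi_pos by (simp add: norm_mult norm_power power_mult_distrib)
    qed
    finally have d: "norm (?P ^ 2 * ev (apos p) - \<sigma> * ev (apos x)) \<le> \<sigma> * rad (akind x)" .
    have "pt a b (lphi (lphi (lphi (lphi (apos p))))) = (b + a * (\<sigma> * ev (apos x))) + a * (?P ^ 2 * ev (apos p) - \<sigma> * ev (apos x))"
      by (simp add: pt_def ev_phi power2_eq_square algebra_simps)
    then have "norm (pt a b (lphi (lphi (lphi (lphi (apos p)))))) \<le> norm (b + a * (\<sigma> * ev (apos x))) + norm (a * (?P ^ 2 * ev (apos p) - \<sigma> * ev (apos x)))"
      by (rule norm_sum_split)
    also have "norm (a * (?P ^ 2 * ev (apos p) - \<sigma> * ev (apos x))) \<le> rho * (\<sigma> * rad (akind x))"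
      unfolding norm_mult a using d rho_pos by (intro mult_left_mono) auto
    finally show ?thesis using D[of "akind x"] x(1) by (simp add: Zs_def)
  qed
  have "(0::real) < 4 * 11 ^ (i + 2)" by simp
  then have "real (card V) > 0" using area n(2) unfolding V_def by linarith
  then have Vne: "V \<noteq> {}" by auto
  note at = atom_ge_pents[OF window_axioms finV[unfolded V_def] Vne[unfolded V_def] Y sub inside]
  show "finite_measure (spectral_measure (tiles_upto T n) adj)" by (rule at(1))
  \<comment> \<open>The tiles of the window that belong to none of the kept supertiles.\<close>
  define A where "A = {y \<in> X. q y \<in> V \<and> y \<notin> kidset (kidset Y)}"
  have A: "A \<subseteq> X" "finite A" using X(2) by (simp_all add: A_def)
  have Anorm: "real n - 2 * D - 7 < norm (pt a b (apos y))" "norm (pt a b (apos y)) \<le> real n + 2" if "y \<in> A" for y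
  proof -
    have y: "y \<in> X" "q y \<in> V" "y \<notin> (kidset ^^ (i + 2)) Zs" using that unfolding A_def YY by blast+
    show "norm (pt a b (apos y)) \<le> real n + 2"
      by (rule conc_touching[OF a]) (use y(2) in \<open>simp add: V_def tiles_upto_def\<close>)
    obtain x where x: "x \<in> U" "y \<in> (kidset ^^ (i + 2)) {x}" using y(1) unfolding XU iterate_UN[of "i + 2" U] by blast
    have "x \<notin> Zs"
    proof
      assume "x \<in> Zs"
      then have "(kidset ^^ (i + 2)) {x} \<subseteq> (kidset ^^ (i + 2)) Zs" by (intro iterate_mono) simp
      then show False using x(2) y(3) by blast
    qed
    then have far: "real n - D - 7 < norm (b + a * (\<sigma> * ev (apos x)))" using x(1) by (simp add: Zs_def)
    let ?P = "complex_of_real phi * phi"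
    have "norm (ev (apos y) - ?P ^ (i + 2) * ev (apos x)) \<le> (phi * phi) ^ (i + 2) * rad (akind x) - rad (akind y)"
      by (rule iterate_displacement[OF x(2)])
    moreover have "?P ^ (i + 2) = \<sigma>" by (simp only: \<sigma>_def of_real_power of_real_mult)
    ultimately have "norm (ev (apos y) - \<sigma> * ev (apos x)) \<le> \<sigma> * rad (akind x) - rad (akind y)"
      by (simp only: \<sigma>_def[symmetric])
    then have "norm (ev (apos y) - \<sigma> * ev (apos x)) \<le> \<sigma> * rad (akind x)"
      using rad_pos[of "akind y"] by linarith
    then have "norm (a * (\<sigma> * ev (apos x) - ev (apos y))) \<le> rho * (\<sigma> * rad (akind x))"
      unfolding norm_mult a using rho_pos by (intro mult_left_mono) (auto simp: norm_minus_commute)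
    moreover have "b + a * (\<sigma> * ev (apos x)) = pt a b (apos y) + a * (\<sigma> * ev (apos x) - ev (apos y))"
      by (simp add: pt_def algebra_simps)
    then have "norm (b + a * (\<sigma> * ev (apos x))) \<le> norm (pt a b (apos y)) + norm (a * (\<sigma> * ev (apos x) - ev (apos y)))"
      by (rule norm_sum_split)
    ultimately show "real n - 2 * D - 7 < norm (pt a b (apos y))" using far D[of "akind x"] by linarith
  qed
  have D0: "D \<ge> 0" using phi_pos by (simp add: D_def)
  have "card A * (rho / 2)\<^sup>2 \<le> (real n + 2 + 1)\<^sup>2 - (real n - 2 * D - 7 - 1)\<^sup>2"
    by (rule annulus_count[OF X(1) a A]) (use n(1) D0 Anorm in auto)
  also have "\<dots> = (2 * D + 11) * (2 * real n - 2 * D - 5)"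
    by (simp add: power2_eq_square algebra_simps)
  also have "\<dots> \<le> (2 * D + 11) * (2 * real n + 2)" using D0 by (intro mult_left_mono) auto
  finally have cA: "real (card A) \<le> (2 * D + 11) * (2 * real n + 2) / (rho / 2)\<^sup>2"
    using rho_pos by (subst pos_le_divide_eq) simp_all
  have "V \<subseteq> q ` (kidset (kidset Y) \<union> A)"
  proof
    fix t assume t: "t \<in> V"
    then obtain y where "y \<in> X" "t = q y" using real unfolding X_def by blast
    with t show "t \<in> q ` (kidset (kidset Y) \<union> A)" unfolding A_def by blast
  qed
  then have "card V \<le> card (kidset (kidset Y) \<union> A)"
    using surj_card_le[of "kidset (kidset Y) \<union> A" V q] A(2) Y(2) finite_kidset by blast
  also have "\<dots> \<le> card (kidset (kidset Y)) + card A" by (rule card_Un_le)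
  finally have "real (card V) - (2 * D + 11) * (2 * real n + 2) / (rho / 2)\<^sup>2 \<le> card ((kidset ^^ (i + 2)) Zs)"
    using cA unfolding YY by linarith
  then have "\<kappa> * (card V - (2 * D + 11) * (2 * real n + 2) / (rho / 2)\<^sup>2) \<le> \<kappa> * card ((kidset ^^ (i + 2)) Zs)"
    using \<kappa> by (rule mult_left_mono)
  also have "\<dots> \<le> weight (kind_weight 1 0 0 0) Y" unfolding Y_def by (rule dens[OF Zs(1,2)])
  finally have "\<kappa> * (card V - (2 * D + 11) * (2 * real n + 2) / (rho / 2)\<^sup>2) / card V \<le> weight (kind_weight 1 0 0 0) Y / card V"
    by (rule divide_right_mono) simp
  also have "\<dots> \<le> measure (spectral_measure V adj) {4}" using at(2) unfolding V_def .
  finally show "\<kappa> * (card (tiles_upto T n) - (2 * D + 11) * (2 * real n + 2) / (rho / 2)\<^sup>2) / card (tiles_upto T n)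
      \<le> measure (spectral_measure (tiles_upto T n) adj) {4}" unfolding V_def .
qed

text \<open>First choose the level so that the density of pentagons is close to its limit, then the ball so
  large that the annulus near its boundary is negligible.\<close>
lemma atom_asymptotics:
  assumes T: "boat_star_tiling T" and \<epsilon>: "\<epsilon> > 0"
  shows "\<forall>\<^sub>F n in sequentially. finite_measure (spectral_measure (tiles_upto T n) adj) \<and>
      sets (spectral_measure (tiles_upto T n) adj) = sets borel \<and>
      ring_freq - \<epsilon> \<le> measure (spectral_measure (tiles_upto T n) adj) {4}"
proof -
  define \<delta> where "\<delta> = min (\<epsilon> / 2) ring_freq"
  have rf: "ring_freq > 0" "ring_freq \<le> 1" using phi_bounds by (simp_all add: ring_freq_phi)
  have \<delta>: "\<delta> > 0" "\<delta> \<le> \<epsilon> / 2" "\<delta> \<le> ring_freq" using \<epsilon> rf by (simp_all add: \<delta>_def)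
  obtain i where i: "\<forall>Z. coherent Z \<longrightarrow> finite Z \<longrightarrow>
    (ring_freq - \<delta>) * card ((kidset ^^ (i + 2)) Z) \<le> weight (kind_weight 1 0 0 0) ((kidset ^^ i) Z)"
    using pent_density[OF \<delta>(1)] by (elim exE) (rule that)
  define D where "D = (phi * phi) ^ (i + 2) * phi"
  define E where "E = (2 * D + 11) / (rho / 2)\<^sup>2"
  have "D \<ge> 0" using phi_pos by (simp add: D_def)
  then have E: "E \<ge> 0" by (simp add: E_def)
  have "\<forall>\<^sub>F n in sequentially. 2 * D + 8 \<le> real n" by real_asymp
  moreover have "\<forall>\<^sub>F n in sequentially. 4 * 11 ^ (i + 2) < (real n)\<^sup>2" by real_asymp
  moreover have "\<forall>\<^sub>F n in sequentially. 4 * E * (2 * real n + 2) \<le> \<epsilon> / 2 * (real n)\<^sup>2" using \<epsilon> by real_asymp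
  ultimately show ?thesis
  proof eventually_elim
    case (elim n)
    let ?V = "tiles_upto T n"
    have dens: "(ring_freq - \<delta>) * card ((kidset ^^ (i + 2)) Z) \<le> weight (kind_weight 1 0 0 0) ((kidset ^^ i) Z)"
      if "coherent Z" "finite Z" for Z using i that by blast
    have "0 \<le> ring_freq - \<delta>" using \<delta>(3) by simp
    note st = supertile_stage[OF T dens this elim(1)[unfolded D_def] elim(2), folded D_def]
    have "(0::real) < 4 * 11 ^ (i + 2)" by simp
    then have V0: "real (card ?V) > 0" using st(3) elim(2) by linarith
    have sets: "sets (spectral_measure ?V adj) = sets borel"
      by (rule spectral_measure_finite_sum(1)[OF finite_tiles_upto[OF T] adj_sym])
    have e: "(2 * D + 11) * (2 * real n + 2) / (rho / 2)\<^sup>2 = E * (2 * real n + 2)" by (simp add: E_def)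
    have "4 * (E * (2 * real n + 2)) \<le> \<epsilon> / 2 * (4 * card ?V)"
    proof -
      have "\<epsilon> / 2 * (real n)\<^sup>2 \<le> \<epsilon> / 2 * (4 * card ?V)" using st(3) \<epsilon> by (intro mult_left_mono) auto
      then show ?thesis using elim(3) by linarith
    qed
    then have 1: "E * (2 * real n + 2) \<le> \<epsilon> / 2 * card ?V" by simp
    have "(ring_freq - \<delta>) * (E * (2 * real n + 2)) \<le> 1 * (E * (2 * real n + 2))"
      using E rf \<delta> by (intro mult_right_mono) auto
    then have "(ring_freq - \<delta>) * (E * (2 * real n + 2)) \<le> \<epsilon> / 2 * card ?V" using 1 by simp
    moreover have "(ring_freq - \<epsilon> / 2) * card ?V \<le> (ring_freq - \<delta>) * card ?V"
      using \<delta>(2) by (intro mult_right_mono) auto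
    ultimately have "(ring_freq - \<epsilon>) * card ?V \<le> (ring_freq - \<delta>) * (card ?V - E * (2 * real n + 2))"
      by (simp add: algebra_simps)
    then have "ring_freq - \<epsilon> \<le> (ring_freq - \<delta>) * (card ?V - E * (2 * real n + 2)) / card ?V"
      using V0 by (simp add: pos_le_divide_eq)
    then show ?case using st(1) order_trans[OF _ st(2)[unfolded e]] sets by blast
  qed
qed

theorem theorem1p4:
  fixes T :: "tile set" and \<nu> :: "real measure"
  assumes "boat_star_tiling T"
    and "density_of_states T \<nu>"
  shows "Lim (at_right 4) (ids \<nu>) - Lim (at_left 4) (ids \<nu>) \<ge> (65 - 29 * sqrt 5) / 10"
proof -
  have "ring_freq \<le> measure \<nu> {4}"
    by (rule atom_ge_of_vague_limit[OF assms(2) atom_asymptotics[OF assms(1)]])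
  moreover have "real_distribution \<nu>" using assms(2) by (simp add: density_of_states_def)
  ultimately show ?thesis using jump_of_ids[of \<nu> 4] by (simp add: ring_freq_def)
qed

end
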